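(* Let $G$ be a cyclic group of order $n$ and $K$ a field of characteristic $0$. Then every pair $(U,\chi)$ with $U\le G$ and $\chi\in\mathrm{Irr}_K(\mathrm{Aut}(U))$ lies in $\mathcal{E}_G$. The primitive central idempotents of $KB^{\lhd}(G,G)$ are parametrized by $\mathrm{Irr}_K(\mathrm{Aut}(G))$: for $\vartheta\in\mathrm{Irr}_K(\mathrm{Aut}(G))$ the corresponding primitive central idempotent is $\sum e_{(U,\chi)}$, the sum over all $(U,\chi)\in\mathcal{E}_G$ with $\vartheta=\chi\circ p_{|U|,n}$.
   Context: Since $G$ is cyclic, it has exactly one subgroup of each order dividing $n$, so every subgroup is its own representative; for abelian $U$, $\mathrm{Out}(U)=\mathrm{Aut}(U)$. For $k\mid k'$ and cyclic groups $U$ of order $k$, $U'$ of order $k'$, $p_{k,k'}\colon\mathrm{Aut}(U')\to\mathrm{Aut}(U)$ is the surjection sending $u'\mapsto u'^i$ to $u\mapsto u^i$ ($i$ coprime to $k'$). Finite $(G,G)$-bisets are left $G\times G$-sets via $(g,h)x=gxh^{-1}$; $B(G,G)$ is their Grothendieck group with product induced by $X\times_G Y$; $B^{\lhd}(G,G)$ (resp. $B^\Delta(G,G)$) is spanned by bisets with point stabilizers $L$ satisfying $k_1(L)=1$ (resp. $k_1(L)=k_2(L)=1$), $k_1(L)=\{g\mid(g,1)\in L\}$, $k_2(L)=\{g\mid(1,g)\in L\}$; $KB^\bullet=K\otimes B^\bullet$. $\Phi_L([X])=|X^L|$. $\mathrm{Inj}(U,G)$: injective homomorphisms $U\to G$,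 $G$ acting by $\lambda\mapsto c_g\lambda$, $\mathrm{Aut}(U)$ on the right; $\overline{\mathrm{Inj}}(U,G)=G\backslash\mathrm{Inj}(U,G)$. The map $\sigma_G\colon KB^\Delta(G,G)\to\prod_{U\le G}\mathrm{End}_{K\mathrm{Out}(U)}(K\overline{\mathrm{Inj}}(U,G))$, $a\mapsto([\mu]\mapsto\sum_{[\lambda]}\Phi_{\{(\lambda(u),\mu(u))\}}(a)|C_G(\lambda(U))|^{-1}[\lambda])_U$, is a $K$-algebra isomorphism. $\mathrm{Irr}_K(H)$: characters of simple $KH$-modules. $\mathcal{E}_G$: pairs $(U,\chi)$, $U\le G$, $\chi\in\mathrm{Irr}_K(\mathrm{Out}(U))$ a constituent of the character of $K\overline{\mathrm{Inj}}(U,G)$; $e_{(U,\chi)}\in KB^\Delta(G,G)$ is the element whose image under $\sigma_G$ has $U'$-component $0$ for $U'\neq U$ and $U$-component right multiplication by the central primitive idempotent of $K\mathrm{Out}(U)$ belonging to $\chi$. *)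

theory Defs
  imports "HOL-Algebra.Algebra" "Jordan_Normal_Form.Matrix"
begin

definition mat_tr :: "'k::comm_ring_1 mat \<Rightarrow> 'k" where
  "mat_tr A = (\<Sum>i<dim_row A. A $$ (i,i))"

definition is_rep :: "('h,'c) monoid_scheme \<Rightarrow> nat \<Rightarrow> ('h \<Rightarrow> 'k::field mat) \<Rightarrow> bool" where
  "is_rep H m \<rho> \<longleftrightarrow>
     (\<forall>h\<in>carrier H. \<rho> h \<in> carrier_mat m m) \<and>
     (\<forall>h\<in>carrier H. \<forall>h'\<in>carrier H. \<rho> (h \<otimes>\<^bsub>H\<^esub> h') = \<rho> h * \<rho> h') \<and>
     \<rho> \<one>\<^bsub>H\<^esub> = 1\<^sub>m m"

definition invariant_subspace :: "('h,'c) monoid_scheme \<Rightarrow> nat \<Rightarrow> ('h \<Rightarrow> 'k::field mat) \<Rightarrow> 'k vec set \<Rightarrow> bool" where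
  "invariant_subspace H m \<rho> W \<longleftrightarrow>
     W \<subseteq> carrier_vec m \<and> 0\<^sub>v m \<in> W \<and>
     (\<forall>v\<in>W. \<forall>w\<in>W. v + w \<in> W) \<and> (\<forall>c. \<forall>v\<in>W. c \<cdot>\<^sub>v v \<in> W) \<and>
     (\<forall>h\<in>carrier H. \<forall>v\<in>W. \<rho> h *\<^sub>v v \<in> W)"

definition simple_rep :: "('h,'c) monoid_scheme \<Rightarrow> nat \<Rightarrow> ('h \<Rightarrow> 'k::field mat) \<Rightarrow> bool" where
  "simple_rep H m \<rho> \<longleftrightarrow> is_rep H m \<rho> \<and> m > 0 \<and>
     (\<forall>W. invariant_subspace H m \<rho> W \<longrightarrow> W = {0\<^sub>v m} \<or> W = carrier_vec m)"

definition character :: "('h,'c) monoid_scheme \<Rightarrow> ('h \<Rightarrow> 'k::field mat) \<Rightarrow> 'h \<Rightarrow> 'k" where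
  "character H \<rho> = (\<lambda>h. if h \<in> carrier H then mat_tr (\<rho> h) else 0)"

definition irr_chars :: "('h,'c) monoid_scheme \<Rightarrow> ('h \<Rightarrow> 'k::field) set" where
  "irr_chars H = {\<chi>. \<exists>m \<rho>. simple_rep H m \<rho> \<and> \<chi> = character H \<rho>}"

definition central_idem :: "('x \<Rightarrow> 'k::field) set \<Rightarrow> (('x \<Rightarrow> 'k) \<Rightarrow> ('x \<Rightarrow> 'k) \<Rightarrow> ('x \<Rightarrow> 'k)) \<Rightarrow> ('x \<Rightarrow> 'k) \<Rightarrow> bool" where
  "central_idem A mul e \<longleftrightarrow> e \<in> A \<and> mul e e = e \<and> (\<forall>a\<in>A. mul a e = mul e a)"

definition primitive_central_idem :: "('x \<Rightarrow> 'k::field) set \<Rightarrow> (('x \<Rightarrow> 'k) \<Rightarrow> ('x \<Rightarrow> 'k) \<Rightarrow> ('x \<Rightarrow> 'k)) \<Rightarrow> ('x \<Rightarrow> 'k) \<Rightarrow> bool" where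
  "primitive_central_idem A mul e \<longleftrightarrow> central_idem A mul e \<and> e \<noteq> (\<lambda>_. 0) \<and>
     \<not> (\<exists>e1 e2. central_idem A mul e1 \<and> central_idem A mul e2 \<and> e1 \<noteq> (\<lambda>_. 0) \<and> e2 \<noteq> (\<lambda>_. 0) \<and>
            mul e1 e2 = (\<lambda>_. 0) \<and> e = (\<lambda>x. e1 x + e2 x))"

definition group_alg :: "('h,'c) monoid_scheme \<Rightarrow> ('h \<Rightarrow> 'k::field) set" where
  "group_alg H = {x. \<forall>h. h \<notin> carrier H \<longrightarrow> x h = 0}"

definition group_alg_mult :: "('h,'c) monoid_scheme \<Rightarrow> ('h \<Rightarrow> 'k::field) \<Rightarrow> ('h \<Rightarrow> 'k) \<Rightarrow> ('h \<Rightarrow> 'k)" where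
  "group_alg_mult H x y = (\<lambda>h. if h \<in> carrier H
      then (\<Sum>a\<in>carrier H. x a * y (inv\<^bsub>H\<^esub> a \<otimes>\<^bsub>H\<^esub> h)) else 0)"

definition cpi_of :: "('h,'c) monoid_scheme \<Rightarrow> ('h \<Rightarrow> 'k::field) \<Rightarrow> ('h \<Rightarrow> 'k)" where
  "cpi_of H \<chi> = (THE e. primitive_central_idem (group_alg H) (group_alg_mult H) e \<and>
      (\<exists>m \<rho>. simple_rep H m \<rho> \<and> character H \<rho> = \<chi> \<and>
             mat m m (\<lambda>(i,j). \<Sum>h\<in>carrier H. e h * \<rho> h $$ (i,j)) = 1\<^sub>m m))"

abbreviation GG :: "('g,'c) monoid_scheme \<Rightarrow> ('g \<times> 'g) monoid" where
  "GG G \<equiv> G \<times>\<times> G"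

definition k1 :: "('g,'c) monoid_scheme \<Rightarrow> ('g \<times> 'g) set \<Rightarrow> 'g set" where
  "k1 G L = {g \<in> carrier G. (g, \<one>\<^bsub>G\<^esub>) \<in> L}"

definition k2 :: "('g,'c) monoid_scheme \<Rightarrow> ('g \<times> 'g) set \<Rightarrow> 'g set" where
  "k2 G L = {g \<in> carrier G. (\<one>\<^bsub>G\<^esub>, g) \<in> L}"

text \<open>The transitive biset (G x G)/L, realised as the set of left cosets of L;
  (g,h) acts by left translation, i.e. (g,h) x = g x h^-1.\<close>
definition cosets :: "('g,'c) monoid_scheme \<Rightarrow> ('g \<times> 'g) set \<Rightarrow> ('g \<times> 'g) set set" where
  "cosets G L = (\<lambda>p. p <#\<^bsub>GG G\<^esub> L) ` carrier (GG G)"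

text \<open>Elements of X \<times>_G Y for X = (GxG)/L, Y = (GxG)/M: classes of pairs (x,y) under
  (x g, y) ~ (x, g y), where x g = (1,g^-1) x and g y = (g,1) y.\<close>
definition tens_class :: "('g,'c) monoid_scheme \<Rightarrow> ('g \<times> 'g) set \<Rightarrow> ('g \<times> 'g) set
     \<Rightarrow> (('g \<times> 'g) set \<times> ('g \<times> 'g) set) set" where
  "tens_class G x y = {((\<one>\<^bsub>G\<^esub>, g) <#\<^bsub>GG G\<^esub> x, (g, \<one>\<^bsub>G\<^esub>) <#\<^bsub>GG G\<^esub> y) | g. g \<in> carrier G}"

definition tens :: "('g,'c) monoid_scheme \<Rightarrow> ('g \<times> 'g) set \<Rightarrow> ('g \<times> 'g) set
     \<Rightarrow> (('g \<times> 'g) set \<times> ('g \<times> 'g) set) set set" where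
  "tens G L M = {tens_class G x y | x y. x \<in> cosets G L \<and> y \<in> cosets G M}"

text \<open>(a,b) [x,y] = [a x, y b^-1] = [(a,1) x, (1,b) y].\<close>
definition tens_act :: "('g,'c) monoid_scheme \<Rightarrow> 'g \<times> 'g
     \<Rightarrow> (('g \<times> 'g) set \<times> ('g \<times> 'g) set) set \<Rightarrow> (('g \<times> 'g) set \<times> ('g \<times> 'g) set) set" where
  "tens_act G p T = (\<lambda>(x,y). ((fst p, \<one>\<^bsub>G\<^esub>) <#\<^bsub>GG G\<^esub> x, (\<one>\<^bsub>G\<^esub>, snd p) <#\<^bsub>GG G\<^esub> y)) ` T"

definition tens_stab :: "('g,'c) monoid_scheme \<Rightarrow> (('g \<times> 'g) set \<times> ('g \<times> 'g) set) set \<Rightarrow> ('g \<times> 'g) set" where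
  "tens_stab G T = {p \<in> carrier (GG G). tens_act G p T = T}"

definition tens_orbits :: "('g,'c) monoid_scheme \<Rightarrow> ('g \<times> 'g) set \<Rightarrow> ('g \<times> 'g) set
     \<Rightarrow> (('g \<times> 'g) set \<times> ('g \<times> 'g) set) set set set" where
  "tens_orbits G L M = {(\<lambda>p. tens_act G p T) ` carrier (GG G) | T. T \<in> tens G L M}"

text \<open>Coefficient of [(GxG)/N] in [(GxG)/L \<times>_G (GxG)/M]: the number of orbits with
  point stabilizer N (G abelian, so isomorphism classes of transitive GxG-sets
  correspond to subgroups of GxG).\<close>
definition bmult_coeff :: "('g,'c) monoid_scheme \<Rightarrow> ('g \<times> 'g) set \<Rightarrow> ('g \<times> 'g) set \<Rightarrow> ('g \<times> 'g) set \<Rightarrow> nat" where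
  "bmult_coeff G L M N = card {Ob \<in> tens_orbits G L M. \<exists>T\<in>Ob. tens_stab G T = N}"

text \<open>KB(G,G): K-linear combinations of the basis elements [(GxG)/L], L \<le> GxG.\<close>
definition KB :: "('g,'c) monoid_scheme \<Rightarrow> (('g \<times> 'g) set \<Rightarrow> 'k::field) set" where
  "KB G = {a. \<forall>L. a L \<noteq> 0 \<longrightarrow> subgroup L (GG G)}"

definition KB_lhd :: "('g,'c) monoid_scheme \<Rightarrow> (('g \<times> 'g) set \<Rightarrow> 'k::field) set" where
  "KB_lhd G = {a. \<forall>L. a L \<noteq> 0 \<longrightarrow> subgroup L (GG G) \<and> k1 G L = {\<one>\<^bsub>G\<^esub>}}"

definition KB_Delta :: "('g,'c) monoid_scheme \<Rightarrow> (('g \<times> 'g) set \<Rightarrow> 'k::field) set" where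
  "KB_Delta G = {a. \<forall>L. a L \<noteq> 0 \<longrightarrow> subgroup L (GG G) \<and> k1 G L = {\<one>\<^bsub>G\<^esub>} \<and> k2 G L = {\<one>\<^bsub>G\<^esub>}}"

definition bmult :: "('g,'c) monoid_scheme \<Rightarrow> (('g \<times> 'g) set \<Rightarrow> 'k::field) \<Rightarrow> (('g \<times> 'g) set \<Rightarrow> 'k) \<Rightarrow> (('g \<times> 'g) set \<Rightarrow> 'k)" where
  "bmult G a b = (\<lambda>N. \<Sum>L\<in>{L. subgroup L (GG G)}. \<Sum>M\<in>{M. subgroup M (GG G)}.
       a L * b M * of_nat (bmult_coeff G L M N))"

text \<open>Mark Phi_L([X]) = |X^L|, extended linearly.\<close>
definition Phi :: "('g,'c) monoid_scheme \<Rightarrow> ('g \<times> 'g) set \<Rightarrow> (('g \<times> 'g) set \<Rightarrow> 'k::field) \<Rightarrow> 'k" where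
  "Phi G L a = (\<Sum>M\<in>{M. subgroup M (GG G)}.
       a M * of_nat (card {C \<in> cosets G M. \<forall>p\<in>L. p <#\<^bsub>GG G\<^esub> C = C}))"

definition Inj :: "('g,'c) monoid_scheme \<Rightarrow> 'g set \<Rightarrow> ('g \<Rightarrow> 'g) set" where
  "Inj G U = {f \<in> extensional U. f \<in> hom (G\<lparr>carrier := U\<rparr>) G \<and> inj_on f U}"

definition AutG :: "('g,'c) monoid_scheme \<Rightarrow> 'g set \<Rightarrow> ('g \<Rightarrow> 'g) monoid" where
  "AutG G U = AutoGroup (G\<lparr>carrier := U\<rparr>)"

definition Delta :: "'g set \<Rightarrow> ('g \<Rightarrow> 'g) \<Rightarrow> ('g \<Rightarrow> 'g) \<Rightarrow> ('g \<times> 'g) set" where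
  "Delta U la mu = {(la u, mu u) | u. u \<in> U}"

definition centralizer_card :: "('g,'c) monoid_scheme \<Rightarrow> 'g set \<Rightarrow> nat" where
  "centralizer_card G S = card {g \<in> carrier G. \<forall>x\<in>S. g \<otimes>\<^bsub>G\<^esub> x = x \<otimes>\<^bsub>G\<^esub> g}"

text \<open>chi is a constituent of the character of the permutation module K Inj(U,G)
  (right Out(U)-action lambda.alpha = lambda o alpha, turned into a left module via
  alpha . P = P . alpha^-1): there is an injective KOut(U)-homomorphism from a simple
  module with character chi into K Inj(U,G).\<close>
definition constituent_Inj :: "('g,'c) monoid_scheme \<Rightarrow> 'g set \<Rightarrow> (('g \<Rightarrow> 'g) \<Rightarrow> 'k::field) \<Rightarrow> bool" where
  "constituent_Inj G U \<chi> \<longleftrightarrow> (\<exists>m \<rho> (f :: 'k vec \<Rightarrow> ('g \<Rightarrow> 'g) \<Rightarrow> 'k).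
     simple_rep (AutG G U) m \<rho> \<and> character (AutG G U) \<rho> = \<chi> \<and>
     (\<forall>v\<in>carrier_vec m. \<forall>l. l \<notin> Inj G U \<longrightarrow> f v l = 0) \<and>
     (\<forall>v\<in>carrier_vec m. \<forall>w\<in>carrier_vec m. f (v + w) = (\<lambda>l. f v l + f w l)) \<and>
     (\<forall>c. \<forall>v\<in>carrier_vec m. f (c \<cdot>\<^sub>v v) = (\<lambda>l. c * f v l)) \<and>
     inj_on f (carrier_vec m) \<and>
     (\<forall>\<alpha>\<in>carrier (AutG G U). \<forall>v\<in>carrier_vec m.
        f (\<rho> \<alpha> *\<^sub>v v) = (\<lambda>l. if l \<in> Inj G U then f v (compose U l \<alpha>) else 0)))"

definition E_G :: "('g,'c) monoid_scheme \<Rightarrow> ('g set \<times> (('g \<Rightarrow> 'g) \<Rightarrow> 'k::field)) set" where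
  "E_G G = {(U, \<chi>). subgroup U G \<and> \<chi> \<in> irr_chars (AutG G U) \<and> constituent_Inj G U \<chi>}"

text \<open>e_(U,chi): the element of KB^Delta(G,G) whose image under sigma_G is right
  multiplication by the central primitive idempotent of chi on the U-component and 0 on
  all other components. (G is abelian, so G acts trivially on Inj(U',G) and
  Inj-bar(U',G) = Inj(U',G).)\<close>
definition e_idem :: "('g,'c) monoid_scheme \<Rightarrow> 'g set \<Rightarrow> (('g \<Rightarrow> 'g) \<Rightarrow> 'k::field) \<Rightarrow> (('g \<times> 'g) set \<Rightarrow> 'k)" where
  "e_idem G U \<chi> = (THE e. e \<in> KB_Delta G \<and>
     (\<forall>U'. subgroup U' G \<longrightarrow> (\<forall>la\<in>Inj G U'. \<forall>mu\<in>Inj G U'.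
        Phi G (Delta U' la mu) e / of_nat (centralizer_card G (la ` U')) =
        (if U' = U then (\<Sum>\<alpha>\<in>carrier (AutG G U). if compose U mu \<alpha> = la then cpi_of (AutG G U) \<chi> \<alpha> else 0)
         else 0))))"

definition p_res :: "('g,'c) monoid_scheme \<Rightarrow> 'g set \<Rightarrow> ('g \<Rightarrow> 'g) \<Rightarrow> ('g \<Rightarrow> 'g)" where
  "p_res G U \<alpha> = (THE \<beta>. \<exists>i::nat. coprime i (order G) \<and>
       (\<forall>g\<in>carrier G. \<alpha> g = g [^]\<^bsub>G\<^esub> i) \<and> \<beta> = (\<lambda>u\<in>U. u [^]\<^bsub>G\<^esub> i))"

end

theory Submission
  imports Defs
begin

text \<open>
  Since \<open>G\<close> is cyclic, a subgroup \<open>L\<close> of \<open>G \<times> G\<close> with \<open>k\<^sub>1(L) = 1\<close> is the graph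
  \<open>{(v\<^sup>i, v) | v \<in> V}\<close> of a power map on a subgroup \<open>V\<close>, and all power maps commute. By the
  Mackey formula the product of the transitive bisets of \<open>L\<close> and \<open>M\<close> is \<open>|G| / |p\<^sub>2(L) p\<^sub>1(M)|\<close>
  copies of that of \<open>L O M\<close>; dividing the basis element of \<open>L\<close> by \<open>|G| / |L|\<close> makes the basis
  multiplicative, so marks of products are easy to compute, and marks determine elements because
  the table of marks is triangular. Comparing the marks of \<open>a M\<close> and \<open>M a\<close> for the graph \<open>M\<close> of a
  power map on \<open>G\<close>, and then for the diagonal \<open>M\<close> of a subgroup, shows that a central element \<open>a\<close> is
  supported on the graphs of automorphisms of \<open>G\<close>, so that the centre is \<open>K Aut(G)\<close>. Its primitive
  idempotents are the \<open>cpi_of \<theta>\<close>. Up to the factor \<open>|G|\<close>, the mark of \<open>cpi_of \<theta>\<close> at the graph of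
  \<open>c \<in> Aut(U)\<close> is the coefficient at \<open>c\<close> of its image under \<open>Aut(G) \<rightarrow> Aut(U)\<close>. This image is
  \<open>cpi_of \<chi>\<close> if \<open>\<theta>\<close> is inflated from \<open>\<chi>\<close>, and \<open>0\<close> if \<open>\<theta>\<close> is not inflated, since both sides act in
  the same way on every simple \<open>K Aut(U)\<close>-module. These are the marks of the sum of the
  \<open>e_idem G U \<chi>\<close>.
\<close>

subsection \<open>Subspaces of functions on a finite set\<close>

text \<open>The rescaled basis turns \<open>KB_lhd G\<close> into the algebra of a finite monoid:
  power maps defined on subgroups of G, under composition, with the automorphisms of G as units. The
  two factors of a composite play different roles: the right one is applied first, so its domain
  bounds the domain of the composite, while the left one constrains only values. This asymmetry,
  caused by asking for k_1 = 1 alone, is what leaves so few central elements.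

  K need not contain roots of unity, so irreducible characters of Aut(U) need not be linear. As K
  Aut(U) is commutative, a primitive idempotent e generates a minimal ideal, and this ideal is the
  simple module on which e acts as 1. A trace computed on it gives e(g) = tr(g^-1) / |Aut(U)|; hence
  a character determines its idempotent over every field of characteristic 0, and the description in
  \<open>cpi_of\<close> is meaningful.

  The isomorphism sigma_G is not invoked: existence and uniqueness of
  \<open>e_idem G U \<chi>\<close> come from the triangular table of marks restricted to subgroups
  with k_1 = k_2 = 1. The graphs of automorphisms of G are among these, which is why the final
  identity can be tested on such marks alone.\<close>

definition fun_subspace :: "'x set \<Rightarrow> ('x \<Rightarrow> 'k::field) set \<Rightarrow> bool" where
  "fun_subspace S W \<longleftrightarrow> (\<forall>w\<in>W. \<forall>s. s \<notin> S \<longrightarrow> w s = 0) \<and> (\<lambda>_. 0) \<in> W \<and>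
     (\<forall>v\<in>W. \<forall>w\<in>W. (\<lambda>s. v s + w s) \<in> W) \<and> (\<forall>c. \<forall>w\<in>W. (\<lambda>s. c * w s) \<in> W)"

lemma fun_subspaceD:
  assumes "fun_subspace S W"
  shows "w \<in> W \<Longrightarrow> s \<notin> S \<Longrightarrow> w s = 0" "(\<lambda>_. 0) \<in> W"
    "v \<in> W \<Longrightarrow> w \<in> W \<Longrightarrow> (\<lambda>s. v s + w s) \<in> W" "w \<in> W \<Longrightarrow> (\<lambda>s. c * w s) \<in> W"
  using assms unfolding fun_subspace_def by blast+

lemma fun_subspace_sum:
  assumes W: "fun_subspace S W" and "finite I" and "\<And>i. i \<in> I \<Longrightarrow> w i \<in> W"
  shows "(\<lambda>s. \<Sum>i\<in>I. c i * w i s) \<in> W"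
  using assms(2,3)
proof (induction I rule: finite_induct)
  case empty
  then show ?case using fun_subspaceD(2)[OF W] by simp
next
  case (insert i I)
  have "(\<lambda>s. c i * w i s) \<in> W" using insert.prems fun_subspaceD(4)[OF W] by blast
  moreover have "(\<lambda>s. \<Sum>i\<in>I. c i * w i s) \<in> W" using insert by blast
  ultimately have "(\<lambda>s. c i * w i s + (\<Sum>i\<in>I. c i * w i s)) \<in> W"
    by (rule fun_subspaceD(3)[OF W])
  then show ?case using insert.hyps by simp
qed

text \<open>The induction step of the next two lemmas: elements are functions on the whole type with
  prescribed support, so induction on the support takes the place of dimension theory.\<close>

lemma fun_subspace_kernel:
  "fun_subspace (insert s S) W \<Longrightarrow> fun_subspace S {w \<in> W. w s = 0}"
  unfolding fun_subspace_def by (simp, metis insert_iff)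

text \<open>Reduced echelon form: evaluation at the pivots \<open>p i\<close> gives coordinates on \<open>W\<close>.\<close>
lemma echelon_basis:
  assumes "finite S" "fun_subspace S W"
  shows "\<exists>m b p. (\<forall>i<m::nat. b i \<in> W \<and> p i \<in> S) \<and>
     (\<forall>i<m. \<forall>j<m. b i (p j) = (if i = j then 1 else 0)) \<and>
     (\<forall>w\<in>W. \<forall>s. w s = (\<Sum>i<m. w (p i) * b i s))"
  using assms
proof (induction S arbitrary: W rule: finite_induct)
  case empty
  then have "\<forall>w\<in>W. \<forall>s. w s = 0" unfolding fun_subspace_def by blast
  then show ?case by (intro exI[of _ 0]) auto
next
  case (insert s S)
  define W' where "W' = {w \<in> W. w s = 0}"
  have W'S: "fun_subspace S W'" using fun_subspace_kernel[OF insert.prems] W'_def by simp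
  obtain m b p where ech: "(\<forall>i<m::nat. b i \<in> W' \<and> p i \<in> S) \<and>
      (\<forall>i<m. \<forall>j<m. b i (p j) = (if i = j then 1 else 0)) \<and>
      (\<forall>w\<in>W'. \<forall>s. w s = (\<Sum>i<m. w (p i) * b i s))"
    using insert.IH[OF W'S] by blast
  have b: "b i \<in> W'" "p i \<in> S" if "i < m" for i using ech that by simp_all
  have dual: "b i (p j) = (if i = j then 1 else 0)" if "i < m" "j < m" for i j using ech that by simp
  have exp: "w t = (\<Sum>i<m. w (p i) * b i t)" if "w \<in> W'" for w t using ech that by blast
  have bs: "b i s = 0" if "i < m" for i using b(1)[OF that] W'_def by simp
  show ?case
  proof (cases "\<exists>w\<in>W. w s \<noteq> 0")
    case False
    then have "W' = W" using W'_def by blast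
    then show ?thesis using b dual exp by (intro exI[of _ m] exI[of _ b] exI[of _ p]) auto
  next
    case True
    then obtain w0 where w0: "w0 \<in> W" "w0 s \<noteq> 0" by blast
    \<comment> \<open>\<open>w0\<close> scaled to the value 1 at the new pivot \<open>s\<close> and
      cleared at the old pivots; the old \<open>b i\<close> already vanish at
      \<open>s\<close>.\<close>
    define v where "v = (\<lambda>t. (1 / w0 s) * w0 t + (-1) * (\<Sum>i<m. (w0 (p i) / w0 s) * b i t))"
    have "(\<lambda>t. (1 / w0 s) * w0 t) \<in> W" using fun_subspaceD(4)[OF insert.prems] w0 by blast
    moreover have "(\<lambda>t. \<Sum>i<m. (w0 (p i) / w0 s) * b i t) \<in> W"
      by (rule fun_subspace_sum[OF insert.prems]) (use b W'_def in auto)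
    then have "(\<lambda>t. (-1) * (\<Sum>i<m. (w0 (p i) / w0 s) * b i t)) \<in> W"
      using fun_subspaceD(4)[OF insert.prems] by blast
    ultimately have vW: "v \<in> W" unfolding v_def by (rule fun_subspaceD(3)[OF insert.prems])
    have vs: "v s = 1" unfolding v_def using w0 bs by simp
    have vp: "v (p j) = 0" if "j < m" for j
    proof -
      have "(\<Sum>i<m. (w0 (p i) / w0 s) * b i (p j)) = (\<Sum>i<m. if i = j then w0 (p j) / w0 s else 0)"
        by (rule sum.cong) (use dual that in auto)
      then show ?thesis unfolding v_def using that by simp
    qed
    define b' where "b' = b(m := v)"
    define p' where "p' = p(m := s)"
    have "\<forall>i<Suc m. b' i \<in> W \<and> p' i \<in> insert s S"
      using b vW W'_def unfolding b'_def p'_def by (auto simp: less_Suc_eq)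
    moreover have "\<forall>i<Suc m. \<forall>j<Suc m. b' i (p' j) = (if i = j then 1 else 0)"
      using dual vp vs bs unfolding b'_def p'_def by (auto simp: less_Suc_eq)
    moreover have "w t = (\<Sum>i<Suc m. w (p' i) * b' i t)" if w: "w \<in> W" for w t
    proof -
      \<comment> \<open>Removing the \<open>v\<close>-part puts \<open>w\<close> into the kernel
        without changing its values at the old pivots, where \<open>v\<close> is 0.\<close>
      define u where "u = (\<lambda>t. w t + (- w s) * v t)"
      have "(\<lambda>t. (- w s) * v t) \<in> W" using vW fun_subspaceD(4)[OF insert.prems] by blast
      then have "u \<in> W" unfolding u_def using w fun_subspaceD(3)[OF insert.prems] by blast
      then have "u \<in> W'" unfolding W'_def u_def using vs by simp
      from exp[OF this, of t] have "u t = (\<Sum>i<m. u (p i) * b i t)" .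
      also have "\<dots> = (\<Sum>i<m. w (p i) * b i t)" unfolding u_def using vp by simp
      finally have "w t = (\<Sum>i<m. w (p i) * b i t) + w s * v t" unfolding u_def by (simp add: algebra_simps)
      then show ?thesis unfolding b'_def p'_def by simp
    qed
    ultimately show ?thesis
      by (intro exI[of _ "Suc m"] exI[of _ b'] exI[of _ p']) blast
  qed
qed

text \<open>A substitute for the dimension of a subspace.\<close>
lemma fun_subspace_measure:
  assumes "finite S"
  shows "\<exists>\<mu> :: ('x \<Rightarrow> 'k::field) set \<Rightarrow> nat. \<forall>V W. fun_subspace S V \<longrightarrow> fun_subspace S W \<longrightarrow> V \<subset> W \<longrightarrow> \<mu> V < \<mu> W"
  using assms
proof (induction S rule: finite_induct)
  case empty
  have "V = W" if "fun_subspace {} V" "fun_subspace {} W" for V W :: "('x \<Rightarrow> 'k) set"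
  proof -
    have "\<forall>w\<in>V. w = (\<lambda>_. 0)" "\<forall>w\<in>W. w = (\<lambda>_. 0)" "(\<lambda>_. 0) \<in> V" "(\<lambda>_. 0) \<in> W"
      using that unfolding fun_subspace_def by auto
    then show ?thesis by (intro subset_antisym subsetI) metis+
  qed
  then show ?case by blast
next
  case (insert s S)
  then obtain \<mu> :: "('x \<Rightarrow> 'k) set \<Rightarrow> nat"
    where \<mu>: "\<And>V W. fun_subspace S V \<Longrightarrow> fun_subspace S W \<Longrightarrow> V \<subset> W \<Longrightarrow> \<mu> V < \<mu> W"
    by blast
  let ?K = "\<lambda>W. {w \<in> W. w s = 0}"
  \<comment> \<open>Rank and nullity of evaluation at \<open>s\<close>: the measure of the kernel
    plus 1 if the evaluation is not zero.\<close>
  define \<nu> :: "('x \<Rightarrow> 'k) set \<Rightarrow> nat" where "\<nu> = (\<lambda>W. \<mu> (?K W) + (if \<exists>w\<in>W. w s \<noteq> 0 then 1 else 0))"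
  have "\<nu> V < \<nu> W" if V: "fun_subspace (insert s S) V" and W: "fun_subspace (insert s S) W" and "V \<subset> W" for V W
  proof (cases "?K V = ?K W")
    case False
    then have "?K V \<subset> ?K W" using \<open>V \<subset> W\<close> by blast
    then have "\<mu> (?K V) < \<mu> (?K W)" using \<mu> fun_subspace_kernel[OF V] fun_subspace_kernel[OF W] by blast
    moreover have "(\<exists>w\<in>V. w s \<noteq> 0) \<longrightarrow> (\<exists>w\<in>W. w s \<noteq> 0)" using \<open>V \<subset> W\<close> by blast
    ultimately show ?thesis unfolding \<nu>_def by auto
  next
    case True
    \<comment> \<open>With equal kernels, an element of \<open>V\<close> that is nonzero at
      \<open>s\<close> would correct every element of \<open>W\<close> into
      \<open>V\<close>.\<close>
    have "\<not> (\<exists>w\<in>V. w s \<noteq> 0)"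
    proof
      assume "\<exists>w\<in>V. w s \<noteq> 0"
      then obtain v where v: "v \<in> V" "v s \<noteq> 0" by blast
      have "w \<in> V" if "w \<in> W" for w
      proof -
        define u where "u = (\<lambda>t. w t + (- (w s / v s)) * v t)"
        have cv: "(\<lambda>t. c * v t) \<in> V" for c using fun_subspaceD(4)[OF V v(1)] .
        then have "(\<lambda>t. (- (w s / v s)) * v t) \<in> W" using \<open>V \<subset> W\<close> by blast
        then have "u \<in> W" unfolding u_def by (rule fun_subspaceD(3)[OF W that])
        moreover have "u s = 0" unfolding u_def using v by simp
        ultimately have "u \<in> V" using True by blast
        from fun_subspaceD(3)[OF V this cv[of "w s / v s"]] show ?thesis
          unfolding u_def by simp
      qed
      then show False using \<open>V \<subset> W\<close> by blast
    qed
    moreover have "\<exists>w\<in>W. w s \<noteq> 0" using True \<open>V \<subset> W\<close> calculation by blast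
    ultimately show ?thesis unfolding \<nu>_def using True by simp
  qed
  then show ?case by blast
qed

subsection \<open>Group algebras of finite abelian groups\<close>

locale fin_comm_group = comm_group H for H :: "('h,'c) monoid_scheme" (structure) +
  assumes fin: "finite (carrier H)"
begin

abbreviation KA :: "('h \<Rightarrow> 'k::field_char_0) set" where "KA \<equiv> group_alg H"

abbreviation conv :: "('h \<Rightarrow> 'k::field_char_0) \<Rightarrow> ('h \<Rightarrow> 'k) \<Rightarrow> ('h \<Rightarrow> 'k)" (infixl \<open>\<star>\<close> 70)
  where "x \<star> y \<equiv> group_alg_mult H x y"

definition pt :: "'h \<Rightarrow> 'h \<Rightarrow> 'k::field_char_0" where
  "pt g = (\<lambda>h. if h = g then 1 else 0)"

text \<open>The linear extension of \<open>\<rho>\<close> to the group algebra; the matrix in the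
  definition of \<open>cpi_of\<close> is \<open>hat \<rho> m e\<close>.\<close>

definition hat :: "('h \<Rightarrow> 'k::field_char_0 mat) \<Rightarrow> nat \<Rightarrow> ('h \<Rightarrow> 'k) \<Rightarrow> 'k mat" where
  "hat \<rho> m x = mat m m (\<lambda>(i,j). \<Sum>h\<in>carrier H. x h * \<rho> h $$ (i,j))"

lemma sum_translate:
  assumes "a \<in> carrier H"
  shows "(\<Sum>h\<in>carrier H. f (inv a \<otimes> h) h) = (\<Sum>b\<in>carrier H. f b (a \<otimes> b))"
  by (rule sum.reindex_bij_witness[of _ "\<lambda>b. a \<otimes> b" "\<lambda>h. inv a \<otimes> h"])
    (use assms in \<open>auto simp: m_assoc[symmetric]\<close>)

lemma KA_vanish: "x \<in> KA \<Longrightarrow> h \<notin> carrier H \<Longrightarrow> x h = 0"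
  by (auto simp: group_alg_def)

lemma conv_in: "x \<star> y \<in> KA"
  by (auto simp: group_alg_def group_alg_mult_def)

lemma pt_in: "g \<in> carrier H \<Longrightarrow> pt g \<in> KA"
  by (auto simp: group_alg_def pt_def)

lemma add_in: "x \<in> KA \<Longrightarrow> y \<in> KA \<Longrightarrow> (\<lambda>h. x h + y h) \<in> KA"
  by (auto simp: group_alg_def)

lemma diff_in: "x \<in> KA \<Longrightarrow> y \<in> KA \<Longrightarrow> (\<lambda>h. x h - y h) \<in> KA"
  by (auto simp: group_alg_def)

lemma KA_subspace: "fun_subspace (carrier H) KA"
  by (auto simp: fun_subspace_def group_alg_def)

text \<open>Substitute \<open>inv a \<otimes> h\<close> for \<open>a\<close>. Convolution reads its
  arguments on the carrier only and is 0 outside, so this and the next laws hold for arbitrary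
  functions; the unit law below is where support matters.\<close>

lemma conv_comm: "x \<star> y = y \<star> x"
proof
  fix h
  have "(\<Sum>a\<in>carrier H. x a * y (inv a \<otimes> h)) = (\<Sum>a\<in>carrier H. y a * x (inv a \<otimes> h))"
    if h: "h \<in> carrier H"
  proof (rule sum.reindex_bij_witness[of _ "\<lambda>a. inv a \<otimes> h" "\<lambda>a. inv a \<otimes> h"])
    fix a assume a: "a \<in> carrier H"
    then show "inv a \<otimes> h \<in> carrier H" using h by simp
    show "inv (inv a \<otimes> h) \<otimes> h = a"
      using a h by (simp add: inv_mult m_assoc)
    then show "y (inv a \<otimes> h) * x (inv (inv a \<otimes> h) \<otimes> h) = x a * y (inv a \<otimes> h)"
      by (simp add: mult.commute)
  next
    fix a assume "a \<in> carrier H"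
    then show "inv (inv a \<otimes> h) \<otimes> h = a" using h by (simp add: inv_mult m_assoc)
  qed (use h in simp)
  then show "(x \<star> y) h = (y \<star> x) h" by (simp add: group_alg_mult_def)
qed

lemma conv_assoc: "x \<star> y \<star> z = x \<star> (y \<star> z)"
proof
  fix h
  have "(\<Sum>b\<in>carrier H. (\<Sum>a\<in>carrier H. x a * y (inv a \<otimes> b)) * z (inv b \<otimes> h)) =
      (\<Sum>a\<in>carrier H. x a * (\<Sum>c\<in>carrier H. y c * z (inv c \<otimes> (inv a \<otimes> h))))" if h: "h \<in> carrier H"
  proof -
    have "(\<Sum>b\<in>carrier H. (\<Sum>a\<in>carrier H. x a * y (inv a \<otimes> b)) * z (inv b \<otimes> h)) =
       (\<Sum>a\<in>carrier H. \<Sum>b\<in>carrier H. x a * y (inv a \<otimes> b) * z (inv b \<otimes> h))"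
      by (subst sum.swap) (simp add: sum_distrib_right)
    also have "\<dots> = (\<Sum>a\<in>carrier H. \<Sum>c\<in>carrier H. x a * y c * z (inv (a \<otimes> c) \<otimes> h))"
      by (rule sum.cong[OF refl], rule sum_translate[of _ "\<lambda>c b. x _ * y c * z (inv b \<otimes> h)"])
    also have "\<dots> = (\<Sum>a\<in>carrier H. x a * (\<Sum>c\<in>carrier H. y c * z (inv c \<otimes> (inv a \<otimes> h))))"
      unfolding sum_distrib_left
      by (intro sum.cong refl) (use h in \<open>simp add: inv_mult m_assoc m_lcomm mult.assoc\<close>)
    finally show ?thesis .
  qed
  then show "(x \<star> y \<star> z) h = (x \<star> (y \<star> z)) h"
    by (auto simp: group_alg_mult_def intro!: sum.cong)
qed

lemma conv_lcomm: "x \<star> (y \<star> z) = y \<star> (x \<star> z)"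
  by (metis conv_assoc conv_comm)

lemma conv_add: "x \<star> (\<lambda>h. y h + z h) = (\<lambda>h. (x \<star> y) h + (x \<star> z) h)"
  by (auto simp: group_alg_mult_def fun_eq_iff distrib_left sum.distrib)

lemma conv_diff: "x \<star> (\<lambda>h. y h - z h) = (\<lambda>h. (x \<star> y) h - (x \<star> z) h)"
  by (auto simp: group_alg_mult_def fun_eq_iff right_diff_distrib sum_subtractf)

lemma conv_add_left: "(\<lambda>h. y h + z h) \<star> x = (\<lambda>h. (y \<star> x) h + (z \<star> x) h)"
  using conv_add[of x y z] by (simp only: conv_comm[of _ x])

lemma conv_smult: "x \<star> (\<lambda>h. c * y h) = (\<lambda>h. c * (x \<star> y) h)"
  by (auto simp: group_alg_mult_def fun_eq_iff sum_distrib_left ac_simps)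

lemma conv_zero: "x \<star> (\<lambda>_. 0) = (\<lambda>_. 0)"
  by (auto simp: group_alg_mult_def)

lemma conv_zero_left: "(\<lambda>_. 0) \<star> x = (\<lambda>_. 0)"
  by (auto simp: group_alg_mult_def)

lemma pt_conv: "g \<in> carrier H \<Longrightarrow> h \<in> carrier H \<Longrightarrow> (pt g \<star> x) h = x (inv g \<otimes> h)"
  by (simp add: group_alg_mult_def pt_def if_distrib[of "\<lambda>c. c * _"] fin cong: if_cong)

lemma pt_one_conv: "x \<in> KA \<Longrightarrow> pt \<one> \<star> x = x"
proof
  fix h assume "x \<in> KA"
  then show "(pt \<one> \<star> x) h = x h"
    by (cases "h \<in> carrier H") (simp_all add: pt_conv KA_vanish KA_vanish[OF conv_in])
qed

text \<open>With this, a subspace stable under all \<open>pt g\<close> is stable under the whole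
  group algebra.\<close>

lemma conv_expand:
  "x \<star> y = (\<lambda>h. \<Sum>g\<in>carrier H. x g * (pt g \<star> y) h)"
proof
  fix h
  show "(x \<star> y) h = (\<Sum>g\<in>carrier H. x g * (pt g \<star> y) h)"
    by (cases "h \<in> carrier H") (auto simp: pt_conv, auto simp: group_alg_mult_def)
qed

lemma hat_carrier: "hat \<rho> m x \<in> carrier_mat m m" by (simp add: hat_def)

lemma hat_add: "hat \<rho> m (\<lambda>h. x h + y h) = hat \<rho> m x + hat \<rho> m y"
  by (rule eq_matI) (auto simp: hat_def distrib_right sum.distrib)

lemma hat_zero: "hat \<rho> m (\<lambda>_. 0) = 0\<^sub>m m m"
  by (rule eq_matI) (auto simp: hat_def)

lemma hat_pt:
  assumes "is_rep H m \<rho>" "g \<in> carrier H"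
  shows "hat \<rho> m (pt g) = \<rho> g"
proof (rule eq_matI)
  have c: "\<rho> g \<in> carrier_mat m m" using assms by (auto simp: is_rep_def)
  then show "dim_row (hat \<rho> m (pt g)) = dim_row (\<rho> g)" "dim_col (hat \<rho> m (pt g)) = dim_col (\<rho> g)"
    by (auto simp: hat_def)
  fix i j assume "i < dim_row (\<rho> g)" "j < dim_col (\<rho> g)"
  then show "hat \<rho> m (pt g) $$ (i,j) = \<rho> g $$ (i,j)"
    using c assms(2) fin by (auto simp: hat_def pt_def if_distrib[of "\<lambda>c. c * _"] cong: if_cong)
qed

lemma hat_conv:
  assumes "is_rep H m \<rho>"
  shows "hat \<rho> m (x \<star> y) = hat \<rho> m x * hat \<rho> m y"
proof (rule eq_matI)
  fix i j assume "i < dim_row (hat \<rho> m x * hat \<rho> m y)" "j < dim_col (hat \<rho> m x * hat \<rho> m y)"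
  then have ij: "i < m" "j < m" by (auto simp: hat_def)
  have mult: "(\<Sum>k<m. \<rho> a $$ (i,k) * \<rho> b $$ (k,j)) = \<rho> (a \<otimes> b) $$ (i,j)"
    if "a \<in> carrier H" "b \<in> carrier H" for a b
  proof -
    have "\<rho> a \<in> carrier_mat m m" "\<rho> b \<in> carrier_mat m m" "\<rho> (a \<otimes> b) = \<rho> a * \<rho> b"
      using assms that by (auto simp: is_rep_def)
    then show ?thesis using ij by (auto simp: scalar_prod_def atLeast0LessThan)
  qed
  have "hat \<rho> m (x \<star> y) $$ (i,j) = (\<Sum>h\<in>carrier H. \<Sum>a\<in>carrier H. x a * y (inv a \<otimes> h) * \<rho> h $$ (i,j))"
    using ij by (simp add: hat_def group_alg_mult_def sum_distrib_right)
  also have "\<dots> = (\<Sum>a\<in>carrier H. \<Sum>h\<in>carrier H. x a * y (inv a \<otimes> h) * \<rho> h $$ (i,j))"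
    by (rule sum.swap)
  also have "\<dots> = (\<Sum>a\<in>carrier H. \<Sum>b\<in>carrier H. x a * y b * \<rho> (a \<otimes> b) $$ (i,j))"
    by (rule sum.cong[OF refl], rule sum_translate[of _ "\<lambda>b h. x _ * y b * \<rho> h $$ (i,j)"])
  also have "\<dots> = (\<Sum>a\<in>carrier H. \<Sum>b\<in>carrier H. \<Sum>k<m. (x a * \<rho> a $$ (i,k)) * (y b * \<rho> b $$ (k,j)))"
    by (intro sum.cong refl) (simp add: mult[symmetric] sum_distrib_left ac_simps)
  also have "\<dots> = (\<Sum>k<m. (\<Sum>a\<in>carrier H. x a * \<rho> a $$ (i,k)) * (\<Sum>b\<in>carrier H. y b * \<rho> b $$ (k,j)))"
    unfolding sum_product by (subst (2) sum.swap, subst sum.swap) (rule refl)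
  also have "\<dots> = (hat \<rho> m x * hat \<rho> m y) $$ (i,j)"
    using ij by (simp add: hat_def scalar_prod_def atLeast0LessThan)
  finally show "hat \<rho> m (x \<star> y) $$ (i,j) = (hat \<rho> m x * hat \<rho> m y) $$ (i,j)" .
qed (auto simp: hat_def)

end

lemma mat_eq_of_vec_eq:
  fixes A B :: "'k::field mat"
  assumes "A \<in> carrier_mat n m" "B \<in> carrier_mat n m" "\<And>v. v \<in> carrier_vec m \<Longrightarrow> A *\<^sub>v v = B *\<^sub>v v"
  shows "A = B"
proof (rule eq_matI)
  fix i j assume ij: "i < dim_row B" "j < dim_col B"
  have "(A *\<^sub>v unit_vec m j) $ i = (B *\<^sub>v unit_vec m j) $ i" using assms(3) by simp
  then show "A $$ (i,j) = B $$ (i,j)" using ij assms(1,2) by (auto simp: scalar_prod_right_unit)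
qed (use assms in auto)

context fin_comm_group
begin

subsection \<open>Ideals and primitive idempotents\<close>

definition ideal_KA :: "('h \<Rightarrow> 'k::field_char_0) set \<Rightarrow> bool" where
  "ideal_KA I \<longleftrightarrow> fun_subspace (carrier H) I \<and> (\<forall>x. \<forall>y\<in>I. x \<star> y \<in> I)"

definition idem :: "('h \<Rightarrow> 'k::field_char_0) \<Rightarrow> bool" where
  "idem e \<longleftrightarrow> e \<in> KA \<and> e \<star> e = e"

text \<open>For an idempotent \<open>e\<close> this is the ideal generated by \<open>e\<close>,
  written as a fixed space so that membership is an equation.\<close>

definition pideal :: "('h \<Rightarrow> 'k::field_char_0) \<Rightarrow> ('h \<Rightarrow> 'k) set" where
  "pideal e = {y \<in> KA. e \<star> y = y}"

abbreviation pci :: "('h \<Rightarrow> 'k::field_char_0) \<Rightarrow> bool" where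
  "pci e \<equiv> primitive_central_idem (group_alg H) (group_alg_mult H) e"

abbreviation N :: "'k::field_char_0" where "N \<equiv> of_nat (card (carrier H))"

lemma N_nonzero: "(N :: 'k::field_char_0) \<noteq> 0"
  using fin one_closed by (auto simp: card_eq_0_iff)

lemma central_idem_iff: "central_idem (group_alg H) (group_alg_mult H) e \<longleftrightarrow> idem e"
  unfolding central_idem_def idem_def using conv_comm by blast

lemma pci_iff: "pci e \<longleftrightarrow> idem e \<and> e \<noteq> (\<lambda>_. 0) \<and>
     \<not> (\<exists>e1 e2. idem e1 \<and> idem e2 \<and> e1 \<noteq> (\<lambda>_. 0) \<and> e2 \<noteq> (\<lambda>_. 0) \<and>
            e1 \<star> e2 = (\<lambda>_. 0) \<and> e = (\<lambda>x. e1 x + e2 x))"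
  unfolding primitive_central_idem_def central_idem_iff ..

lemma pciD: "pci e \<Longrightarrow> e \<in> KA" "pci e \<Longrightarrow> e \<star> e = e" "pci e \<Longrightarrow> e \<noteq> (\<lambda>_. 0)"
  by (auto simp: pci_iff idem_def)

lemma conv_sum: "x \<star> (\<lambda>h. \<Sum>i\<in>I. c i * y i h) = (\<lambda>h. \<Sum>i\<in>I. c i * (x \<star> y i) h)"
proof
  fix h
  show "(x \<star> (\<lambda>h. \<Sum>i\<in>I. c i * y i h)) h = (\<Sum>i\<in>I. c i * (x \<star> y i) h)"
    unfolding group_alg_mult_def
    by (cases "h \<in> carrier H") (simp_all add: sum_distrib_left sum.swap[of _ I] ac_simps)
qed

text \<open>Averaging the projection \<open>w \<mapsto> \<Sum>i. w (p i) b i\<close> onto \<open>I\<close> over the group and evaluating at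
  the unit gives \<open>f\<close>.\<close>
lemma maschke:
  assumes "ideal_KA I"
  shows "\<exists>f\<in>I. \<forall>x\<in>I. x \<star> f = x"
proof -
  have sub: "fun_subspace (carrier H) I" and mul: "\<And>x y. y \<in> I \<Longrightarrow> x \<star> y \<in> I"
    using assms by (auto simp: ideal_KA_def)
  obtain m b p where ech: "(\<forall>i<m::nat. b i \<in> I \<and> p i \<in> carrier H) \<and>
      (\<forall>i<m. \<forall>j<m. b i (p j) = (if i = j then 1 else 0)) \<and>
      (\<forall>w\<in>I. \<forall>s. w s = (\<Sum>i<m. w (p i) * b i s))"
    using echelon_basis[OF fin sub] by blast
  have b: "b i \<in> I" "p i \<in> carrier H" if "i < m" for i using ech that by simp_all
  have exp: "w t = (\<Sum>i<m. w (p i) * b i t)" if "w \<in> I" for w t using ech that by blast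
  \<comment> \<open>Averaging \<open>pt (inv g)\<close> times the projection of \<open>pt g\<close>
    over all \<open>g\<close>: the projection evaluates at the pivots, so only
    \<open>g = p i\<close> contributes, with the translate of \<open>b i\<close> by
    \<open>inv (p i)\<close>.\<close>
  define f where "f = (\<lambda>h. \<Sum>i<m. (1 / N) * (pt (inv (p i)) \<star> b i) h)"
  have fI: "f \<in> I" unfolding f_def by (rule fun_subspace_sum[OF sub]) (use mul b in auto)
  have "(x \<star> f) h = x h" if x: "x \<in> I" for x h
  proof (cases "h \<in> carrier H")
    case False
    then show ?thesis using fun_subspaceD(1)[OF sub] x mul[OF fI] by metis
  next
    case True
    \<comment> \<open>The translation is moved from \<open>b i\<close> onto \<open>x\<close>, since
      the expansion \<open>exp\<close> applies to translates of \<open>x\<close>, which again lie in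
      \<open>I\<close>.\<close>
    have step: "(x \<star> (pt (inv (p i)) \<star> b i)) h = (\<Sum>t\<in>carrier H. (pt (t \<otimes> inv h) \<star> x) (p i) * b i t)"
      if i: "i < m" for i
    proof -
      have "(x \<star> (pt (inv (p i)) \<star> b i)) h = ((pt (inv (p i)) \<star> x) \<star> b i) h"
        by (metis conv_assoc conv_lcomm)
      also have "\<dots> = (b i \<star> (pt (inv (p i)) \<star> x)) h" by (simp only: conv_comm)
      also have "\<dots> = (\<Sum>t\<in>carrier H. b i t * x (p i \<otimes> (inv t \<otimes> h)))"
        using True b(2)[OF i] by (simp add: group_alg_mult_def[of H "b i"] pt_conv)
      also have "\<dots> = (\<Sum>t\<in>carrier H. (pt (t \<otimes> inv h) \<star> x) (p i) * b i t)"
      proof (rule sum.cong[OF refl])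
        fix t assume t: "t \<in> carrier H"
        have "p i \<otimes> (inv t \<otimes> h) = inv (t \<otimes> inv h) \<otimes> p i"
          using t True b(2)[OF i] by (simp add: inv_mult m_comm)
        then show "b i t * x (p i \<otimes> (inv t \<otimes> h)) = (pt (t \<otimes> inv h) \<star> x) (p i) * b i t"
          using t True b(2)[OF i] by (simp add: pt_conv)
      qed
      finally show ?thesis .
    qed
    have "(x \<star> f) h = (\<Sum>i<m. (1 / N) * (x \<star> (pt (inv (p i)) \<star> b i)) h)"
      unfolding f_def by (subst conv_sum) simp
    also have "\<dots> = (\<Sum>i<m. (1 / N) * (\<Sum>t\<in>carrier H. (pt (t \<otimes> inv h) \<star> x) (p i) * b i t))"
      using step by simp
    also have "\<dots> = (1 / N) * (\<Sum>t\<in>carrier H. \<Sum>i<m. (pt (t \<otimes> inv h) \<star> x) (p i) * b i t)"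
      unfolding sum_distrib_left by (rule sum.swap)
    also have "\<dots> = (1 / N) * (\<Sum>t\<in>carrier H. (pt (t \<otimes> inv h) \<star> x) t)"
      by (simp only: exp[OF mul[OF x], symmetric])
    also have "\<dots> = (1 / N) * (\<Sum>t\<in>carrier H. x h)"
    \<comment> \<open>The translates are chosen so that each of them takes the value
      \<open>x h\<close> at its own index \<open>t\<close>; the \<open>N\<close> equal terms cancel
      \<open>1 / N\<close>.\<close>
    proof -
      have "inv (t \<otimes> inv h) \<otimes> t = h" if t: "t \<in> carrier H" for t
        using t True by (simp add: inv_mult m_comm[of "inv t" h] m_assoc)
      then show ?thesis using True by (simp add: pt_conv)
    qed
    also have "\<dots> = x h" using N_nonzero[where 'k='a] by simp
    finally show ?thesis .
  qed
  then show ?thesis using fI by blast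
qed

lemma pideal_subspace: "fun_subspace (carrier H) (pideal e)"
  unfolding fun_subspace_def pideal_def
  by (auto simp: conv_add conv_smult conv_zero group_alg_def)

lemma pideal_ideal: "ideal_KA (pideal e)"
  unfolding ideal_KA_def by (auto simp: pideal_subspace) (auto simp: pideal_def conv_in conv_lcomm[of e])

text \<open>Choose an idempotent with \<open>P\<close> whose ideal is as small as possible. If it
  split into two orthogonal idempotents, one of them would inherit \<open>P\<close> and generate a
  strictly smaller ideal. This avoids decomposing the unit into primitive idempotents; it is applied
  to "acts nontrivially on a module" and to "has nonzero product with \<open>x\<close>".\<close>

lemma exists_pci:
  fixes P :: "('h \<Rightarrow> 'k::field_char_0) \<Rightarrow> bool"
  assumes add: "\<And>a b. P (\<lambda>h. a h + b h) \<Longrightarrow> P a \<or> P b" and one: "P (pt \<one>)" and zero: "\<not> P (\<lambda>_. 0)"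
  shows "\<exists>e. pci e \<and> P e"
proof -
  obtain \<mu> :: "('h \<Rightarrow> 'k) set \<Rightarrow> nat" where
    \<mu>: "\<And>V W. fun_subspace (carrier H) V \<Longrightarrow> fun_subspace (carrier H) W \<Longrightarrow> V \<subset> W \<Longrightarrow> \<mu> V < \<mu> W"
    using fun_subspace_measure[OF fin] by blast
  have "idem (pt \<one> :: 'h \<Rightarrow> 'k)" by (simp add: idem_def pt_in pt_one_conv)
  then obtain e where e: "idem e" "P e" and min: "\<And>y. idem y \<and> P y \<Longrightarrow> \<mu> (pideal e) \<le> \<mu> (pideal y)"
    using ex_has_least_nat[of "\<lambda>e. idem e \<and> P e" "pt \<one>" "\<lambda>e. \<mu> (pideal e)"] one by auto
  have smaller: "\<not> P e1"
    if d: "idem e1" "idem e2" "e2 \<noteq> (\<lambda>_. 0)" "e1 \<star> e2 = (\<lambda>_. 0)" "e = (\<lambda>x. e1 x + e2 x)" for e1 e2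
  proof
    assume "P e1"
    have e1e: "e1 \<star> e = e1" using d by (simp add: conv_add idem_def)
    have "pideal e1 \<subseteq> pideal e"
      unfolding pideal_def using e1e by (auto, metis conv_assoc conv_comm)
    moreover have "e \<in> pideal e" using e by (auto simp: pideal_def idem_def)
    moreover have "e \<notin> pideal e1"
    proof
      assume "e \<in> pideal e1"
      then have "e1 = e" using e1e by (simp add: pideal_def)
      then have "e2 = (\<lambda>_. 0)" using d(5) by (auto simp: fun_eq_iff)
      then show False using d(3) by blast
    qed
    ultimately have "\<mu> (pideal e1) < \<mu> (pideal e)" using \<mu> pideal_subspace by blast
    then show False using min[of e1] d(1) \<open>P e1\<close> by simp
  qed
  have "\<not> (\<exists>e1 e2. idem e1 \<and> idem e2 \<and> e1 \<noteq> (\<lambda>_. 0) \<and> e2 \<noteq> (\<lambda>_. 0) \<and>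
            e1 \<star> e2 = (\<lambda>_. 0) \<and> e = (\<lambda>x. e1 x + e2 x))"
  proof (intro notI, elim exE conjE)
    fix e1 e2 assume d: "idem e1" "idem e2" "e1 \<noteq> (\<lambda>_. 0)" "e2 \<noteq> (\<lambda>_. 0)"
      "e1 \<star> e2 = (\<lambda>_. 0)" "e = (\<lambda>x. e1 x + e2 x)"
    have "P e1 \<or> P e2" using add e(2) d(6) by blast
    moreover have "\<not> P e1" using smaller d by blast
    moreover have "e = (\<lambda>x. e2 x + e1 x)" "e2 \<star> e1 = (\<lambda>_. 0)" using d(5,6) by (auto simp: add.commute conv_comm)
    then have "\<not> P e2" using smaller d(1,2,3) by blast
    ultimately show False by blast
  qed
  moreover have "e \<noteq> (\<lambda>_. 0)" using e(2) zero by blast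
  ultimately show ?thesis using e unfolding pci_iff by blast
qed

text \<open>By Maschke \<open>J\<close> has an idempotent unit \<open>f\<close>; then
  \<open>f\<close> and \<open>e - f\<close> are orthogonal idempotents with sum \<open>e\<close>, so
  primitivity forces \<open>e = f\<close>. Thus \<open>pideal e\<close> is a minimal nonzero
  ideal.\<close>

lemma pci_minimal:
  assumes e: "pci e" and J: "ideal_KA J" and sub: "J \<subseteq> pideal e" and x: "x \<in> J" "x \<noteq> (\<lambda>_. 0)"
  shows "e \<in> J"
proof -
  obtain f where f: "f \<in> J" and fx: "\<And>x. x \<in> J \<Longrightarrow> x \<star> f = x" using maschke[OF J] by blast
  have eK: "e \<in> KA" "e \<star> e = e" using pciD[OF e] by auto
  have fe: "f \<in> KA" "e \<star> f = f" using f sub by (auto simp: pideal_def)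
  define g where "g = (\<lambda>h. e h - f h)"
  have ff: "f \<star> f = f" using fx f by blast
  have f0: "f \<noteq> (\<lambda>_. 0)" using x fx[OF x(1)] conv_zero by metis
  have fg: "f \<star> g = (\<lambda>_. 0)" unfolding g_def conv_diff using ff fe(2) by (simp add: conv_comm)
  have eg: "e \<star> g = g" unfolding g_def conv_diff using eK fe by simp
  have gg: "g \<star> g = g"
  proof -
    have "g \<star> g = (\<lambda>h. (g \<star> e) h - (g \<star> f) h)" by (subst (2) g_def) (rule conv_diff)
    then show ?thesis using eg fg by (simp add: conv_comm)
  qed
  have "idem f" "idem g" using ff gg fe eK by (auto simp: idem_def g_def diff_in)
  moreover have "e = (\<lambda>h. f h + g h)" by (simp add: g_def)
  ultimately have "g = (\<lambda>_. 0)" using e f0 fg unfolding pci_iff by blast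
  then have "e = f" by (auto simp: g_def fun_eq_iff)
  then show ?thesis using f by simp
qed

subsection \<open>Simple modules and primitive idempotents\<close>

text \<open>The fixed space of \<open>hat \<rho> m f\<close> is invariant because the group is
  abelian, and it is also the image of this idempotent matrix.\<close>

lemma simple_hat_idem:
  assumes s: "simple_rep H m \<rho>" and f: "f \<star> f = f"
  shows "hat \<rho> m f = 0\<^sub>m m m \<or> hat \<rho> m f = 1\<^sub>m m"
proof -
  let ?F = "hat \<rho> m f"
  have r: "is_rep H m \<rho>" using s by (simp add: simple_rep_def)
  have F: "?F \<in> carrier_mat m m" by (rule hat_carrier)
  have rc: "\<rho> g \<in> carrier_mat m m" if "g \<in> carrier H" for g using r that by (simp add: is_rep_def)
  have FF: "?F * ?F = ?F" using hat_conv[OF r, of f f] f by simp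
  have comm: "\<rho> g * ?F = ?F * \<rho> g" if g: "g \<in> carrier H" for g
    using hat_conv[OF r, of "pt g" f] hat_conv[OF r, of f "pt g"] hat_pt[OF r g]
    by (simp add: conv_comm)
  define W where "W = {v \<in> carrier_vec m. ?F *\<^sub>v v = v}"
  have "invariant_subspace H m \<rho> W"
    unfolding invariant_subspace_def W_def
  proof (intro conjI ballI allI)
    fix g v assume g: "g \<in> carrier H" and v: "v \<in> {v \<in> carrier_vec m. ?F *\<^sub>v v = v}"
    then have "?F *\<^sub>v (\<rho> g *\<^sub>v v) = \<rho> g *\<^sub>v (?F *\<^sub>v v)"
      using comm[OF g] F rc[OF g] by (metis (mono_tags, lifting) assoc_mult_mat_vec mem_Collect_eq)
    then show "\<rho> g *\<^sub>v v \<in> {v \<in> carrier_vec m. ?F *\<^sub>v v = v}"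
      using v rc[OF g] by auto
  qed (use F in \<open>auto simp: mult_add_distrib_mat_vec mult_mat_vec\<close>)
  then consider "W = {0\<^sub>v m}" | "W = carrier_vec m" using s by (auto simp: simple_rep_def)
  then show ?thesis
  proof cases
    case 1
    have "?F *\<^sub>v v = 0\<^sub>m m m *\<^sub>v v" if v: "v \<in> carrier_vec m" for v
    proof -
      have "?F *\<^sub>v (?F *\<^sub>v v) = ?F *\<^sub>v v" using FF F v by (metis assoc_mult_mat_vec)
      then have "?F *\<^sub>v v \<in> W" using F v by (auto simp: W_def)
      then show ?thesis using 1 v by auto
    qed
    then have "?F = 0\<^sub>m m m" using mat_eq_of_vec_eq[OF F] by auto
    then show ?thesis by simp
  next
    case 2
    then have "?F *\<^sub>v v = 1\<^sub>m m *\<^sub>v v" if "v \<in> carrier_vec m" for v using that by (auto simp: W_def)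
    then have "?F = 1\<^sub>m m" using mat_eq_of_vec_eq[OF F] by auto
    then show ?thesis by simp
  qed
qed

lemma one_mat_nonzero: "m > 0 \<Longrightarrow> 1\<^sub>m m \<noteq> (0\<^sub>m m m :: 'k::field mat)"
  by (metis index_one_mat(1) index_zero_mat(1) zero_neq_one)

text \<open>A primitive idempotent that acts nontrivially exists because the unit does; on a simple
  module it then acts as the identity.\<close>

lemma simple_exists_pci:
  assumes s: "simple_rep H m \<rho>"
  shows "\<exists>e. pci e \<and> hat \<rho> m e = 1\<^sub>m m"
proof -
  have r: "is_rep H m \<rho>" and m: "m > 0" using s by (auto simp: simple_rep_def)
  have "\<exists>e. pci e \<and> hat \<rho> m e \<noteq> 0\<^sub>m m m"
  proof (rule exists_pci)
    fix a b assume "hat \<rho> m (\<lambda>h. a h + b h) \<noteq> 0\<^sub>m m m"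
    then show "hat \<rho> m a \<noteq> 0\<^sub>m m m \<or> hat \<rho> m b \<noteq> 0\<^sub>m m m" by (auto simp: hat_add)
  next
    have "hat \<rho> m (pt \<one>) = 1\<^sub>m m" using hat_pt[OF r one_closed] r by (simp add: is_rep_def)
    then show "hat \<rho> m (pt \<one>) \<noteq> 0\<^sub>m m m" using one_mat_nonzero[OF m] by simp
  qed (simp add: hat_zero)
  then show ?thesis using simple_hat_idem[OF s] pciD by blast
qed

text \<open>Both sides are the trace of multiplication by \<open>g e\<close> on the group algebra, since
  \<open>y \<mapsto> \<rho>(y) v\<close> identifies \<open>e KA\<close> with the module of \<open>\<rho>\<close>.\<close>
lemma simple_trace:
  fixes \<rho> :: "'h \<Rightarrow> 'k::field_char_0 mat"
  assumes s: "simple_rep H m \<rho>" and e: "pci e" and he: "hat \<rho> m e = 1\<^sub>m m" and g: "g \<in> carrier H"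
  shows "mat_tr (\<rho> g) = N * e (inv g)"
proof -
  have r: "is_rep H m \<rho>" and m: "m > 0" using s by (auto simp: simple_rep_def)
  have rc: "\<rho> g \<in> carrier_mat m m" if "g \<in> carrier H" for g using r that by (simp add: is_rep_def)
  note eK = pciD(1,2)[OF e]
  \<comment> \<open>Any nonzero vector would serve: it generates the simple module, so
    \<open>T\<close> below is onto, and injective on \<open>pideal e\<close>.\<close>
  define v :: "'k vec" where "v = unit_vec m 0"
  have v: "v \<in> carrier_vec m" "v \<noteq> 0\<^sub>v m" using m by (auto simp: v_def)
  define T where "T = (\<lambda>y. hat \<rho> m y *\<^sub>v v)"
  have Tc: "T y \<in> carrier_vec m" for y unfolding T_def using hat_carrier v by (metis mult_mat_vec_carrier)
  have Tconv: "T (x \<star> y) = hat \<rho> m x *\<^sub>v T y" for x y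
    unfolding T_def hat_conv[OF r] using hat_carrier v by (metis assoc_mult_mat_vec)
  have Tadd: "T (\<lambda>h. x h + y h) = T x + T y" for x y
    unfolding T_def hat_add using hat_carrier v by (metis add_mult_distrib_mat_vec)
  have Tidx: "T y $ i = (\<Sum>h\<in>carrier H. y h * (\<rho> h *\<^sub>v v) $ i)" if i: "i < m" for y i
  proof -
    have "T y $ i = (\<Sum>j<m. (\<Sum>h\<in>carrier H. y h * \<rho> h $$ (i,j)) * v $ j)"
      using i v by (simp add: T_def hat_def scalar_prod_def atLeast0LessThan)
    also have "\<dots> = (\<Sum>h\<in>carrier H. y h * (\<Sum>j<m. \<rho> h $$ (i,j) * v $ j))"
      by (simp only: sum_distrib_left sum_distrib_right mult.assoc) (rule sum.swap)
    also have "\<dots> = (\<Sum>h\<in>carrier H. y h * (\<rho> h *\<^sub>v v) $ i)"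
    proof (rule sum.cong[OF refl])
      fix h assume "h \<in> carrier H"
      then have "dim_row (\<rho> h) = m" "dim_col (\<rho> h) = m" "dim_vec v = m" using rc v by auto
      then show "y h * (\<Sum>j<m. \<rho> h $$ (i,j) * v $ j) = y h * (\<rho> h *\<^sub>v v) $ i"
        using i by (simp add: scalar_prod_def atLeast0LessThan)
    qed
    finally show ?thesis .
  qed
  have Tsmult: "T (\<lambda>h. c * y h) = c \<cdot>\<^sub>v T y" for c y
    by (rule eq_vecI) (use Tc[THEN carrier_vecD] Tidx in \<open>auto simp: sum_distrib_left mult.assoc\<close>)
  have Tinj: "y = (\<lambda>_. 0)" if y: "y \<in> KA" "e \<star> y = y" "T y = 0\<^sub>v m" for y
  proof (rule ccontr)
    assume y0: "y \<noteq> (\<lambda>_. 0)"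
    \<comment> \<open>The kernel of \<open>T\<close> on \<open>pideal e\<close> is an ideal; if it
      were nonzero, it would contain \<open>e\<close> by minimality, but
      \<open>T e = v\<close>.\<close>
    define J where "J = {y \<in> pideal e. T y = 0\<^sub>v m}"
    have "T (\<lambda>_. 0) = 0\<^sub>v m" unfolding T_def hat_zero using v by (intro eq_vecI) auto
    then have "fun_subspace (carrier H) J"
      using pideal_subspace[of e] unfolding fun_subspace_def J_def by (auto simp: Tadd Tsmult)
    moreover have "x \<star> y \<in> J" if "y \<in> J" for x y
      using that pideal_ideal[of e] hat_carrier[of \<rho> m x] unfolding ideal_KA_def J_def by (auto simp: Tconv)
    ultimately have "ideal_KA J" by (simp add: ideal_KA_def)
    moreover have "y \<in> J" using y by (auto simp: J_def pideal_def)
    ultimately have "e \<in> J" using pci_minimal[OF e _ _ _ y0] by (auto simp: J_def)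
    then have "1\<^sub>m m *\<^sub>v v = 0\<^sub>v m" using he by (simp add: J_def T_def)
    then show False using v by simp
  qed
  define R where "R = {T y | y. y \<in> KA}"
  have RI: "T y \<in> R" if "y \<in> KA" for y using that by (auto simp: R_def)
  have "invariant_subspace H m \<rho> R"
    unfolding invariant_subspace_def
  proof (intro conjI ballI allI)
    show "R \<subseteq> carrier_vec m" using Tc by (auto simp: R_def)
    have "T (\<lambda>_. 0) = 0\<^sub>v m" unfolding T_def hat_zero using v by (intro eq_vecI) auto
    then show "0\<^sub>v m \<in> R" using RI[OF fun_subspaceD(2)[OF KA_subspace]] by simp
    fix u assume "u \<in> R"
    then obtain y where y: "y \<in> KA" "u = T y" by (auto simp: R_def)
    { fix w assume "w \<in> R"
      then obtain z where "z \<in> KA" "w = T z" by (auto simp: R_def)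
      then show "u + w \<in> R" using y Tadd[of y z] RI[OF add_in[of y z]] by simp }
    { fix c
      have "(\<lambda>h. c * y h) \<in> KA" using fun_subspaceD(4)[OF KA_subspace] y by blast
      then show "c \<cdot>\<^sub>v u \<in> R" using y Tsmult[of c y] RI by metis }
    { fix h assume "h \<in> carrier H"
      then have "\<rho> h *\<^sub>v u = T (pt h \<star> y)" using Tconv hat_pt[OF r] y by simp
      then show "\<rho> h *\<^sub>v u \<in> R" using RI[OF conv_in] by simp }
  qed
  moreover have "v \<in> R" using RI[OF eK(1)] he v by (simp add: T_def)
  ultimately have R: "R = carrier_vec m" using s v by (auto simp: simple_rep_def)
  have "\<exists>x. x \<in> KA \<and> e \<star> x = x \<and> T x = unit_vec m i" if "i < m" for i
  proof -
    obtain y where y: "y \<in> KA" "T y = unit_vec m i" using R that unfolding R_def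
      by (smt (verit) mem_Collect_eq unit_vec_carrier)
    \<comment> \<open>Multiplying by \<open>e\<close> moves the preimage into
      \<open>pideal e\<close> without changing its image, since \<open>e\<close> acts as 1.\<close>
    have "T (e \<star> y) = T y" using Tconv[of e y] he Tc by simp
    moreover have "e \<star> (e \<star> y) = e \<star> y" using eK by (metis conv_assoc)
    ultimately show ?thesis using y conv_in by metis
  qed
  then obtain x where x: "\<And>i. i < m \<Longrightarrow> x i \<in> KA" "\<And>i. i < m \<Longrightarrow> e \<star> x i = x i"
    "\<And>i. i < m \<Longrightarrow> T (x i) = unit_vec m i" by metis
  \<comment> \<open>The combination of the \<open>x i\<close> with the coordinates of
    \<open>T y\<close> is the inverse of \<open>T\<close> on \<open>pideal e\<close> applied to
    \<open>T y\<close>, hence the projection of \<open>y\<close> to that ideal.\<close>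
  have ST: "(\<Sum>i<m. T y $ i * x i h) = (e \<star> y) h" for y h
  proof -
    define z where "z = (\<lambda>h. (\<Sum>i<m. T y $ i * x i h) + (-1) * (e \<star> y) h)"
    have s1: "(\<lambda>h. \<Sum>i<m. T y $ i * x i h) \<in> pideal e"
      by (rule fun_subspace_sum[OF pideal_subspace]) (use x in \<open>auto simp: pideal_def\<close>)
    have s2: "(\<lambda>h. (-1) * (e \<star> y) h) \<in> pideal e"
      by (rule fun_subspaceD(4)[OF pideal_subspace])
        (use eK in \<open>auto simp: pideal_def conv_in conv_assoc[symmetric]\<close>)
    have zp: "z \<in> pideal e" unfolding z_def using fun_subspaceD(3)[OF pideal_subspace s1 s2] .
    have "T (e \<star> y) = T y" using Tconv[of e y] he Tc by simp
    moreover have "T (\<lambda>h. \<Sum>i<m. T y $ i * x i h) = T y"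
    proof (rule eq_vecI)
      show "dim_vec (T (\<lambda>h. \<Sum>i<m. T y $ i * x i h)) = dim_vec (T y)" using Tc[THEN carrier_vecD] by simp
      fix j assume "j < dim_vec (T y)"
      then have j: "j < m" using Tc[of y] by simp
      have "T (\<lambda>h. \<Sum>i<m. T y $ i * x i h) $ j = (\<Sum>i<m. T y $ i * T (x i) $ j)"
        by (simp only: Tidx[OF j] sum_distrib_left sum_distrib_right mult.assoc) (rule sum.swap)
      also have "\<dots> = (\<Sum>i<m. if i = j then T y $ j else 0)"
        by (rule sum.cong) (use x j in \<open>auto simp: unit_vec_def\<close>)
      finally show "T (\<lambda>h. \<Sum>i<m. T y $ i * x i h) $ j = T y $ j" using j by simp
    qed
    ultimately have "T z = 0\<^sub>v m" unfolding z_def Tadd Tsmult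
      using Tc[of y] by (intro eq_vecI) auto
    then have "z = (\<lambda>_. 0)" using zp Tinj by (auto simp: pideal_def)
    then have "z h = 0" by simp
    then show ?thesis by (simp add: z_def)
  qed
  have "mat_tr (\<rho> g) = (\<Sum>i<m. T (pt g \<star> x i) $ i)"
  proof -
    have "\<rho> g $$ (i,i) = T (pt g \<star> x i) $ i" if "i < m" for i
      using that rc[OF g] x hat_pt[OF r g] by (simp add: Tconv scalar_prod_right_unit)
    then show ?thesis using rc[OF g] by (simp add: mat_tr_def)
  qed
  also have "\<dots> = (\<Sum>i<m. \<Sum>h\<in>carrier H. x i (inv g \<otimes> h) * (\<rho> h *\<^sub>v v) $ i)"
    by (simp add: Tidx pt_conv g)
  also have "\<dots> = (\<Sum>i<m. \<Sum>b\<in>carrier H. x i b * (\<rho> (g \<otimes> b) *\<^sub>v v) $ i)"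
    by (rule sum.cong[OF refl], rule sum_translate[OF g, of "\<lambda>b h. x _ b * (\<rho> h *\<^sub>v v) $ _"])
  \<comment> \<open>After the sums are exchanged, the term for \<open>b\<close> is the diagonal
    entry at \<open>pt b\<close> of multiplication by \<open>g e\<close> on the whole group algebra;
    each such entry is \<open>e (inv g)\<close>.\<close>
  also have "\<dots> = (\<Sum>b\<in>carrier H. \<Sum>i<m. T (pt (g \<otimes> b)) $ i * x i b)"
    by (subst sum.swap) (simp add: T_def hat_pt[OF r] g mult.commute)
  also have "\<dots> = (\<Sum>b\<in>carrier H. (pt (g \<otimes> b) \<star> e) b)"
    by (simp only: ST conv_comm)
  also have "\<dots> = (\<Sum>b\<in>carrier H. e (inv g))"
  proof (rule sum.cong[OF refl])
    fix b assume b: "b \<in> carrier H"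
    have "inv (g \<otimes> b) \<otimes> b = inv g" using g b by (simp add: inv_mult m_assoc)
    then show "(pt (g \<otimes> b) \<star> e) b = e (inv g)" using g b by (simp add: pt_conv)
  qed
  finally show ?thesis by simp
qed

text \<open>The ideal \<open>pideal e\<close> is itself the module, with values at the pivots as
  coordinates: \<open>R x\<close> is the matrix of multiplication by \<open>x\<close>. Simplicity is
  the minimality of the ideal.\<close>

lemma pci_exists_simple:
  fixes e :: "'h \<Rightarrow> 'k::field_char_0"
  assumes e: "pci e"
  shows "\<exists>m \<rho>. simple_rep H m \<rho> \<and> hat \<rho> m e = 1\<^sub>m m"
proof -
  note eK = pciD[OF e]
  let ?W = "pideal e"
  obtain m b p where b': "\<forall>i<m::nat. b i \<in> ?W \<and> p i \<in> carrier H"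
    and dual': "\<forall>i<m. \<forall>j<m. b i (p j) = (if i = j then 1 else 0)"
    and exp': "\<forall>w\<in>?W. \<forall>s. w s = (\<Sum>i<m. w (p i) * b i s)"
    using echelon_basis[OF fin pideal_subspace[of e]] by blast
  have b: "b i \<in> ?W" "p i \<in> carrier H" if "i < m" for i using b' that by blast+
  have dual: "b i (p j) = (if i = j then 1 else 0)" if "i < m" "j < m" for i j using dual' that by blast
  have exp: "w = (\<lambda>t. \<Sum>i<m. w (p i) * b i t)" if "w \<in> ?W" for w using exp' that by blast
  have mul: "x \<star> y \<in> ?W" if "y \<in> ?W" for x y
    using pideal_ideal[of e] that by (auto simp: ideal_KA_def)
  define crd :: "('h \<Rightarrow> 'k) \<Rightarrow> 'k vec" where "crd = (\<lambda>w. vec m (\<lambda>i. w (p i)))"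
  define R where "R = (\<lambda>x. mat m m (\<lambda>(i,j). (x \<star> b j) (p i)))"
  define \<rho> where "\<rho> = (\<lambda>g. R (pt g))"
  have Rc: "R x \<in> carrier_mat m m" for x by (simp add: R_def)
  have crdc: "crd w \<in> carrier_vec m" for w by (simp add: crd_def)
  have Rcrd: "R x *\<^sub>v crd w = crd (x \<star> w)" if w: "w \<in> ?W" for x w
  proof (rule eq_vecI)
    fix i assume "i < dim_vec (crd (x \<star> w))"
    then have i: "i < m" by (simp add: crd_def)
    have "(x \<star> w) (p i) = (x \<star> (\<lambda>t. \<Sum>j<m. w (p j) * b j t)) (p i)"
      using arg_cong[OF exp[OF w], of "\<lambda>w. (x \<star> w) (p i)"] .
    also have "\<dots> = (\<Sum>j<m. w (p j) * (x \<star> b j) (p i))" by (simp add: conv_sum)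
    finally show "(R x *\<^sub>v crd w) $ i = crd (x \<star> w) $ i"
      using i by (simp add: R_def crd_def scalar_prod_def atLeast0LessThan mult.commute)
  qed (simp add: R_def crd_def)
  have crd_surj: "\<exists>w\<in>?W. crd w = v" if v: "v \<in> carrier_vec m" for v
  proof (intro bexI)
    let ?w = "\<lambda>t. \<Sum>i<m. v $ i * b i t"
    show "?w \<in> ?W" by (rule fun_subspace_sum[OF pideal_subspace]) (use b in auto)
    have "(\<Sum>i<m. v $ i * b i (p j)) = v $ j" if "j < m" for j
    proof -
      have "(\<Sum>i<m. v $ i * b i (p j)) = (\<Sum>i<m. if i = j then v $ j else 0)"
        by (rule sum.cong) (use dual that in auto)
      then show ?thesis using that by simp
    qed
    then show "crd ?w = v" using v by (intro eq_vecI) (auto simp: crd_def)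
  qed
  have crd_inj: "w = w'" if "w \<in> ?W" "w' \<in> ?W" "crd w = crd w'" for w w'
  proof -
    have "w (p i) = w' (p i)" if "i < m" for i
    proof -
      have "crd w $ i = crd w' $ i" using \<open>crd w = crd w'\<close> by simp
      then show ?thesis using that by (simp add: crd_def)
    qed
    then have "(\<lambda>t. \<Sum>i<m. w (p i) * b i t) = (\<lambda>t. \<Sum>i<m. w' (p i) * b i t)" by simp
    then show ?thesis using exp[OF that(1)] exp[OF that(2)] by metis
  qed
  have crd_add: "crd (\<lambda>h. x h + y h) = crd x + crd y" for x y by (rule eq_vecI) (auto simp: crd_def)
  have crd_smult: "crd (\<lambda>h. c * x h) = c \<cdot>\<^sub>v crd x" for c x by (rule eq_vecI) (auto simp: crd_def)
  have crd_zero: "crd (\<lambda>_. 0) = 0\<^sub>v m" by (rule eq_vecI) (auto simp: crd_def)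
  have hatR: "hat \<rho> m x = R x" for x
  proof (rule eq_matI)
    fix i j assume "i < dim_row (R x)" "j < dim_col (R x)"
    then have ij: "i < m" "j < m" by (auto simp: R_def)
    have "(x \<star> b j) (p i) = (\<Sum>g\<in>carrier H. x g * (pt g \<star> b j) (p i))"
      by (subst conv_expand) simp
    then show "hat \<rho> m x $$ (i,j) = R x $$ (i,j)" using ij by (simp add: hat_def R_def \<rho>_def)
  qed (auto simp: hat_def R_def)
  have Rconv: "R (x \<star> y) = R x * R y" for x y
  proof (rule mat_eq_of_vec_eq[of _ m m])
    fix v :: "'k vec" assume v: "v \<in> carrier_vec m"
    then obtain w where w: "w \<in> ?W" "crd w = v" using crd_surj by blast
    have "R (x \<star> y) *\<^sub>v crd w = R x *\<^sub>v (R y *\<^sub>v crd w)"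
      using Rcrd[OF w(1), of "x \<star> y"] Rcrd[OF w(1), of y] Rcrd[OF mul[OF w(1)], of x y]
      by (simp only: conv_assoc)
    then show "R (x \<star> y) *\<^sub>v v = R x * R y *\<^sub>v v" using w v Rc by (metis assoc_mult_mat_vec)
  qed (use Rc mult_carrier_mat[OF Rc Rc] in auto)
  have R1: "R x = 1\<^sub>m m" if x: "\<And>w. w \<in> ?W \<Longrightarrow> x \<star> w = w" for x
  proof (rule mat_eq_of_vec_eq[of _ m m])
    fix v :: "'k vec" assume v: "v \<in> carrier_vec m"
    then obtain w where w: "w \<in> ?W" "crd w = v" using crd_surj by blast
    then show "R x *\<^sub>v v = 1\<^sub>m m *\<^sub>v v" using Rcrd[OF w(1), of x] x v by simp
  qed (use Rc in auto)
  have ptpt: "(pt (g \<otimes> h) :: 'h \<Rightarrow> 'k) = pt g \<star> pt h" if "g \<in> carrier H" "h \<in> carrier H" for g h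
  proof
    fix t
    show "(pt (g \<otimes> h) :: 'h \<Rightarrow> 'k) t = (pt g \<star> pt h) t"
    proof (cases "t \<in> carrier H")
      case True
      then have "h = inv g \<otimes> t \<longleftrightarrow> t = g \<otimes> h" using that by (simp add: inv_solve_left)
      then have "inv g \<otimes> t = h \<longleftrightarrow> t = g \<otimes> h" by metis
      then show ?thesis unfolding pt_conv[OF that(1) True] by (simp add: pt_def)
    next
      case False
      then show ?thesis using that by (simp add: KA_vanish[OF conv_in] KA_vanish[OF pt_in])
    qed
  qed
  have rep: "is_rep H m \<rho>"
    unfolding is_rep_def \<rho>_def
  proof (intro conjI ballI)
    show "R (pt \<one>) = 1\<^sub>m m" by (rule R1) (simp add: pideal_def pt_one_conv)
  qed (use Rc ptpt Rconv in auto)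
  have eW: "e \<in> ?W" using eK by (simp add: pideal_def)
  have m0: "m > 0"
  proof (rule ccontr)
    assume "\<not> m > 0"
    then have "e = (\<lambda>_. 0)" by (subst exp[OF eW]) simp
    then show False using eK by blast
  qed
  have "U = {0\<^sub>v m} \<or> U = carrier_vec m" if U: "invariant_subspace H m \<rho> U" for U
  proof -
    have U': "U \<subseteq> carrier_vec m" "0\<^sub>v m \<in> U" "\<And>v w. v \<in> U \<Longrightarrow> w \<in> U \<Longrightarrow> v + w \<in> U"
      "\<And>c v. v \<in> U \<Longrightarrow> c \<cdot>\<^sub>v v \<in> U" "\<And>h v. h \<in> carrier H \<Longrightarrow> v \<in> U \<Longrightarrow> \<rho> h *\<^sub>v v \<in> U"
      using U by (auto simp: invariant_subspace_def)
    \<comment> \<open>An invariant subspace of coordinate vectors, pulled back to the ideal; if it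
      is nonzero it contains \<open>e\<close>, and with \<open>e\<close> all of
      \<open>pideal e\<close>.\<close>
    define J where "J = {w \<in> ?W. crd w \<in> U}"
    have subJ: "fun_subspace (carrier H) J"
      using pideal_subspace[of e] U' unfolding fun_subspace_def J_def by (auto simp: crd_add crd_smult crd_zero)
    have "x \<star> y \<in> J" if y: "y \<in> J" for x y
    proof -
      have "pt g \<star> y \<in> J" if "g \<in> carrier H" for g
        using U'(5)[OF that, of "crd y"] y mul Rcrd by (auto simp: J_def \<rho>_def)
      then have "(\<lambda>h. \<Sum>g\<in>carrier H. x g * (pt g \<star> y) h) \<in> J"
        by (intro fun_subspace_sum[OF subJ fin])
      then show ?thesis by (subst conv_expand)
    qed
    then have J: "ideal_KA J" using subJ by (simp add: ideal_KA_def)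
    show ?thesis
    proof (cases "\<exists>x\<in>J. x \<noteq> (\<lambda>_. 0)")
      case False
      have "v = 0\<^sub>v m" if v: "v \<in> U" for v
      proof -
        obtain w where "w \<in> ?W" "crd w = v" using crd_surj v U'(1) by blast
        then have "w \<in> J" using v by (simp add: J_def)
        then have "w = (\<lambda>_. 0)" using False by blast
        then show ?thesis using \<open>crd w = v\<close> crd_zero by simp
      qed
      then show ?thesis using U'(2) by blast
    next
      case True
      then have eJ: "e \<in> J" using pci_minimal[OF e J] by (auto simp: J_def)
      have "v \<in> U" if v: "v \<in> carrier_vec m" for v
      proof -
        obtain w where w: "w \<in> ?W" "crd w = v" using crd_surj v by blast
        have "w \<star> e \<in> J" using J eJ by (simp add: ideal_KA_def)
        moreover have "w \<star> e = w" using w by (simp add: pideal_def conv_comm[of w])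
        ultimately show ?thesis using w by (simp add: J_def)
      qed
      then show ?thesis using U'(1) by blast
    qed
  qed
  then have "simple_rep H m \<rho>" using rep m0 by (simp add: simple_rep_def)
  moreover have "hat \<rho> m e = 1\<^sub>m m" unfolding hatR by (rule R1) (simp add: pideal_def)
  ultimately show ?thesis by blast
qed

subsection \<open>Characters and central primitive idempotents\<close>

text \<open>The trace formula reads \<open>e h\<close> off as the character at \<open>inv h\<close>
  divided by the group order, so two candidates for the definite description agree even if they come
  from different modules with the same character.\<close>

lemma cpi_of_eq:
  fixes e :: "'h \<Rightarrow> 'k::field_char_0"
  assumes s: "simple_rep H m \<rho>" and e: "pci e" and he: "hat \<rho> m e = 1\<^sub>m m"
  shows "cpi_of H (character H \<rho>) = e"
  unfolding cpi_of_def
proof (rule the_equality)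
  show "pci e \<and> (\<exists>m' \<rho>'. simple_rep H m' \<rho>' \<and> character H \<rho>' = character H \<rho> \<and>
      mat m' m' (\<lambda>(i,j). \<Sum>h\<in>carrier H. e h * \<rho>' h $$ (i,j)) = 1\<^sub>m m')"
    using s e he unfolding hat_def by blast
next
  fix e' :: "'h \<Rightarrow> 'k"
  assume "pci e' \<and> (\<exists>m' \<rho>'. simple_rep H m' \<rho>' \<and> character H \<rho>' = character H \<rho> \<and>
      mat m' m' (\<lambda>(i,j). \<Sum>h\<in>carrier H. e' h * \<rho>' h $$ (i,j)) = 1\<^sub>m m')"
  then obtain m' \<rho>' where e': "pci e'" and s': "simple_rep H m' \<rho>'"
    and ch: "character H \<rho>' = character H \<rho>" and he': "hat \<rho>' m' e' = 1\<^sub>m m'"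
    unfolding hat_def by blast
  show "e' = e"
  proof
    fix h
    show "e' h = e h"
    proof (cases "h \<in> carrier H")
      case True
      then have "mat_tr (\<rho>' (inv h)) = mat_tr (\<rho> (inv h))"
        using fun_cong[OF ch, of "inv h"] by (simp add: character_def)
      then show ?thesis
        using True simple_trace[OF s e he, of "inv h"] simple_trace[OF s' e' he', of "inv h"]
          N_nonzero[where 'k='k] by simp
    next
      case False
      then show ?thesis using pciD(1)[OF e] pciD(1)[OF e'] KA_vanish by metis
    qed
  qed
qed

lemma character_cpi_of:
  assumes s: "simple_rep H m (\<rho> :: 'h \<Rightarrow> 'k::field_char_0 mat)"
  shows "pci (cpi_of H (character H \<rho>))" "hat \<rho> m (cpi_of H (character H \<rho>)) = 1\<^sub>m m"
    "character H \<rho> = (\<lambda>g. if g \<in> carrier H then N * cpi_of H (character H \<rho>) (inv g) else 0)"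
proof -
  obtain e where e: "pci e" "hat \<rho> m e = 1\<^sub>m m" using simple_exists_pci[OF s] by blast
  have "cpi_of H (character H \<rho>) = e" by (rule cpi_of_eq[OF s e])
  then show "pci (cpi_of H (character H \<rho>))" "hat \<rho> m (cpi_of H (character H \<rho>)) = 1\<^sub>m m"
    "character H \<rho> = (\<lambda>g. if g \<in> carrier H then N * cpi_of H (character H \<rho>) (inv g) else 0)"
    using e simple_trace[OF s e] by (auto simp: character_def)
qed

lemma cpi_of_inj:
  assumes "\<chi> \<in> irr_chars H" "\<psi> \<in> irr_chars H" "cpi_of H \<chi> = cpi_of H \<psi>"
  shows "\<chi> = (\<psi> :: 'h \<Rightarrow> 'k::field_char_0)"
proof -
  have \<chi>: "\<chi> = (\<lambda>g. if g \<in> carrier H then N * cpi_of H \<chi> (inv g) else 0)"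
    using assms(1) character_cpi_of(3) unfolding irr_chars_def by blast
  have \<psi>: "\<psi> = (\<lambda>g. if g \<in> carrier H then N * cpi_of H \<psi> (inv g) else 0)"
    using assms(2) character_cpi_of(3) unfolding irr_chars_def by blast
  show ?thesis by (subst \<chi>, subst \<psi>) (simp only: assms(3))
qed

lemma cpi_of_bij:
  "bij_betw (cpi_of H) (irr_chars H :: ('h \<Rightarrow> 'k::field_char_0) set) {e. pci e}"
  unfolding bij_betw_def
proof
  show "inj_on (cpi_of H) (irr_chars H :: ('h \<Rightarrow> 'k) set)"
    by (rule inj_onI) (rule cpi_of_inj)
  show "cpi_of H ` (irr_chars H :: ('h \<Rightarrow> 'k) set) = {e. pci e}"
  proof
    show "cpi_of H ` (irr_chars H :: ('h \<Rightarrow> 'k) set) \<subseteq> {e. pci e}"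
      using character_cpi_of(1) by (auto simp: irr_chars_def)
    show "{e. pci e} \<subseteq> cpi_of H ` (irr_chars H :: ('h \<Rightarrow> 'k) set)"
    proof
      fix e :: "'h \<Rightarrow> 'k" assume "e \<in> {e. pci e}"
      then have e: "pci e" by simp
      obtain m \<rho> where s: "simple_rep H m \<rho>" and he: "hat \<rho> m e = 1\<^sub>m m"
        using pci_exists_simple[OF e] by blast
      have "cpi_of H (character H \<rho>) = e" by (rule cpi_of_eq[OF s e he])
      moreover have "character H \<rho> \<in> irr_chars H" using s by (auto simp: irr_chars_def)
      ultimately show "e \<in> cpi_of H ` irr_chars H" by blast
    qed
  qed
qed

lemma cpi_of_pci: "\<chi> \<in> irr_chars H \<Longrightarrow> pci (cpi_of H (\<chi> :: 'h \<Rightarrow> 'k::field_char_0))"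
  using cpi_of_bij by (auto simp: bij_betw_def)

text \<open>An idempotent acts on a simple module as 0 or 1, and if it acts as 1 then it is the
  idempotent of that module, which determines the character.\<close>

lemma hat_cpi_of:
  fixes \<rho> :: "'h \<Rightarrow> 'k::field_char_0 mat"
  assumes s: "simple_rep H m \<rho>" and \<chi>: "\<chi> \<in> irr_chars H"
  shows "hat \<rho> m (cpi_of H \<chi>) = (if character H \<rho> = \<chi> then 1\<^sub>m m else 0\<^sub>m m m)"
proof (cases "character H \<rho> = \<chi>")
  case True
  then show ?thesis using character_cpi_of(2)[OF s] by auto
next
  case False
  have irr: "character H \<rho> \<in> irr_chars H" using s by (auto simp: irr_chars_def)
  have "hat \<rho> m (cpi_of H \<chi>) \<noteq> 1\<^sub>m m"
  proof
    assume "hat \<rho> m (cpi_of H \<chi>) = 1\<^sub>m m"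
    from cpi_of_eq[OF s cpi_of_pci[OF \<chi>] this] have "character H \<rho> = \<chi>"
      using cpi_of_inj[OF irr \<chi>] by blast
    then show False using False by blast
  qed
  then show ?thesis using simple_hat_idem[OF s pciD(2)[OF cpi_of_pci[OF \<chi>]]] False by auto
qed

text \<open>If \<open>x\<close> is nonzero, some primitive \<open>e\<close> has nonzero product with
  \<open>x\<close>. By minimality \<open>e\<close> is then a multiple of \<open>e \<star> x\<close>,
  so it acts as 0 on the module where it should act as 1.\<close>

lemma hat_separates:
  fixes x :: "'h \<Rightarrow> 'k::field_char_0"
  assumes x: "x \<in> KA" and z: "\<And>m \<rho>. simple_rep H m \<rho> \<Longrightarrow> hat \<rho> m x = 0\<^sub>m m m"
  shows "x = (\<lambda>_. 0)"
proof (rule ccontr)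
  assume x0: "x \<noteq> (\<lambda>_. 0)"
  have "\<exists>e. pci e \<and> e \<star> x \<noteq> (\<lambda>_. 0)"
  proof (rule exists_pci)
    fix a b assume "(\<lambda>h. a h + b h) \<star> x \<noteq> (\<lambda>_. 0)"
    then show "a \<star> x \<noteq> (\<lambda>_. 0) \<or> b \<star> x \<noteq> (\<lambda>_. 0)" by (auto simp: conv_add_left)
  qed (use x x0 in \<open>auto simp: pt_one_conv conv_zero_left\<close>)
  then obtain e where e: "pci e" and ex: "e \<star> x \<noteq> (\<lambda>_. 0)" by blast
  let ?J = "{z \<star> (e \<star> x) | z. True}"
  have "fun_subspace (carrier H) ?J"
    unfolding fun_subspace_def
  proof (intro conjI ballI allI)
    show "(\<lambda>_. 0) \<in> ?J" by (auto simp: conv_zero_left intro!: exI[of _ "\<lambda>_. 0"])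
    fix u v assume "u \<in> ?J" "v \<in> ?J"
    then obtain a b where "u = a \<star> (e \<star> x)" "v = b \<star> (e \<star> x)" by blast
    then have "(\<lambda>s. u s + v s) = (\<lambda>h. a h + b h) \<star> (e \<star> x)" by (simp only: conv_add_left)
    then show "(\<lambda>s. u s + v s) \<in> ?J" by blast
  next
    fix c u assume "u \<in> ?J"
    then obtain a where "u = a \<star> (e \<star> x)" by blast
    then have "(\<lambda>s. c * u s) = (\<lambda>h. c * a h) \<star> (e \<star> x)"
      by (simp only: conv_comm[of _ "e \<star> x"] conv_smult)
    then show "(\<lambda>s. c * u s) \<in> ?J" by blast
  qed (use KA_vanish[OF conv_in] in auto)
  moreover have "y \<star> u \<in> ?J" if "u \<in> ?J" for u y
  proof -
    from that obtain a where "u = a \<star> (e \<star> x)" by blast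
    then have "y \<star> u = (y \<star> a) \<star> (e \<star> x)" by (simp only: conv_assoc)
    then show ?thesis by blast
  qed
  ultimately have J: "ideal_KA ?J" by (simp add: ideal_KA_def)
  have "?J \<subseteq> pideal e"
  proof clarify
    fix z
    have "e \<star> (z \<star> (e \<star> x)) = z \<star> ((e \<star> e) \<star> x)" by (simp only: conv_lcomm[of e z] conv_assoc)
    then show "z \<star> (e \<star> x) \<in> pideal e" using pciD(2)[OF e] by (simp add: pideal_def conv_in)
  qed
  moreover have "e \<star> x \<in> ?J" using pt_one_conv[OF conv_in, of e x, symmetric] by blast
  ultimately have "e \<in> ?J" using pci_minimal[OF e J _ _ ex] by blast
  then obtain z where ez: "e = z \<star> (e \<star> x)" by blast
  obtain m \<rho> where s: "simple_rep H m \<rho>" and he: "hat \<rho> m e = 1\<^sub>m m"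
    using pci_exists_simple[OF e] by blast
  have r: "is_rep H m \<rho>" and m: "m > 0" using s by (auto simp: simple_rep_def)
  have "hat \<rho> m e = hat \<rho> m (z \<star> (e \<star> x))" using ez by simp
  also have "\<dots> = hat \<rho> m z * (hat \<rho> m e * 0\<^sub>m m m)" by (simp add: hat_conv[OF r] z[OF s])
  also have "\<dots> = 0\<^sub>m m m" using hat_carrier[of \<rho> m z] by (simp add: he)
  finally show False using he one_mat_nonzero[OF m, where 'k='k] by simp
qed

end

section \<open>The map of group algebras induced by a surjective homomorphism\<close>

definition push :: "('a,'c) monoid_scheme \<Rightarrow> ('b,'d) monoid_scheme \<Rightarrow> ('a \<Rightarrow> 'b) \<Rightarrow> ('a \<Rightarrow> 'k::field_char_0) \<Rightarrow> 'b \<Rightarrow> 'k" where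
  "push A B p x = (\<lambda>b. if b \<in> carrier B then \<Sum>a | a \<in> carrier A \<and> p a = b. x a else 0)"

text \<open>Simple modules of \<open>B\<close> stay simple when inflated along \<open>p\<close>, and
  the pushed element acts on \<open>\<sigma>\<close> as the original acts on the inflation
  \<open>\<sigma> \<circ> p\<close>: as 1 if \<open>\<theta>\<close> is the inflated character, as 0
  otherwise. Elements of the group algebra of \<open>B\<close> are determined by these
  actions.\<close>

lemma push_cpi_of:
  fixes A :: "('a,'c) monoid_scheme" and B :: "('b,'d) monoid_scheme" and \<theta> :: "'a \<Rightarrow> 'k::field_char_0"
  assumes A: "fin_comm_group A" and B: "fin_comm_group B" and p: "p \<in> hom A B"
    and surj: "p ` carrier A = carrier B" and \<theta>: "\<theta> \<in> irr_chars A"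
  shows "\<chi> \<in> irr_chars B \<Longrightarrow> \<forall>a\<in>carrier A. \<theta> a = \<chi> (p a) \<Longrightarrow> push A B p (cpi_of A \<theta>) = cpi_of B \<chi>"
    and "\<not> (\<exists>\<chi>\<in>irr_chars B. \<forall>a\<in>carrier A. \<theta> a = \<chi> (p a)) \<Longrightarrow> push A B p (cpi_of A \<theta>) = (\<lambda>_. 0)"
proof -
  interpret A: fin_comm_group A by (rule A)
  interpret B: fin_comm_group B by (rule B)
  have pc: "p a \<in> carrier B" if "a \<in> carrier A" for a using surj that by blast
  have simple: "simple_rep A m (\<sigma> \<circ> p)" if s: "simple_rep B m \<sigma>" for m and \<sigma> :: "'b \<Rightarrow> 'k mat"
  proof -
    have "is_rep B m \<sigma>" using s by (simp add: simple_rep_def)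
    then have "is_rep A m (\<sigma> \<circ> p)"
      using p pc by (simp add: is_rep_def hom_mult hom_one[OF p A.is_group B.is_group])
    \<comment> \<open>Surjectivity enters here: every operator of \<open>B\<close> is an operator of
      \<open>A\<close>, so no new invariant subspaces appear.\<close>
    moreover have "invariant_subspace B m \<sigma> W" if W: "invariant_subspace A m (\<sigma> \<circ> p) W" for W
      unfolding invariant_subspace_def
    proof (intro conjI)
      show "\<forall>b\<in>carrier B. \<forall>v\<in>W. \<sigma> b *\<^sub>v v \<in> W"
        using W unfolding invariant_subspace_def surj[symmetric] by simp
    qed (use W in \<open>simp_all add: invariant_subspace_def\<close>)
    ultimately show ?thesis using s by (auto simp: simple_rep_def)
  qed
  have hat: "B.hat \<sigma> m (push A B p x) = A.hat (\<sigma> \<circ> p) m x" for m and \<sigma> :: "'b \<Rightarrow> 'k mat" and x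
  proof (rule eq_matI)
    fix i j assume "i < dim_row (A.hat (\<sigma> \<circ> p) m x)" "j < dim_col (A.hat (\<sigma> \<circ> p) m x)"
    then have ij: "i < m" "j < m" by (auto simp: A.hat_def)
    have "(\<Sum>b\<in>carrier B. push A B p x b * \<sigma> b $$ (i,j)) =
        (\<Sum>b\<in>carrier B. \<Sum>a | a \<in> carrier A \<and> p a = b. x a * \<sigma> (p a) $$ (i,j))"
      by (rule sum.cong) (auto simp: push_def sum_distrib_right)
    also have "\<dots> = (\<Sum>a\<in>carrier A. x a * \<sigma> (p a) $$ (i,j))"
      by (rule sum.group) (use A.fin B.fin pc in auto)
    finally show "B.hat \<sigma> m (push A B p x) $$ (i,j) = A.hat (\<sigma> \<circ> p) m x $$ (i,j)"
      using ij by (simp add: A.hat_def B.hat_def)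
  qed (auto simp: A.hat_def B.hat_def)
  have char: "character A (\<sigma> \<circ> p) = \<theta> \<longleftrightarrow> (\<forall>a\<in>carrier A. \<theta> a = character B \<sigma> (p a))"
    for \<sigma> :: "'b \<Rightarrow> 'k mat"
  proof -
    have "\<theta> a = 0" if "a \<notin> carrier A" for a
      using \<theta> that by (auto simp: irr_chars_def character_def)
    then show ?thesis using pc by (auto simp: character_def fun_eq_iff)
  qed
  have hat_push: "B.hat \<sigma> m (push A B p (cpi_of A \<theta>)) =
      (if \<forall>a\<in>carrier A. \<theta> a = character B \<sigma> (p a) then 1\<^sub>m m else 0\<^sub>m m m)"
    if s: "simple_rep B m \<sigma>" for m \<sigma>
    using A.hat_cpi_of[OF simple[OF s] \<theta>] unfolding hat char .
  have push_in: "push A B p (cpi_of A \<theta>) \<in> group_alg B" by (simp add: group_alg_def push_def)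
  show "push A B p (cpi_of A \<theta>) = cpi_of B \<chi>"
    if \<chi>: "\<chi> \<in> irr_chars B" and eq: "\<forall>a\<in>carrier A. \<theta> a = \<chi> (p a)"
  proof -
    define d where "d = (\<lambda>b. push A B p (cpi_of A \<theta>) b + (-1) * cpi_of B \<chi> b)"
    have c: "(\<lambda>b. (-1) * cpi_of B \<chi> b) \<in> group_alg B"
      using B.pciD(1)[OF B.cpi_of_pci[OF \<chi>]] by (simp add: group_alg_def)
    have "d = (\<lambda>_. 0)"
    proof (rule B.hat_separates)
      show "d \<in> group_alg B" unfolding d_def by (rule B.add_in[OF push_in c])
      fix m and \<sigma> :: "'b \<Rightarrow> 'k mat" assume s: "simple_rep B m \<sigma>"
      have "character B \<sigma> = \<chi> \<longleftrightarrow> (\<forall>a\<in>carrier A. \<theta> a = character B \<sigma> (p a))"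
      proof
        assume r: "\<forall>a\<in>carrier A. \<theta> a = character B \<sigma> (p a)"
        have "character B \<sigma> b = \<chi> b" for b
        proof (cases "b \<in> carrier B")
          case True
          then show ?thesis using r eq surj by (metis imageE)
        next
          case False
          then show ?thesis using \<chi> by (auto simp: irr_chars_def character_def)
        qed
        then show "character B \<sigma> = \<chi>" by blast
      qed (use eq in simp)
      then have "B.hat \<sigma> m (push A B p (cpi_of A \<theta>)) = B.hat \<sigma> m (cpi_of B \<chi>)"
        using hat_push[OF s] B.hat_cpi_of[OF s \<chi>] by simp
      moreover have "B.hat \<sigma> m (\<lambda>b. (-1) * cpi_of B \<chi> b) = - B.hat \<sigma> m (cpi_of B \<chi>)"
        by (rule eq_matI) (auto simp: B.hat_def sum_negf)
      ultimately show "B.hat \<sigma> m d = 0\<^sub>m m m"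
        unfolding d_def B.hat_add
        by (intro eq_matI) (simp_all add: carrier_matD[OF B.hat_carrier])
    qed
    then show ?thesis by (auto simp: d_def fun_eq_iff)
  qed
  show "push A B p (cpi_of A \<theta>) = (\<lambda>_. 0)"
    if no: "\<not> (\<exists>\<chi>\<in>irr_chars B. \<forall>a\<in>carrier A. \<theta> a = \<chi> (p a))"
  proof (rule B.hat_separates[OF push_in])
    fix m and \<sigma> :: "'b \<Rightarrow> 'k mat" assume s: "simple_rep B m \<sigma>"
    then have "character B \<sigma> \<in> irr_chars B" by (auto simp: irr_chars_def)
    then show "B.hat \<sigma> m (push A B p (cpi_of A \<theta>)) = 0\<^sub>m m m" using hat_push[OF s] no by auto
  qed
qed

subsection \<open>Finite cyclic groups\<close>

text \<open>Take j to be the product of the primes of n that do not divide i. A prime p of n then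
  divides exactly one of i and k j: if p divides i, it divides neither k nor j. This is the lifting
  of units modulo k to units modulo n.\<close>

lemma coprime_lift:
  fixes i k n :: nat
  assumes "coprime i k" "n > 0"
  shows "\<exists>j. coprime (i + k * j) n"
proof -
  define t where "t = \<Prod>{p \<in> prime_factors n. \<not> p dvd i}"
  have fin: "finite {p \<in> prime_factors n. \<not> p dvd i}" by simp
  have "\<not> p dvd i + k * t" if p: "normalization_semidom_class.prime p" "p dvd n" for p
  proof (cases "p dvd i")
    case True
    have "\<not> p dvd k" using True assms(1) p(1) by (meson coprime_common_divisor not_prime_unit)
    moreover have "\<not> p dvd t"
    proof
      assume "p dvd t"
      then obtain q where q: "q \<in> {p \<in> prime_factors n. \<not> p dvd i}" "p dvd q"
        unfolding t_def using prime_dvd_prod_iff[OF fin p(1)] by auto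
      then have "p = q" using p(1) by (auto simp: primes_dvd_imp_eq in_prime_factors_iff)
      then show False using q True by simp
    qed
    ultimately show ?thesis using True p(1) by (simp add: dvd_add_right_iff prime_dvd_mult_iff)
  next
    case False
    then have "p \<in> {p \<in> prime_factors n. \<not> p dvd i}" using p assms(2) by (simp add: in_prime_factors_iff)
    then have "p dvd t" unfolding t_def using dvd_prodI[OF fin, of p "\<lambda>x. x"] by simp
    then show ?thesis using False by (simp add: dvd_add_left_iff)
  qed
  note nd = this
  have "gcd (i + k * t) n = 1"
  proof (rule ccontr)
    assume "gcd (i + k * t) n \<noteq> 1"
    then obtain p where "normalization_semidom_class.prime p" "p dvd gcd (i + k * t) n"
      using prime_factor_nat by blast
    then show False using nd[of p] by simp
  qed
  then have "coprime (i + k * t) n" by (simp add: coprime_iff_gcd_eq_1)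
  then show ?thesis by blast
qed

locale fin_cyclic_group = comm_group G for G :: "('g,'c) monoid_scheme" (structure) +
  assumes finG: "finite (carrier G)" and cyc: "cyclic_group G"
begin

lemma order_pos: "order G > 0"
  using finG order_gt_0_iff_finite by blast

lemma generator:
  obtains x where "x \<in> carrier G" "carrier G = range (\<lambda>i::nat. x [^] i)" "ord x = order G"
proof -
  obtain x where x: "x \<in> carrier G" "subgroup_generated G {x} = G"
    using cyc by (auto simp: cyclic_group_def)
  then have "carrier G = generate G {x}" using carrier_subgroup_generated[of G "{x}"] by simp
  moreover have "generate G {x} = range (\<lambda>i::nat. x [^] i)"
    using generate_pow_on_finite_carrier[OF finG x(1)] by auto
  moreover have "ord x = card (generate G {x})" by (rule generate_pow_card[OF x(1)])
  ultimately show ?thesis using x that by (simp add: order_def)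
qed

lemma subgroup_in: "subgroup U G \<Longrightarrow> u \<in> U \<Longrightarrow> u \<in> carrier G"
  by (rule subgroup.mem_carrier)

lemma subgroup_fin: "subgroup U G \<Longrightarrow> finite U"
  using finite_subset[OF subgroup.subset finG] .

lemma subgroup_pow: "subgroup U G \<Longrightarrow> u \<in> U \<Longrightarrow> u [^] (i::nat) \<in> U"
  by (induction i) (auto simp: subgroup.one_closed subgroup.m_closed)

lemma subgroup_card_pos: "subgroup U G \<Longrightarrow> card U > 0"
  using subgroup_fin[of U] subgroup.one_closed[of U G] by (auto simp: card_gt_0_iff)

lemma subgroup_card_dvd: "subgroup U G \<Longrightarrow> card U dvd order G"
  using dvd_triv_right[of "card U" "card (rcosets U)"] by (simp add: lagrange)

text \<open>One inclusion is Lagrange. Conversely, an element killed by \<open>card U\<close> is a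
  power of the generator whose exponent, reduced modulo the group order, is one of only
  \<open>card U\<close> multiples of the index. In particular a subgroup is determined by its
  order.\<close>

lemma subgroup_eq_torsion:
  assumes U: "subgroup U G"
  shows "U = {g \<in> carrier G. g [^] card U = \<one>}"
proof (rule card_seteq)
  obtain x where x: "x \<in> carrier G" "carrier G = range (\<lambda>i::nat. x [^] i)" "ord x = order G"
    by (rule generator)
  let ?S = "{g \<in> carrier G. g [^] card U = \<one>}"
  let ?k = "card U" and ?d = "order G div card U"
  show "finite ?S" using finG by simp
  show "U \<subseteq> ?S"
  proof
    fix u assume u: "u \<in> U"
    interpret UG: group "G\<lparr>carrier := U\<rparr>" by (rule subgroup_imp_group[OF U])
    have "u [^]\<^bsub>G\<lparr>carrier := U\<rparr>\<^esub> order (G\<lparr>carrier := U\<rparr>) = \<one>"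
      using UG.pow_order_eq_1[of u] u by simp
    then have "u [^] card U = \<one>" using nat_pow_consistent[of u "card U" U] by (simp add: order_def)
    then show "u \<in> ?S" using subgroup_in[OF U u] by simp
  qed
  have kd: "?k * ?d = order G" using subgroup_card_dvd[OF U] by simp
  have k0: "?k > 0" by (rule subgroup_card_pos[OF U])
  have "?S \<subseteq> (\<lambda>j. x [^] (?d * j)) ` {..<?k}"
  proof
    fix g assume g: "g \<in> ?S"
    then obtain i :: nat where i: "g = x [^] i" using x(2) by auto
    define r where "r = i mod order G"
    have gr: "g = x [^] r"
    proof -
      have "x [^] i = x [^] (order G * (i div order G) + r)" by (simp add: r_def)
      also have "\<dots> = x [^] r"
        using x(1) pow_order_eq_1[OF x(1)] by (simp only: nat_pow_mult[symmetric] nat_pow_pow[symmetric] nat_pow_one l_one nat_pow_closed)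
      finally show ?thesis using i by simp
    qed
    have "x [^] (r * ?k) = \<one>" using g gr x(1) by (simp add: nat_pow_pow)
    then have "order G dvd r * ?k" using pow_eq_id[OF x(1)] x(3) by simp
    then have "?k * ?d dvd ?k * r" using kd by (simp add: mult.commute)
    then obtain j where j: "r = ?d * j" using k0 by (auto simp: dvd_def)
    have "r < ?k * ?d" using kd order_pos by (simp add: r_def)
    then have "j < ?k" using j by (metis mult.commute mult_less_cancel2)
    then show "g \<in> (\<lambda>j. x [^] (?d * j)) ` {..<?k}" using gr j by blast
  qed
  then show "card ?S \<le> card U" using card_image_le[of "{..<?k}"] card_mono
    by (metis (no_types, lifting) card_lessThan finite_imageI finite_lessThan le_trans)
qed

text \<open>The power map by the index sends G onto U. Besides yielding generators of subgroups, it
  provides the power map used to test central elements.\<close>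

lemma subgroup_pow_image:
  assumes U: "subgroup U G"
  shows "U = (\<lambda>g. g [^] (order G div card U)) ` carrier G"
proof -
  obtain x where x: "x \<in> carrier G" "carrier G = range (\<lambda>i::nat. x [^] i)" "ord x = order G"
    by (rule generator)
  let ?k = "card U" and ?d = "order G div card U"
  have kd: "?k * ?d = order G" using subgroup_card_dvd[OF U] by simp
  have k0: "?k > 0" by (rule subgroup_card_pos[OF U])
  show ?thesis
  proof (intro subset_antisym subsetI)
    fix u assume "u \<in> U"
    then have u: "u \<in> carrier G" "u [^] ?k = \<one>" using subgroup_eq_torsion[OF U] by auto
    then obtain i :: nat where i: "u = x [^] i" using x(2) by auto
    have "x [^] (i * ?k) = \<one>" using u i x(1) by (simp add: nat_pow_pow)
    then have "?k * ?d dvd ?k * i" using pow_eq_id[OF x(1)] x(3) kd by (simp add: mult.commute)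
    then obtain j where j: "i = ?d * j" using k0 by (auto simp: dvd_def)
    have "u = (x [^] j) [^] ?d" using i j x(1) by (simp add: nat_pow_pow mult.commute)
    then show "u \<in> (\<lambda>g. g [^] ?d) ` carrier G" using x(1) by blast
  next
    fix u assume "u \<in> (\<lambda>g. g [^] ?d) ` carrier G"
    then obtain g where g: "g \<in> carrier G" "u = g [^] ?d" by blast
    have "u [^] ?k = \<one>" using g pow_order_eq_1[OF g(1)] kd by (simp add: nat_pow_pow mult.commute)
    then show "u \<in> U" using g by (subst subgroup_eq_torsion[OF U]) simp
  qed
qed

lemma subgroup_generator:
  assumes U: "subgroup U G"
  obtains y where "y \<in> U" "U = range (\<lambda>i::nat. y [^] i)" "ord y = card U"
proof -
  obtain x where x: "x \<in> carrier G" "carrier G = range (\<lambda>i::nat. x [^] i)" "ord x = order G"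
    by (rule generator)
  define y where "y = x [^] (order G div card U)"
  have "y \<in> U" unfolding y_def using x(1) by (subst subgroup_pow_image[OF U]) blast
  moreover have r: "U = range (\<lambda>i::nat. y [^] i)"
  proof -
    have "U = (\<lambda>g. g [^] (order G div card U)) ` range (\<lambda>i::nat. x [^] i)"
      using subgroup_pow_image[OF U] x(2) by simp
    also have "\<dots> = range (\<lambda>i::nat. y [^] i)"
      unfolding y_def image_image using x(1) by (simp add: nat_pow_pow mult.commute)
    finally show ?thesis .
  qed
  moreover have "ord y = card U"
  proof -
    have y: "y \<in> carrier G" using x(1) by (simp add: y_def)
    have "generate G {y} = U" using generate_pow_on_finite_carrier[OF finG y] r by auto
    then show ?thesis using generate_pow_card[OF y] by simp
  qed
  ultimately show ?thesis using that by blast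
qed

text \<open>The image of a generator \<open>y\<close> is killed by \<open>card U\<close>, so by the
  torsion description it falls back into U and is a power of \<open>y\<close>.\<close>

lemma hom_is_power:
  assumes U: "subgroup U G" and f: "f \<in> hom (G\<lparr>carrier := U\<rparr>) G"
  shows "\<exists>i::nat. \<forall>u\<in>U. f u = u [^] i"
proof -
  obtain y where y: "y \<in> U" "U = range (\<lambda>i::nat. y [^] i)" "ord y = card U"
    by (rule subgroup_generator[OF U])
  have yG: "y \<in> carrier G" using subgroup_in[OF U y(1)] .
  have fc: "f u \<in> carrier G" if "u \<in> U" for u using f that by (auto simp: hom_def)
  have fm: "f (u \<otimes> v) = f u \<otimes> f v" if "u \<in> U" "v \<in> U" for u v using f that by (auto simp: hom_def)
  have f1: "f \<one> = \<one>"
    using fm[of \<one> \<one>] subgroup.one_closed[OF U] fc[of \<one>] by (metis l_cancel_one one_closed r_one)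
  have fpow: "f (y [^] j) = f y [^] j" for j :: nat
    by (induction j) (simp_all add: f1 fm subgroup_pow[OF U] y(1))
  have "f y [^] card U = \<one>" using fpow[of "card U"] f1 pow_ord_eq_1[OF yG] y(3) by simp
  then have "f y \<in> U" using fc[OF y(1)] by (subst subgroup_eq_torsion[OF U]) simp
  then obtain i :: nat where i: "f y = y [^] i" using y(2) by blast
  have "f u = u [^] i" if u: "u \<in> U" for u
  proof -
    obtain j :: nat where j: "u = y [^] j" using u y(2) by blast
    then show ?thesis using fpow[of j] i yG by (simp add: nat_pow_pow mult.commute)
  qed
  then show ?thesis by blast
qed

text \<open>With d the gcd, the element \<open>y [^] (card U div d)\<close> is killed by the i-th
  power map, so it is trivial and d = 1.\<close>

lemma coprime_if_inj_power:
  assumes U: "subgroup U G" and inj: "inj_on (\<lambda>u. u [^] (i::nat)) U"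
  shows "coprime i (card U)"
proof -
  obtain y where y: "y \<in> U" "U = range (\<lambda>i::nat. y [^] i)" "ord y = card U"
    by (rule subgroup_generator[OF U])
  have yG: "y \<in> carrier G" using subgroup_in[OF U y(1)] .
  define d where "d = gcd i (card U)"
  obtain a b where a: "i = d * a" and b: "card U = d * b" unfolding d_def by (meson dvdE gcd_dvd1 gcd_dvd2)
  have "(y [^] b) [^] i = (y [^] card U) [^] a" using yG a b by (simp add: nat_pow_pow ac_simps)
  also have "\<dots> = \<one> [^] i" using pow_ord_eq_1[OF yG] y(3) by simp
  finally have "y [^] b = \<one>"
    using inj_onD[OF inj, of "y [^] b" \<one>] subgroup_pow[OF U y(1)] subgroup.one_closed[OF U] by simp
  then have "d * b dvd b" using pow_eq_id[OF yG] y(3) b by simp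
  moreover have "b > 0" using b subgroup_card_pos[OF U] by (cases b) auto
  ultimately have "d = 1" by (simp add: dvd_mult_cancel2)
  then show ?thesis unfolding d_def by (simp add: coprime_iff_gcd_eq_1)
qed

lemma inj_power_if_coprime:
  assumes "coprime i (order G)"
  shows "inj_on (\<lambda>g. g [^] (i::nat)) (carrier G)"
proof (rule inj_onI)
  fix g h assume gh: "g \<in> carrier G" "h \<in> carrier G" "g [^] i = h [^] i"
  let ?t = "g \<otimes> inv h"
  have t: "?t \<in> carrier G" using gh by simp
  have "?t [^] i = \<one>" using gh by (simp add: nat_pow_distrib nat_pow_inv)
  then have "ord ?t dvd i" using pow_eq_id[OF t] by simp
  moreover have "ord ?t dvd order G" by (rule ord_dvd_group_order[OF t])
  ultimately have "ord ?t = 1" using assms by (metis coprime_common_divisor_nat)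
  then have "?t = \<one>" using ord_eq_1[OF t] by simp
  then show "g = h" using gh by (metis inv_closed inv_equality inv_inv)
qed

subsection \<open>Automorphisms of subgroups of a cyclic group\<close>

lemma carrier_AutG: "carrier (AutG G U) = {a \<in> extensional U. a \<in> hom (G\<lparr>carrier := U\<rparr>) (G\<lparr>carrier := U\<rparr>) \<and> bij_betw a U U}"
  by (auto simp: AutG_def AutoGroup_def auto_def Bij_def)

lemma AutG_mult: "a \<in> carrier (AutG G U) \<Longrightarrow> b \<in> carrier (AutG G U) \<Longrightarrow> a \<otimes>\<^bsub>AutG G U\<^esub> b = compose U a b"
  by (auto simp: AutG_def AutoGroup_def auto_def BijGroup_def)

lemma AutG_carrier: "AutG G (carrier G) = AutoGroup G"
  by (simp add: AutG_def)

text \<open>Both properties of the exponent are recorded: \<open>p_res\<close> is phrased with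
  coprime exponents, while the arguments on graphs use injectivity.\<close>

lemma AutG_iff:
  assumes U: "subgroup U G"
  shows "a \<in> carrier (AutG G U) \<longleftrightarrow> (\<exists>i::nat. coprime i (card U) \<and> inj_on (\<lambda>u. u [^] i) U \<and> a = (\<lambda>u\<in>U. u [^] i))"
proof
  assume a: "a \<in> carrier (AutG G U)"
  then have "a \<in> hom (G\<lparr>carrier := U\<rparr>) G" using subgroup_in[OF U] by (auto simp: carrier_AutG hom_def)
  then obtain i :: nat where i: "\<And>u. u \<in> U \<Longrightarrow> a u = u [^] i" using hom_is_power[OF U] by blast
  have "inj_on a U" using a by (auto simp: carrier_AutG bij_betw_def)
  then have inj: "inj_on (\<lambda>u. u [^] i) U" using i by (simp add: inj_on_def)
  moreover have "a = (\<lambda>u\<in>U. u [^] i)"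
    using a i by (auto simp: carrier_AutG fun_eq_iff extensional_def)
  ultimately show "\<exists>i::nat. coprime i (card U) \<and> inj_on (\<lambda>u. u [^] i) U \<and> a = (\<lambda>u\<in>U. u [^] i)"
    using coprime_if_inj_power[OF U] by blast
next
  assume "\<exists>i::nat. coprime i (card U) \<and> inj_on (\<lambda>u. u [^] i) U \<and> a = (\<lambda>u\<in>U. u [^] i)"
  then obtain i :: nat where i: "inj_on (\<lambda>u. u [^] i) U" "a = (\<lambda>u\<in>U. u [^] i)" by blast
  have "(\<lambda>u. u [^] i) ` U \<subseteq> U" using subgroup_pow[OF U] by blast
  then have "(\<lambda>u. u [^] i) ` U = U" using endo_inj_surj[OF subgroup_fin[OF U] _ i(1)] by blast
  then have "bij_betw (\<lambda>u. u [^] i) U U" using i(1) by (simp add: bij_betw_def)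
  then have "bij_betw a U U" using i(2) by (simp cong: bij_betw_cong)
  moreover have "a \<in> hom (G\<lparr>carrier := U\<rparr>) (G\<lparr>carrier := U\<rparr>)"
    using i(2) subgroup_pow[OF U] subgroup.m_closed[OF U]
    by (auto simp: hom_def subgroup_in[OF U] nat_pow_distrib)
  ultimately show "a \<in> carrier (AutG G U)" using i(2) by (simp add: carrier_AutG)
qed

text \<open>An injective homomorphism into G is a power map, hence maps the finite group U onto
  itself. So Aut(U) acts regularly on \<open>Inj G U\<close>, and the permutation module is the
  regular module.\<close>

lemma Inj_eq:
  assumes U: "subgroup U G"
  shows "Inj G U = carrier (AutG G U)"
proof (intro subset_antisym subsetI)
  fix f assume f: "f \<in> Inj G U"
  then obtain i :: nat where i: "\<And>u. u \<in> U \<Longrightarrow> f u = u [^] i"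
    using hom_is_power[OF U, of f] unfolding Inj_def by blast
  have "inj_on f U" using f by (simp add: Inj_def)
  then have inj: "inj_on (\<lambda>u. u [^] i) U" using i by (simp add: inj_on_def)
  moreover have "f = (\<lambda>u\<in>U. u [^] i)" using f i by (auto simp: Inj_def fun_eq_iff extensional_def)
  ultimately show "f \<in> carrier (AutG G U)" using AutG_iff[OF U] coprime_if_inj_power[OF U] by blast
next
  fix f assume "f \<in> carrier (AutG G U)"
  then show "f \<in> Inj G U" using subgroup_in[OF U] by (auto simp: Inj_def carrier_AutG bij_betw_def hom_def)
qed

lemma AutG_fin_comm_group:
  assumes U: "subgroup U G"
  shows "fin_comm_group (AutG G U)"
proof -
  interpret UG: group "G\<lparr>carrier := U\<rparr>" by (rule subgroup_imp_group[OF U])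
  interpret A: group "AutG G U" unfolding AutG_def by (rule UG.AutoGroup)
  have comm: "a \<otimes>\<^bsub>AutG G U\<^esub> b = b \<otimes>\<^bsub>AutG G U\<^esub> a" if ab: "a \<in> carrier (AutG G U)" "b \<in> carrier (AutG G U)" for a b
  proof -
    obtain i j :: nat where "a = (\<lambda>u\<in>U. u [^] i)" "b = (\<lambda>u\<in>U. u [^] j)"
      using ab AutG_iff[OF U] by blast
    then have "compose U a b = compose U b a"
      using subgroup_pow[OF U] by (auto simp: compose_def fun_eq_iff nat_pow_pow subgroup_in[OF U] mult.commute)
    then show ?thesis using ab by (simp add: AutG_mult)
  qed
  have "carrier (AutG G U) \<subseteq> (\<Pi>\<^sub>E u\<in>U. U)"
    by (auto simp: carrier_AutG hom_def PiE_def)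
  then have "finite (carrier (AutG G U))"
    using finite_PiE[of U "\<lambda>_. U"] subgroup_fin[OF U] finite_subset by blast
  moreover have "comm_group (AutG G U)" by (rule A.group_comm_groupI) (rule comm)
  ultimately show ?thesis by (simp add: fin_comm_group_def fin_comm_group_axioms_def)
qed

text \<open>The exponent i is not unique, but every admissible one gives the same map on U, namely
  the restriction; this makes the definite description in \<open>p_res\<close> unambiguous.\<close>

lemma p_res_eq:
  assumes U: "subgroup U G" and a: "a \<in> carrier (AutoGroup G)"
  shows "p_res G U a = restrict a U" "p_res G U a \<in> carrier (AutG G U)"
proof -
  obtain i :: nat where i: "coprime i (order G)" "inj_on (\<lambda>u. u [^] i) (carrier G)" "a = (\<lambda>u\<in>carrier G. u [^] i)"
    using AutG_iff[OF subgroup_self] a unfolding AutG_carrier order_def by blast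
  have r: "restrict a U = (\<lambda>u\<in>U. u [^] i)" using i(3) subgroup_in[OF U] by (auto simp: fun_eq_iff)
  show p: "p_res G U a = restrict a U" unfolding p_res_def
  proof (rule the_equality)
    show "\<exists>i::nat. coprime i (order G) \<and> (\<forall>g\<in>carrier G. a g = g [^] i) \<and> restrict a U = (\<lambda>u\<in>U. u [^] i)"
      using i r by auto
    fix \<beta> assume "\<exists>i::nat. coprime i (order G) \<and> (\<forall>g\<in>carrier G. a g = g [^] i) \<and> \<beta> = (\<lambda>u\<in>U. u [^] i)"
    then show "\<beta> = restrict a U" using subgroup_in[OF U] by (auto simp: fun_eq_iff)
  qed
  have "inj_on (\<lambda>u. u [^] i) U" using i(2) subgroup.subset[OF U] inj_on_subset by blast
  then show "p_res G U a \<in> carrier (AutG G U)"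
    unfolding p r using AutG_iff[OF U] coprime_if_inj_power[OF U] by blast
qed

lemma p_res_hom:
  assumes U: "subgroup U G"
  shows "p_res G U \<in> hom (AutoGroup G) (AutG G U)"
proof (rule homI)
  fix a b assume ab: "a \<in> carrier (AutoGroup G)" "b \<in> carrier (AutoGroup G)"
  interpret A: fin_comm_group "AutoGroup G"
    using AutG_fin_comm_group[OF subgroup_self] unfolding AutG_carrier .
  have bU: "b u \<in> U" if "u \<in> U" for u
    using p_res_eq[OF U ab(2)] that bij_betw_apply[of "restrict b U" U U u] by (simp add: carrier_AutG)
  have "a \<otimes>\<^bsub>AutoGroup G\<^esub> b = compose (carrier G) a b"
    using AutG_mult[of a "carrier G" b] ab unfolding AutG_carrier by blast
  then have "restrict (a \<otimes>\<^bsub>AutoGroup G\<^esub> b) U = compose U (restrict a U) (restrict b U)"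
    using bU subgroup_in[OF U] by (auto simp: compose_def fun_eq_iff)
  then show "p_res G U (a \<otimes>\<^bsub>AutoGroup G\<^esub> b) = p_res G U a \<otimes>\<^bsub>AutG G U\<^esub> p_res G U b"
    using p_res_eq[OF U] ab AutG_mult A.m_closed by simp
qed (rule p_res_eq(2)[OF U])

text \<open>Adding a multiple of \<open>card U\<close> to the exponent does not change the power map
  on U, and a suitable multiple makes the exponent coprime to the order of G.\<close>

lemma p_res_surj:
  assumes U: "subgroup U G"
  shows "p_res G U ` carrier (AutoGroup G) = carrier (AutG G U)"
proof (intro subset_antisym subsetI)
  fix b assume "b \<in> carrier (AutG G U)"
  then obtain i :: nat where i: "coprime i (card U)" "b = (\<lambda>u\<in>U. u [^] i)" using AutG_iff[OF U] by blast
  obtain j where j: "coprime (i + card U * j) (order G)" using coprime_lift[OF i(1) order_pos] by blast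
  let ?a = "\<lambda>g\<in>carrier G. g [^] (i + card U * j)"
  have a: "?a \<in> carrier (AutoGroup G)"
    using AutG_iff[OF subgroup_self, of ?a] inj_power_if_coprime[OF j] j unfolding AutG_carrier order_def by blast
  have "u [^] (i + card U * j) = u [^] i" if u: "u \<in> U" for u
  proof -
    have "u \<in> carrier G" "u [^] card U = \<one>" using u subgroup_eq_torsion[OF U] by auto
    then show ?thesis by (simp add: nat_pow_mult[symmetric] nat_pow_pow[symmetric])
  qed
  then have "restrict ?a U = b" using i(2) subgroup_in[OF U] by (auto simp: fun_eq_iff)
  then show "b \<in> p_res G U ` carrier (AutoGroup G)" using p_res_eq(1)[OF U a] a by (metis image_eqI)
qed (use p_res_eq(2)[OF U] in blast)

text \<open>\<open>Inj G U\<close> is the group Aut(U) itself, so the module embeds by matrix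
  coefficients: \<open>v\<close> goes to the function
  \<open>l \<mapsto> (\<rho> l *\<^sub>v v) $ 0\<close>. The kernel is invariant and is not
  everything, because the unit vector with index 0 gives the value 1 at the identity.\<close>

lemma constituent_all:
  assumes U: "subgroup U G" and \<chi>: "(\<chi> :: ('g \<Rightarrow> 'g) \<Rightarrow> 'k::field_char_0) \<in> irr_chars (AutG G U)"
  shows "constituent_Inj G U \<chi>"
proof -
  let ?A = "AutG G U"
  interpret A: fin_comm_group ?A by (rule AutG_fin_comm_group[OF U])
  obtain m and \<rho> :: "('g \<Rightarrow> 'g) \<Rightarrow> 'k mat" where s: "simple_rep ?A m \<rho>" and ch: "\<chi> = character ?A \<rho>"
    using \<chi> by (auto simp: irr_chars_def)
  have r: "is_rep ?A m \<rho>" and m: "m > 0" using s by (auto simp: simple_rep_def)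
  have rc: "\<rho> a \<in> carrier_mat m m" if "a \<in> carrier ?A" for a using r that by (simp add: is_rep_def)
  have rm: "\<rho> (a \<otimes>\<^bsub>?A\<^esub> b) *\<^sub>v v = \<rho> a *\<^sub>v (\<rho> b *\<^sub>v v)"
    if "a \<in> carrier ?A" "b \<in> carrier ?A" "v \<in> carrier_vec m" for a b v
    using r assoc_mult_mat_vec[OF rc[OF that(1)] rc[OF that(2)] that(3)] that(1,2) by (simp add: is_rep_def)
  have radd: "\<rho> a *\<^sub>v (v + w) = \<rho> a *\<^sub>v v + \<rho> a *\<^sub>v w"
    if "a \<in> carrier ?A" "v \<in> carrier_vec m" "w \<in> carrier_vec m" for a v w
    using mult_add_distrib_mat_vec[OF rc[OF that(1)]] that by simp
  have rsm: "\<rho> a *\<^sub>v (c \<cdot>\<^sub>v v) = c \<cdot>\<^sub>v (\<rho> a *\<^sub>v v)"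
    if "a \<in> carrier ?A" "v \<in> carrier_vec m" for a v c
    using mult_mat_vec[OF rc[OF that(1)]] that by simp
  have rv: "\<rho> a *\<^sub>v v \<in> carrier_vec m" if "a \<in> carrier ?A" for a v
    using rc[OF that] by (metis carrier_matD(1) carrier_vecI dim_mult_mat_vec)
  have rv0: "dim_row (\<rho> a) = m" if "a \<in> carrier ?A" for a using rc[OF that] by simp
  define f where "f = (\<lambda>(v :: 'k vec) l. if l \<in> carrier ?A then (\<rho> l *\<^sub>v v) $ 0 else 0)"
  define W where "W = {v \<in> carrier_vec m. f v = (\<lambda>_. 0)}"
  have fadd: "f (v + w) = (\<lambda>l. f v l + f w l)" if "v \<in> carrier_vec m" "w \<in> carrier_vec m" for v w
    using that m by (auto simp: f_def fun_eq_iff radd rv0)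
  have fsm: "f (c \<cdot>\<^sub>v v) = (\<lambda>l. c * f v l)" if "v \<in> carrier_vec m" for c v
    using that m by (auto simp: f_def fun_eq_iff rsm rv0)
  have fact: "f (\<rho> a *\<^sub>v v) = (\<lambda>l. if l \<in> carrier ?A then f v (compose U l a) else 0)"
    if "a \<in> carrier ?A" "v \<in> carrier_vec m" for a v
    using that A.m_closed by (auto simp: f_def fun_eq_iff AutG_mult[symmetric] rm)
  have "invariant_subspace ?A m \<rho> W"
    unfolding invariant_subspace_def
  proof (intro conjI ballI allI)
    have "f (0 \<cdot>\<^sub>v 0\<^sub>v m) = (\<lambda>_. 0)" by (subst fsm) auto
    moreover have "0 \<cdot>\<^sub>v 0\<^sub>v m = (0\<^sub>v m :: 'k vec)" by (rule eq_vecI) auto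
    ultimately show "0\<^sub>v m \<in> W" by (simp add: W_def)
  qed (auto simp: W_def fadd fsm fact rv)
  then consider "W = {0\<^sub>v m}" | "W = carrier_vec m" using s by (auto simp: simple_rep_def)
  then have W0: "W = {0\<^sub>v m}"
  proof cases
    case 2
    have "\<rho> \<one>\<^bsub>?A\<^esub> = 1\<^sub>m m" using r by (simp add: is_rep_def)
    then have "f (unit_vec m 0) \<one>\<^bsub>?A\<^esub> = 1" using m by (simp add: f_def)
    moreover have "unit_vec m 0 \<in> W" using 2 by simp
    ultimately show ?thesis by (simp add: W_def)
  qed
  have "inj_on f (carrier_vec m)"
  proof (rule inj_onI)
    fix v w assume vw: "v \<in> carrier_vec m" "w \<in> carrier_vec m" "f v = f w"
    have "f (v + (-1) \<cdot>\<^sub>v w) = (\<lambda>_. 0)" using vw by (simp add: fadd fsm)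
    then have "v + (-1) \<cdot>\<^sub>v w \<in> W" using vw by (simp add: W_def)
    then have d: "v + (-1) \<cdot>\<^sub>v w = 0\<^sub>v m" using W0 by simp
    show "v = w"
    proof (rule eq_vecI)
      fix i assume "i < dim_vec w"
      then have "(v + (-1) \<cdot>\<^sub>v w) $ i = 0\<^sub>v m $ i" "i < m" using d vw by auto
      then show "v $ i = w $ i" using vw by simp
    qed (use vw in simp)
  qed
  moreover have "\<forall>v\<in>carrier_vec m. \<forall>l. l \<notin> carrier ?A \<longrightarrow> f v l = 0" by (simp add: f_def)
  ultimately show ?thesis unfolding constituent_Inj_def Inj_eq[OF U]
    using s ch fadd fsm fact by (intro exI[of _ m] exI[of _ \<rho>] exI[of _ f]) auto
qed

end

subsection \<open>Products of transitive bisets\<close>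

lemma (in group) lcos_eq_iff:
  assumes L: "subgroup L G" and p: "p \<in> carrier G" and q: "q \<in> carrier G"
  shows "p <# L = q <# L \<longleftrightarrow> inv q \<otimes> p \<in> L"
proof
  assume "p <# L = q <# L"
  moreover have "p \<in> p <# L" using subgroup.one_closed[OF L] p by (force simp: l_coset_def)
  ultimately obtain l where "l \<in> L" "p = q \<otimes> l" by (auto simp: l_coset_def)
  then show "inv q \<otimes> p \<in> L" using q subgroup.mem_carrier[OF L] by (simp add: m_assoc[symmetric])
next
  assume l: "inv q \<otimes> p \<in> L"
  have "q \<otimes> (inv q \<otimes> p) = p" using p q by (simp add: m_assoc[symmetric])
  then have "p \<in> q <# L" using l by (force simp: l_coset_def)
  then show "p <# L = q <# L" using l_repr_independence[OF _ q L] by simp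
qed

text \<open>The fibres of \<open>f\<close> are the cosets of \<open>D\<close>.\<close>
lemma (in group) card_image_fibres:
  assumes fin: "finite (carrier G)" and D: "subgroup D G"
    and f: "\<And>h h'. h \<in> carrier G \<Longrightarrow> h' \<in> carrier G \<Longrightarrow> f h = f h' \<longleftrightarrow> h \<otimes> inv h' \<in> D"
  shows "card (f ` carrier G) * card D = card (carrier G)"
proof -
  have fibre: "card {h \<in> carrier G. f h = y} = card D" if y: "y \<in> f ` carrier G" for y
  proof -
    obtain k where k: "k \<in> carrier G" "y = f k" using y by blast
    have "{h \<in> carrier G. f h = y} = (\<lambda>d. d \<otimes> k) ` D"
    proof (intro subset_antisym subsetI)
      fix h assume "h \<in> {h \<in> carrier G. f h = y}"
      then have h: "h \<in> carrier G" "h \<otimes> inv k \<in> D" using f k by auto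
      have "h = (h \<otimes> inv k) \<otimes> k" using h k by (simp add: m_assoc)
      then show "h \<in> (\<lambda>d. d \<otimes> k) ` D" using h by blast
    next
      fix h assume "h \<in> (\<lambda>d. d \<otimes> k) ` D"
      then obtain d where d: "d \<in> D" "h = d \<otimes> k" by blast
      then have dc: "d \<in> carrier G" using subgroup.mem_carrier[OF D] by blast
      have "h \<otimes> inv k = d" using d dc k by (simp add: m_assoc)
      then show "h \<in> {h \<in> carrier G. f h = y}" using f[of h k] d dc k by simp
    qed
    moreover have "inj_on (\<lambda>d. d \<otimes> k) D"
      using subgroup.mem_carrier[OF D] k by (auto simp: inj_on_def)
    ultimately show ?thesis by (simp add: card_image)
  qed
  have "card (carrier G) = (\<Sum>y\<in>f ` carrier G. card {h \<in> carrier G. f h = y})"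
    using sum.image_gen[OF fin, of "\<lambda>_. 1::nat" f] by simp
  also have "\<dots> = card (f ` carrier G) * card D" using fibre by simp
  finally show ?thesis by simp
qed

lemma snd_subgroup:
  assumes "group G" "subgroup L (GG G)"
  shows "subgroup (snd ` L) G"
proof -
  interpret G: group G by (rule assms(1))
  interpret P: group "GG G" using DirProd_group[OF assms(1) assms(1)] .
  have LP: "l \<in> carrier G \<times> carrier G" if "l \<in> L" for l
    using subgroup.mem_carrier[OF assms(2) that] by simp
  show ?thesis
  proof (rule G.subgroupI)
    show "snd ` L \<noteq> {}" using subgroup.one_closed[OF assms(2)] by auto
    show "snd ` L \<subseteq> carrier G" using LP by force
    fix a assume "a \<in> snd ` L"
    then obtain x where x: "(x, a) \<in> L" by force
    then have xa: "x \<in> carrier G" "a \<in> carrier G" using LP by auto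
    have "inv\<^bsub>GG G\<^esub> (x, a) \<in> L" by (rule subgroup.m_inv_closed[OF assms(2) x])
    then show "inv\<^bsub>G\<^esub> a \<in> snd ` L"
      using inv_DirProd[OF assms(1) assms(1) xa] by (metis snd_conv image_eqI)
    fix b assume "b \<in> snd ` L"
    then obtain y where "(y, b) \<in> L" by force
    then have "(x, a) \<otimes>\<^bsub>GG G\<^esub> (y, b) \<in> L" using x subgroup.m_closed[OF assms(2)] by blast
    then show "a \<otimes>\<^bsub>G\<^esub> b \<in> snd ` L" by force
  qed
qed

lemma fst_subgroup:
  assumes "group G" "subgroup L (GG G)"
  shows "subgroup (fst ` L) G"
proof -
  interpret G: group G by (rule assms(1))
  interpret P: group "GG G" using DirProd_group[OF assms(1) assms(1)] .
  have LP: "l \<in> carrier G \<times> carrier G" if "l \<in> L" for l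
    using subgroup.mem_carrier[OF assms(2) that] by simp
  show ?thesis
  proof (rule G.subgroupI)
    show "fst ` L \<noteq> {}" using subgroup.one_closed[OF assms(2)] by auto
    show "fst ` L \<subseteq> carrier G" using LP by force
    fix a assume "a \<in> fst ` L"
    then obtain x where x: "(a, x) \<in> L" by force
    then have xa: "a \<in> carrier G" "x \<in> carrier G" using LP by auto
    have "inv\<^bsub>GG G\<^esub> (a, x) \<in> L" by (rule subgroup.m_inv_closed[OF assms(2) x])
    then show "inv\<^bsub>G\<^esub> a \<in> fst ` L"
      using inv_DirProd[OF assms(1) assms(1) xa] by (metis fst_conv image_eqI)
    fix b assume "b \<in> fst ` L"
    then obtain y where "(b, y) \<in> L" by force
    then have "(a, x) \<otimes>\<^bsub>GG G\<^esub> (b, y) \<in> L" using x subgroup.m_closed[OF assms(2)] by blast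
    then show "a \<otimes>\<^bsub>G\<^esub> b \<in> fst ` L" by force
  qed
qed

context fin_cyclic_group
begin

lemma P_comm_group: "comm_group (GG G)"
proof -
  interpret P: group "GG G" by (rule DirProd_group[OF is_group is_group])
  show ?thesis by (rule P.group_comm_groupI) (auto simp: m_comm)
qed

lemma P_finite: "finite (carrier (GG G))"
  using finG by simp

lemma P_subgroups_finite: "finite {L. subgroup L (GG G)}"
  by (rule finite_subset[of _ "Pow (carrier (GG G))"]) (use P_finite subgroup.subset in blast)+

lemma P_inv: "g \<in> carrier G \<Longrightarrow> h \<in> carrier G \<Longrightarrow> inv\<^bsub>GG G\<^esub> (g, h) = (inv g, inv h)"
  by (rule inv_DirProd[OF is_group is_group])

lemma cosets_card:
  assumes M: "subgroup M (GG G)"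
  shows "card (cosets G M) * card M = order G * order G"
proof -
  interpret P: comm_group "GG G" by (rule P_comm_group)
  have "p <#\<^bsub>GG G\<^esub> M = q <#\<^bsub>GG G\<^esub> M \<longleftrightarrow> p \<otimes>\<^bsub>GG G\<^esub> inv\<^bsub>GG G\<^esub> q \<in> M"
    if "p \<in> carrier (GG G)" "q \<in> carrier (GG G)" for p q
    using P.lcos_eq_iff[OF M that] P.m_comm[OF that(1) P.inv_closed[OF that(2)]] by simp
  from P.card_image_fibres[OF P_finite M this] show ?thesis
    by (simp add: cosets_def order_def card_cartesian_product)
qed

text \<open>The group is abelian, so every coset of \<open>M\<close> has stabilizer
  \<open>M\<close>; a mark is therefore either 0 or the full number of cosets.\<close>

lemma coset_fixed_iff:
  assumes M: "subgroup M (GG G)" and N: "subgroup N (GG G)" and C: "C \<in> cosets G M"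
  shows "(\<forall>p\<in>N. p <#\<^bsub>GG G\<^esub> C = C) \<longleftrightarrow> N \<subseteq> M"
proof -
  interpret P: comm_group "GG G" by (rule P_comm_group)
  obtain q where q: "q \<in> carrier (GG G)" "C = q <#\<^bsub>GG G\<^esub> M" using C by (auto simp: cosets_def)
  have Ms: "M \<subseteq> carrier (GG G)" by (rule subgroup.subset[OF M])
  have "p <#\<^bsub>GG G\<^esub> C = C \<longleftrightarrow> p \<in> M" if p: "p \<in> N" for p
  proof -
    have pc: "p \<in> carrier (GG G)" by (rule subgroup.mem_carrier[OF N p])
    have "p <#\<^bsub>GG G\<^esub> C = (p \<otimes>\<^bsub>GG G\<^esub> q) <#\<^bsub>GG G\<^esub> M" unfolding q(2) by (rule P.lcos_m_assoc[OF Ms pc q(1)])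
    then have "p <#\<^bsub>GG G\<^esub> C = C \<longleftrightarrow> inv\<^bsub>GG G\<^esub> q \<otimes>\<^bsub>GG G\<^esub> (p \<otimes>\<^bsub>GG G\<^esub> q) \<in> M"
      using P.lcos_eq_iff[OF M P.m_closed[OF pc q(1)] q(1)] q(2) by simp
    also have "inv\<^bsub>GG G\<^esub> q \<otimes>\<^bsub>GG G\<^esub> (p \<otimes>\<^bsub>GG G\<^esub> q) = p"
      using P.m_comm[OF pc q(1)] P.m_assoc[symmetric, of "inv\<^bsub>GG G\<^esub> q" q p] P.l_inv[OF q(1)] P.l_one[OF pc]
        P.inv_closed[OF q(1)] pc q(1) by simp
    finally show ?thesis .
  qed
  then show ?thesis by blast
qed

lemma order_nonzero: "(of_nat (order G) :: 'k::field_char_0) \<noteq> 0"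
  using order_pos by simp

lemma P_subgroup_card_nonzero: "subgroup M (GG G) \<Longrightarrow> (of_nat (card M) :: 'k::field_char_0) \<noteq> 0"
  using subgroup.one_closed[of M "GG G"] finite_subset[OF subgroup.subset P_finite, of M]
  by (auto simp: card_eq_0_iff)

text \<open>The number of cosets |G|^2 / |M| is split as |G| times |G| / |M|. The common factor |G|
  will cancel against centralizer orders, and the second factor is the multiplicative
  weight.\<close>

lemma Phi_eq:
  fixes a :: "('g \<times> 'g) set \<Rightarrow> 'k::field_char_0"
  assumes N: "subgroup N (GG G)"
  shows "Phi G N a = of_nat (order G) *
    (\<Sum>M | subgroup M (GG G). if N \<subseteq> M then a M * (of_nat (order G) / of_nat (card M)) else 0)"
  unfolding Phi_def sum_distrib_left
proof (rule sum.cong[OF refl])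
  fix M assume "M \<in> {M. subgroup M (GG G)}"
  then have M: "subgroup M (GG G)" by simp
  have "{C \<in> cosets G M. \<forall>p\<in>N. p <#\<^bsub>GG G\<^esub> C = C} = (if N \<subseteq> M then cosets G M else {})"
  proof -
    have "{C \<in> cosets G M. \<forall>p\<in>N. p <#\<^bsub>GG G\<^esub> C = C} = {C \<in> cosets G M. N \<subseteq> M}"
      using coset_fixed_iff[OF M N] by (intro Collect_cong conj_cong refl)
    then show ?thesis by simp
  qed
  moreover have "of_nat (card (cosets G M)) = (of_nat (order G) * (of_nat (order G) / of_nat (card M)) :: 'k)"
    using arg_cong[OF cosets_card[OF M], of "of_nat :: nat \<Rightarrow> 'k"] P_subgroup_card_nonzero[OF M, where 'k='k]
    by (simp add: field_simps)
  ultimately show "a M * of_nat (card {C \<in> cosets G M. \<forall>p\<in>N. p <#\<^bsub>GG G\<^esub> C = C}) =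
      of_nat (order G) * (if N \<subseteq> M then a M * (of_nat (order G) / of_nat (card M)) else 0)"
    by (simp add: mult.left_commute)
qed

abbreviation tcl where
  "tcl L M p q \<equiv> tens_class G (p <#\<^bsub>GG G\<^esub> L) (q <#\<^bsub>GG G\<^esub> M)"

context
  fixes L M
  assumes L: "subgroup L (GG G)" and M: "subgroup M (GG G)"
begin

interpretation P: comm_group "GG G" by (rule P_comm_group)

lemma lcos_assoc:
  assumes "subgroup S (GG G)" "p \<in> carrier (GG G)" "q \<in> carrier (GG G)"
  shows "p <#\<^bsub>GG G\<^esub> (q <#\<^bsub>GG G\<^esub> S) = (p \<otimes>\<^bsub>GG G\<^esub> q) <#\<^bsub>GG G\<^esub> S"
  by (rule P.lcos_m_assoc[OF subgroup.subset[OF assms(1)] assms(2,3)])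

lemma tcl_set:
  assumes "p1 \<in> carrier G" "p2 \<in> carrier G" "q1 \<in> carrier G" "q2 \<in> carrier G"
  shows "tcl L M (p1, p2) (q1, q2) =
    (\<lambda>g. ((p1, g \<otimes> p2) <#\<^bsub>GG G\<^esub> L, (g \<otimes> q1, q2) <#\<^bsub>GG G\<^esub> M)) ` carrier G"
proof -
  have "(\<one>, g) <#\<^bsub>GG G\<^esub> ((p1, p2) <#\<^bsub>GG G\<^esub> L) = (p1, g \<otimes> p2) <#\<^bsub>GG G\<^esub> L"
    "(g, \<one>) <#\<^bsub>GG G\<^esub> ((q1, q2) <#\<^bsub>GG G\<^esub> M) = (g \<otimes> q1, q2) <#\<^bsub>GG G\<^esub> M" if "g \<in> carrier G" for g
    using lcos_assoc[OF L, of "(\<one>, g)" "(p1, p2)"] lcos_assoc[OF M, of "(g, \<one>)" "(q1, q2)"] assms that by simp_all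
  then show ?thesis unfolding tens_class_def by (auto simp: image_iff) blast+
qed

text \<open>A class is an orbit of the middle action of G, so two classes agree once they share a
  pair; \<open>shift\<close> carries the coincidence along the orbit.\<close>

lemma tcl_eq_iff:
  assumes "p1 \<in> carrier G" "p2 \<in> carrier G" "q1 \<in> carrier G" "q2 \<in> carrier G"
    and "p1' \<in> carrier G" "p2' \<in> carrier G" "q1' \<in> carrier G" "q2' \<in> carrier G"
  shows "tcl L M (p1, p2) (q1, q2) = tcl L M (p1', p2') (q1', q2') \<longleftrightarrow>
    (\<exists>g\<in>carrier G. (p1, p2) <#\<^bsub>GG G\<^esub> L = (p1', g \<otimes> p2') <#\<^bsub>GG G\<^esub> L \<and>
       (q1, q2) <#\<^bsub>GG G\<^esub> M = (g \<otimes> q1', q2') <#\<^bsub>GG G\<^esub> M)" (is "?l = ?r")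
proof
  assume eq: ?l
  have "((p1, \<one> \<otimes> p2) <#\<^bsub>GG G\<^esub> L, (\<one> \<otimes> q1, q2) <#\<^bsub>GG G\<^esub> M) \<in> tcl L M (p1, p2) (q1, q2)"
    unfolding tcl_set[OF assms(1-4)] by (rule image_eqI[OF refl one_closed])
  then show ?r using assms unfolding eq tcl_set[OF assms(5-8)] by auto
next
  assume ?r
  then obtain g where g: "g \<in> carrier G" "(p1, p2) <#\<^bsub>GG G\<^esub> L = (p1', g \<otimes> p2') <#\<^bsub>GG G\<^esub> L"
    "(q1, q2) <#\<^bsub>GG G\<^esub> M = (g \<otimes> q1', q2') <#\<^bsub>GG G\<^esub> M" by blast
  have shift: "(p1, k \<otimes> p2) <#\<^bsub>GG G\<^esub> L = (p1', (k \<otimes> g) \<otimes> p2') <#\<^bsub>GG G\<^esub> L"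
    "(k \<otimes> q1, q2) <#\<^bsub>GG G\<^esub> M = ((k \<otimes> g) \<otimes> q1', q2') <#\<^bsub>GG G\<^esub> M" if k: "k \<in> carrier G" for k
  proof -
    have "(\<one>, k) <#\<^bsub>GG G\<^esub> ((p1, p2) <#\<^bsub>GG G\<^esub> L) = (\<one>, k) <#\<^bsub>GG G\<^esub> ((p1', g \<otimes> p2') <#\<^bsub>GG G\<^esub> L)"
      using g(2) by simp
    then show "(p1, k \<otimes> p2) <#\<^bsub>GG G\<^esub> L = (p1', (k \<otimes> g) \<otimes> p2') <#\<^bsub>GG G\<^esub> L"
      using assms g(1) k by (simp add: lcos_assoc[OF L] m_assoc)
    have "(k, \<one>) <#\<^bsub>GG G\<^esub> ((q1, q2) <#\<^bsub>GG G\<^esub> M) = (k, \<one>) <#\<^bsub>GG G\<^esub> ((g \<otimes> q1', q2') <#\<^bsub>GG G\<^esub> M)"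
      using g(3) by simp
    then show "(k \<otimes> q1, q2) <#\<^bsub>GG G\<^esub> M = ((k \<otimes> g) \<otimes> q1', q2') <#\<^bsub>GG G\<^esub> M"
      using assms g(1) k by (simp add: lcos_assoc[OF M] m_assoc)
  qed
  show ?l unfolding tcl_set[OF assms(1-4)] tcl_set[OF assms(5-8)]
  proof (intro subset_antisym subsetI)
    fix z assume "z \<in> (\<lambda>g. ((p1, g \<otimes> p2) <#\<^bsub>GG G\<^esub> L, (g \<otimes> q1, q2) <#\<^bsub>GG G\<^esub> M)) ` carrier G"
    then obtain k where k: "k \<in> carrier G" "z = ((p1, k \<otimes> p2) <#\<^bsub>GG G\<^esub> L, (k \<otimes> q1, q2) <#\<^bsub>GG G\<^esub> M)" by blast
    show "z \<in> (\<lambda>g. ((p1', g \<otimes> p2') <#\<^bsub>GG G\<^esub> L, (g \<otimes> q1', q2') <#\<^bsub>GG G\<^esub> M)) ` carrier G"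
      by (rule image_eqI[of _ _ "k \<otimes> g"]) (use k g(1) shift in simp_all)
  next
    fix z assume "z \<in> (\<lambda>g. ((p1', g \<otimes> p2') <#\<^bsub>GG G\<^esub> L, (g \<otimes> q1', q2') <#\<^bsub>GG G\<^esub> M)) ` carrier G"
    then obtain k where k: "k \<in> carrier G" "z = ((p1', k \<otimes> p2') <#\<^bsub>GG G\<^esub> L, (k \<otimes> q1', q2') <#\<^bsub>GG G\<^esub> M)" by blast
    have "k \<otimes> inv g \<otimes> g = k" using k(1) g(1) by (simp add: m_assoc)
    then show "z \<in> (\<lambda>g. ((p1, g \<otimes> p2) <#\<^bsub>GG G\<^esub> L, (g \<otimes> q1, q2) <#\<^bsub>GG G\<^esub> M)) ` carrier G"
      by (intro image_eqI[of _ _ "k \<otimes> inv g"]) (use k g(1) shift[of "k \<otimes> inv g"] in simp_all)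
  qed
qed

lemma tens_act_tcl:
  assumes "p1 \<in> carrier G" "p2 \<in> carrier G" "q1 \<in> carrier G" "q2 \<in> carrier G" "a \<in> carrier G" "b \<in> carrier G"
  shows "tens_act G (a, b) (tcl L M (p1, p2) (q1, q2)) = tcl L M (a \<otimes> p1, p2) (q1, b \<otimes> q2)"
proof -
  have "(a, \<one>) <#\<^bsub>GG G\<^esub> ((p1, g \<otimes> p2) <#\<^bsub>GG G\<^esub> L) = (a \<otimes> p1, g \<otimes> p2) <#\<^bsub>GG G\<^esub> L"
    "(\<one>, b) <#\<^bsub>GG G\<^esub> ((g \<otimes> q1, q2) <#\<^bsub>GG G\<^esub> M) = (g \<otimes> q1, b \<otimes> q2) <#\<^bsub>GG G\<^esub> M" if "g \<in> carrier G" for g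
    using assms that by (simp_all add: lcos_assoc[OF L] lcos_assoc[OF M])
  then show ?thesis using assms
    by (simp add: tens_act_def tcl_set image_image cong: image_cong)
qed

text \<open>A pair (a, b) fixes the class iff its effect can be undone by some middle element g. In
  an abelian group the base points cancel, leaving (a, g^-1) in \<open>L\<close> and (g^-1, b) in
  \<open>M\<close>.\<close>

lemma tens_stab_tcl:
  assumes "p1 \<in> carrier G" "p2 \<in> carrier G" "q1 \<in> carrier G" "q2 \<in> carrier G"
  shows "tens_stab G (tcl L M (p1, p2) (q1, q2)) = L O M"
proof (rule Set.set_eqI)
  fix ab :: "'g \<times> 'g"
  obtain a b where pair: "ab = (a, b)" by (cases ab)
  have LM: "x \<in> carrier G \<and> y \<in> carrier G" if "(x, y) \<in> L \<or> (x, y) \<in> M" for x y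
    using that subgroup.subset[OF L] subgroup.subset[OF M] by auto
  have "(a, b) \<in> tens_stab G (tcl L M (p1, p2) (q1, q2)) \<longleftrightarrow>
    (\<exists>g\<in>carrier G. (a, inv g) \<in> L \<and> (inv g, b) \<in> M)" if ab: "a \<in> carrier G" "b \<in> carrier G"
  proof -
    have "(a \<otimes> p1, p2) <#\<^bsub>GG G\<^esub> L = (p1, g \<otimes> p2) <#\<^bsub>GG G\<^esub> L \<longleftrightarrow> (a, inv g) \<in> L"
      "(q1, b \<otimes> q2) <#\<^bsub>GG G\<^esub> M = (g \<otimes> q1, q2) <#\<^bsub>GG G\<^esub> M \<longleftrightarrow> (inv g, b) \<in> M" if g: "g \<in> carrier G" for g
    proof -
      have "inv p1 \<otimes> (a \<otimes> p1) = a" "inv q2 \<otimes> (b \<otimes> q2) = b"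
        using ab assms by (simp_all add: m_lcomm)
      moreover have "inv (g \<otimes> p2) \<otimes> p2 = inv g" "inv (g \<otimes> q1) \<otimes> q1 = inv g"
        using assms g by (simp_all add: inv_mult m_assoc)
      ultimately show "(a \<otimes> p1, p2) <#\<^bsub>GG G\<^esub> L = (p1, g \<otimes> p2) <#\<^bsub>GG G\<^esub> L \<longleftrightarrow> (a, inv g) \<in> L"
        "(q1, b \<otimes> q2) <#\<^bsub>GG G\<^esub> M = (g \<otimes> q1, q2) <#\<^bsub>GG G\<^esub> M \<longleftrightarrow> (inv g, b) \<in> M"
        using P.lcos_eq_iff[OF L, of "(a \<otimes> p1, p2)" "(p1, g \<otimes> p2)"]
          P.lcos_eq_iff[OF M, of "(q1, b \<otimes> q2)" "(g \<otimes> q1, q2)"] assms ab g by (simp_all add: P_inv)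
    qed
    then show ?thesis using ab assms unfolding tens_stab_def
      by (simp add: tens_act_tcl tcl_eq_iff)
  qed
  moreover have "(\<exists>g\<in>carrier G. (a, inv g) \<in> L \<and> (inv g, b) \<in> M) \<longleftrightarrow> (\<exists>h. (a, h) \<in> L \<and> (h, b) \<in> M)"
    using LM by (metis inv_closed inv_inv)
  moreover have "(a, b) \<in> tens_stab G (tcl L M (p1, p2) (q1, q2)) \<Longrightarrow> a \<in> carrier G \<and> b \<in> carrier G"
    by (simp add: tens_stab_def)
  moreover have "(\<exists>h. (a, h) \<in> L \<and> (h, b) \<in> M) \<Longrightarrow> a \<in> carrier G \<and> b \<in> carrier G" using LM by blast
  ultimately have "(a, b) \<in> tens_stab G (tcl L M (p1, p2) (q1, q2)) \<longleftrightarrow> (\<exists>h. (a, h) \<in> L \<and> (h, b) \<in> M)"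
    by blast
  then show "(ab \<in> tens_stab G (tcl L M (p1, p2) (q1, q2))) = (ab \<in> L O M)"
    unfolding pair relcomp_unfold by simp
qed

text \<open>The outer coordinates are absorbed by the left and right action and the middle action
  normalizes one inner coordinate to \<one>, so \<open>h\<close>, the quotient of the inner
  coordinates, is the only label left.\<close>

definition tens_orb :: "'g \<Rightarrow> (('g \<times> 'g) set \<times> ('g \<times> 'g) set) set set" where
  "tens_orb h = {tcl L M (a, \<one>) (h, b) | a b. a \<in> carrier G \<and> b \<in> carrier G}"

lemma orbit_eq:
  assumes p: "p1 \<in> carrier G" "p2 \<in> carrier G" "q1 \<in> carrier G" "q2 \<in> carrier G"
  shows "(\<lambda>x. tens_act G x (tcl L M (p1, p2) (q1, q2))) ` carrier (GG G) = tens_orb (inv p2 \<otimes> q1)"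
proof -
  have eq: "tcl L M (a, p2) (q1, b) = tcl L M (a, \<one>) (inv p2 \<otimes> q1, b)" if "a \<in> carrier G" "b \<in> carrier G" for a b
  proof (subst tcl_eq_iff)
    have "p2 \<otimes> (inv p2 \<otimes> q1) = q1" using p by (simp add: m_assoc[symmetric])
    then show "\<exists>g\<in>carrier G. (a, p2) <#\<^bsub>GG G\<^esub> L = (a, g \<otimes> \<one>) <#\<^bsub>GG G\<^esub> L \<and>
       (q1, b) <#\<^bsub>GG G\<^esub> M = (g \<otimes> (inv p2 \<otimes> q1), b) <#\<^bsub>GG G\<^esub> M"
      using p by (intro bexI[of _ p2]) auto
  qed (use that p in auto)
  show ?thesis unfolding tens_orb_def
  proof (intro subset_antisym subsetI)
    fix z assume "z \<in> (\<lambda>x. tens_act G x (tcl L M (p1, p2) (q1, q2))) ` carrier (GG G)"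
    then obtain a b where ab: "a \<in> carrier G" "b \<in> carrier G" "z = tens_act G (a, b) (tcl L M (p1, p2) (q1, q2))"
      by auto
    then have "z = tcl L M (a \<otimes> p1, \<one>) (inv p2 \<otimes> q1, b \<otimes> q2)" using p by (simp add: tens_act_tcl eq)
    then show "z \<in> {tcl L M (a, \<one>) (inv p2 \<otimes> q1, b) | a b. a \<in> carrier G \<and> b \<in> carrier G}"
      using ab p by blast
  next
    fix z assume "z \<in> {tcl L M (a, \<one>) (inv p2 \<otimes> q1, b) | a b. a \<in> carrier G \<and> b \<in> carrier G}"
    then obtain a b where ab: "a \<in> carrier G" "b \<in> carrier G" "z = tcl L M (a, \<one>) (inv p2 \<otimes> q1, b)" by blast
    have "a \<otimes> inv p1 \<otimes> p1 = a" "b \<otimes> inv q2 \<otimes> q2 = b" using ab p by (simp_all add: m_assoc)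
    then have "z = tens_act G (a \<otimes> inv p1, b \<otimes> inv q2) (tcl L M (p1, p2) (q1, q2))"
      using ab p by (simp add: tens_act_tcl eq)
    then show "z \<in> (\<lambda>x. tens_act G x (tcl L M (p1, p2) (q1, q2))) ` carrier (GG G)" using ab p by force
  qed
qed

lemma tens_orbits_eq: "tens_orbits G L M = tens_orb ` carrier G"
proof (intro subset_antisym subsetI)
  fix Ob assume "Ob \<in> tens_orbits G L M"
  then obtain p1 p2 q1 q2 where p: "p1 \<in> carrier G" "p2 \<in> carrier G" "q1 \<in> carrier G" "q2 \<in> carrier G"
    and "Ob = (\<lambda>x. tens_act G x (tcl L M (p1, p2) (q1, q2))) ` carrier (GG G)"
    by (auto simp: tens_orbits_def tens_def cosets_def)
  then show "Ob \<in> tens_orb ` carrier G" using orbit_eq[OF p] by auto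
next
  fix Ob assume "Ob \<in> tens_orb ` carrier G"
  then obtain h where h: "h \<in> carrier G" "Ob = tens_orb h" by blast
  then have "Ob = (\<lambda>x. tens_act G x (tcl L M (\<one>, \<one>) (h, \<one>))) ` carrier (GG G)"
    using orbit_eq[of \<one> \<one> h \<one>] by simp
  moreover have "tcl L M (\<one>, \<one>) (h, \<one>) \<in> tens G L M"
    unfolding tens_def cosets_def using h by fastforce
  ultimately show "Ob \<in> tens_orbits G L M" unfolding tens_orbits_def by blast
qed

text \<open>These are the double cosets of the Mackey formula, with respect to the second projection
  of \<open>L\<close> and the first projection of \<open>M\<close>; in an abelian group they are the
  cosets of the product of the two.\<close>

lemma tens_orb_eq_iff:
  assumes h: "h \<in> carrier G" "h' \<in> carrier G"
  shows "tens_orb h = tens_orb h' \<longleftrightarrow> h \<otimes> inv h' \<in> snd ` L <#> fst ` M"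
proof -
  have LM: "x \<in> carrier G \<and> y \<in> carrier G" if "(x, y) \<in> L \<or> (x, y) \<in> M" for x y
    using that subgroup.subset[OF L] subgroup.subset[OF M] by auto
  let ?D = "snd ` L <#> fst ` M"
  have D: "subgroup ?D G"
    by (rule mult_subgroups[OF snd_subgroup[OF is_group L] fst_subgroup[OF is_group M]])
  have sub: "tens_orb h \<subseteq> tens_orb h'" if hD: "h \<otimes> inv h' \<in> ?D" and h: "h \<in> carrier G" "h' \<in> carrier G" for h h'
  proof -
    \<comment> \<open>The factor \<open>g\<close> is absorbed by \<open>L\<close> at the price of
      \<open>x\<close> in the left outer coordinate, the factor \<open>m\<close> by \<open>M\<close>
      at the price of \<open>y\<close> in the right one.\<close>
    obtain x g m y where L': "(x, g) \<in> L" and M': "(m, y) \<in> M" and hh: "h \<otimes> inv h' = g \<otimes> m"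
      using hD by (auto simp: set_mult_def)
    have c: "x \<in> carrier G" "g \<in> carrier G" "m \<in> carrier G" "y \<in> carrier G" using L' M' LM by blast+
    have "tcl L M (a, \<one>) (h, b) = tcl L M (a \<otimes> x, \<one>) (h', b \<otimes> inv y)" if ab: "a \<in> carrier G" "b \<in> carrier G" for a b
    proof (subst tcl_eq_iff)
      have "(a, \<one>) <#\<^bsub>GG G\<^esub> L = (a \<otimes> x, g \<otimes> \<one>) <#\<^bsub>GG G\<^esub> L"
      proof (subst eq_commute, subst P.lcos_eq_iff[OF L])
        have "inv a \<otimes> (a \<otimes> x) = x" using ab c by (simp add: m_assoc[symmetric])
        then show "inv\<^bsub>GG G\<^esub> (a, \<one>) \<otimes>\<^bsub>GG G\<^esub> (a \<otimes> x, g \<otimes> \<one>) \<in> L"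
          using ab c L' by (simp add: P_inv)
      qed (use ab c in auto)
      moreover have "(h, b) <#\<^bsub>GG G\<^esub> M = (g \<otimes> h', b \<otimes> inv y) <#\<^bsub>GG G\<^esub> M"
      proof (subst P.lcos_eq_iff[OF M])
        have "h = g \<otimes> m \<otimes> h'" using hh h c by (metis inv_solve_right m_closed)
        then have "h = (g \<otimes> h') \<otimes> m" using h c by (simp add: m_ac)
        then have "inv (g \<otimes> h') \<otimes> h = m" using inv_solve_left[of m "g \<otimes> h'" h] h c by simp
        moreover have "inv (b \<otimes> inv y) \<otimes> b = y"
          using inv_solve_left[of y "b \<otimes> inv y" b] ab c by (simp add: m_assoc)
        ultimately show "inv\<^bsub>GG G\<^esub> (g \<otimes> h', b \<otimes> inv y) \<otimes>\<^bsub>GG G\<^esub> (h, b) \<in> M"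
          using ab c h M' by (simp add: P_inv)
      qed (use ab c h in auto)
      ultimately show "\<exists>g\<in>carrier G. (a, \<one>) <#\<^bsub>GG G\<^esub> L = (a \<otimes> x, g \<otimes> \<one>) <#\<^bsub>GG G\<^esub> L \<and>
          (h, b) <#\<^bsub>GG G\<^esub> M = (g \<otimes> h', b \<otimes> inv y) <#\<^bsub>GG G\<^esub> M" using c by blast
    qed (use ab c h in auto)
    then show ?thesis unfolding tens_orb_def using c by blast
  qed
  show ?thesis
  proof
    assume hD: "h \<otimes> inv h' \<in> ?D"
    have "inv (h \<otimes> inv h') \<in> ?D" by (rule subgroup.m_inv_closed[OF D hD])
    then have "h' \<otimes> inv h \<in> ?D" using h by (simp add: inv_mult m_comm)
    then show "tens_orb h = tens_orb h'" using sub[OF hD h] sub[OF _ h(2,1)] by blast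
  next
    assume "tens_orb h = tens_orb h'"
    moreover have "tcl L M (\<one>, \<one>) (h, \<one>) \<in> tens_orb h" unfolding tens_orb_def by blast
    ultimately obtain a b where ab: "a \<in> carrier G" "b \<in> carrier G"
      and "tcl L M (\<one>, \<one>) (h, \<one>) = tcl L M (a, \<one>) (h', b)" by (auto simp: tens_orb_def)
    then obtain g where g: "g \<in> carrier G" "(\<one>, \<one>) <#\<^bsub>GG G\<^esub> L = (a, g \<otimes> \<one>) <#\<^bsub>GG G\<^esub> L"
      "(h, \<one>) <#\<^bsub>GG G\<^esub> M = (g \<otimes> h', b) <#\<^bsub>GG G\<^esub> M"
      using tcl_eq_iff[of \<one> \<one> h \<one> a \<one> h' b] h ab by auto
    have "inv\<^bsub>GG G\<^esub> (\<one>, \<one>) \<otimes>\<^bsub>GG G\<^esub> (a, g \<otimes> \<one>) \<in> L"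
      using P.lcos_eq_iff[OF L, of "(a, g \<otimes> \<one>)" "(\<one>, \<one>)"] g ab by simp
    then have gL: "g \<in> snd ` L" using g(1) ab by (force simp: P_inv)
    have "inv\<^bsub>GG G\<^esub> (g \<otimes> h', b) \<otimes>\<^bsub>GG G\<^esub> (h, \<one>) \<in> M"
      using P.lcos_eq_iff[OF M, of "(h, \<one>)" "(g \<otimes> h', b)"] g ab h by simp
    then have "inv (g \<otimes> h') \<otimes> h \<in> fst ` M" using g(1) ab h by (force simp: P_inv)
    moreover have "h \<otimes> inv h' = g \<otimes> (inv (g \<otimes> h') \<otimes> h)"
    proof -
      have "g \<otimes> (inv (g \<otimes> h') \<otimes> h) = (g \<otimes> inv g) \<otimes> (inv h' \<otimes> h)"
        using g(1) h by (simp only: inv_mult m_assoc inv_closed m_closed)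
      then show ?thesis using g(1) h by (simp add: m_comm)
    qed
    ultimately show "h \<otimes> inv h' \<in> ?D" using gL unfolding set_mult_def by blast
  qed
qed

text \<open>All points of the tensor product have the same stabilizer, so the product of two
  transitive bisets is a multiple of a single transitive one.\<close>

lemma bmult_coeff_eq:
  "bmult_coeff G L M N = (if N = L O M then card (tens_orbits G L M) else 0)"
proof -
  have "(\<exists>T\<in>Ob. tens_stab G T = N) \<longleftrightarrow> N = L O M" if Ob: "Ob \<in> tens_orbits G L M" for Ob
  proof -
    obtain h where h: "h \<in> carrier G" "Ob = tens_orb h" using Ob tens_orbits_eq by auto
    have "tens_stab G T = L O M" if "T \<in> Ob" for T
      using that h tens_stab_tcl by (auto simp: tens_orb_def)
    moreover have "tcl L M (\<one>, \<one>) (h, \<one>) \<in> Ob" unfolding h tens_orb_def by blast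
    ultimately show ?thesis by blast
  qed
  then have "{Ob \<in> tens_orbits G L M. \<exists>T\<in>Ob. tens_stab G T = N} = (if N = L O M then tens_orbits G L M else {})"
    by auto
  then show ?thesis by (simp add: bmult_coeff_def)
qed

lemma card_tens_orbits: "card (tens_orbits G L M) * card (snd ` L <#> fst ` M) = order G"
  unfolding tens_orbits_eq order_def
  by (rule card_image_fibres[OF finG mult_subgroups[OF snd_subgroup[OF is_group L] fst_subgroup[OF is_group M]]])
    (rule tens_orb_eq_iff)

end

end

subsection \<open>Graphs of homomorphisms\<close>

lemma (in group) mult_inv_eq_one_iff:
  assumes "a \<in> carrier G" "b \<in> carrier G"
  shows "a \<otimes> inv b = \<one> \<longleftrightarrow> a = b"
  using inv_equality[of a "inv b"] assms by auto

context fin_cyclic_group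
begin

text \<open>The argument stands second: k_1 = 1 makes the first coordinate a function of the second.
  Consequently \<open>O\<close> composes with the right factor applied first.\<close>

definition graph :: "'g set \<Rightarrow> nat \<Rightarrow> ('g \<times> 'g) set" where
  "graph V i = (\<lambda>v. (v [^] i, v)) ` V"

lemma graph_iff: "(a, b) \<in> graph V i \<longleftrightarrow> b \<in> V \<and> a = b [^] i"
  by (auto simp: graph_def)

lemma graph_relcomp: "graph V i O graph W j = {(a, w). w \<in> W \<and> w [^] j \<in> V \<and> a = (w [^] j) [^] i}"
  by (auto simp: relcomp_unfold graph_iff)

lemma graph_subgroup:
  assumes V: "subgroup V G"
  shows "subgroup (graph V i) (GG G)" "k1 G (graph V i) = {\<one>}"
proof -
  interpret P: comm_group "GG G" by (rule P_comm_group)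
  show "subgroup (graph V i) (GG G)"
  proof (rule P.subgroupI)
    show "graph V i \<noteq> {}" using subgroup.one_closed[OF V] by (auto simp: graph_def)
    show "graph V i \<subseteq> carrier (GG G)" using subgroup_in[OF V] by (auto simp: graph_def)
    fix p assume "p \<in> graph V i"
    then obtain v where v: "v \<in> V" "p = (v [^] i, v)" by (auto simp: graph_def)
    have vc: "v \<in> carrier G" using subgroup_in[OF V v(1)] .
    show "inv\<^bsub>GG G\<^esub> p \<in> graph V i"
      using v vc subgroup.m_inv_closed[OF V v(1)] by (simp add: P_inv graph_iff nat_pow_inv)
    fix q assume "q \<in> graph V i"
    then obtain w where w: "w \<in> V" "q = (w [^] i, w)" by (auto simp: graph_def)
    show "p \<otimes>\<^bsub>GG G\<^esub> q \<in> graph V i"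
      using v w vc subgroup_in[OF V w(1)] subgroup.m_closed[OF V v(1) w(1)]
      by (simp add: graph_iff nat_pow_distrib)
  qed
  show "k1 G (graph V i) = {\<one>}"
    using subgroup.one_closed[OF V] by (auto simp: k1_def graph_iff)
qed

text \<open>The basis of \<open>KB_lhd G\<close>; under \<open>O\<close> it is the monoid of power
  maps defined on subgroups.\<close>

definition Lam :: "('g \<times> 'g) set set" where
  "Lam = {L. subgroup L (GG G) \<and> k1 G L = {\<one>}}"

lemma graph_in_Lam: "subgroup V G \<Longrightarrow> graph V i \<in> Lam"
  using graph_subgroup by (simp add: Lam_def)

lemma Lam_subgroup: "L \<in> Lam \<Longrightarrow> subgroup L (GG G)"
  by (simp add: Lam_def)

text \<open>Two elements of \<open>L\<close> with the same second coordinate differ by an element of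
  k_1, so \<open>L\<close> is the graph of a homomorphism on its second projection, and
  homomorphisms are power maps.\<close>

lemma Lam_graph:
  assumes "L \<in> Lam"
  shows "\<exists>V i. subgroup V G \<and> L = graph V i"
proof -
  have L: "subgroup L (GG G)" and k: "k1 G L = {\<one>}" using assms by (auto simp: Lam_def)
  interpret P: comm_group "GG G" by (rule P_comm_group)
  have Lc: "a \<in> carrier G \<and> b \<in> carrier G" if "(a, b) \<in> L" for a b
    using that subgroup.subset[OF L] by auto
  have Lm: "(a \<otimes> c, b \<otimes> d) \<in> L" if "(a, b) \<in> L" "(c, d) \<in> L" for a b c d
    using subgroup.m_closed[OF L that] by simp
  have unique: "a = c" if ab: "(a, b) \<in> L" "(c, b) \<in> L" for a b c
  proof -
    have cc: "a \<in> carrier G" "b \<in> carrier G" "c \<in> carrier G" using ab Lc by blast+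
    have "inv\<^bsub>GG G\<^esub> (c, b) \<in> L" by (rule subgroup.m_inv_closed[OF L ab(2)])
    then have "(inv c, inv b) \<in> L" using cc by (simp add: P_inv)
    from Lm[OF ab(1) this] have "(a \<otimes> inv c, \<one>) \<in> L" using cc by simp
    then have "a \<otimes> inv c \<in> k1 G L" using cc by (simp add: k1_def)
    then have "a \<otimes> inv c = \<one>" using k by simp
    then show "a = c" using cc by (simp add: mult_inv_eq_one_iff)
  qed
  let ?V = "snd ` L"
  have V: "subgroup ?V G" by (rule snd_subgroup[OF is_group L])
  define f where "f = (\<lambda>b. THE a. (a, b) \<in> L)"
  have f: "f b = a" if "(a, b) \<in> L" for a b
    unfolding f_def using that unique by (intro the_equality) blast+
  have fL: "(f b, b) \<in> L" if b: "b \<in> ?V" for b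
  proof -
    obtain a where "(a, b) \<in> L" using b by force
    then show ?thesis using f by simp
  qed
  have "f \<in> hom (G\<lparr>carrier := ?V\<rparr>) G"
  proof (rule homI)
    fix b d assume "b \<in> carrier (G\<lparr>carrier := ?V\<rparr>)" "d \<in> carrier (G\<lparr>carrier := ?V\<rparr>)"
    then have "(f b \<otimes> f d, b \<otimes> d) \<in> L" using Lm fL by simp
    then show "f (b \<otimes>\<^bsub>G\<lparr>carrier := ?V\<rparr>\<^esub> d) = f b \<otimes> f d" using f by simp
  qed (use fL Lc in \<open>simp, blast\<close>)
  then obtain i :: nat where i: "\<forall>b\<in>?V. f b = b [^] i" using hom_is_power[OF V] by blast
  have "L = graph ?V i"
  proof (intro subset_antisym subsetI)
    fix p assume "p \<in> L"
    then obtain a b where "p = (a, b)" "(a, b) \<in> L" by (cases p) auto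
    then show "p \<in> graph ?V i" using f[of a b] i by (force simp: graph_def)
  next
    fix p assume "p \<in> graph ?V i"
    then obtain b where b: "b \<in> ?V" "p = (b [^] i, b)" unfolding graph_def by blast
    then show "p \<in> L" using fL[OF b(1)] i by auto
  qed
  then show ?thesis using V by blast
qed

lemma graph_snd: "snd ` graph V i = V"
  by (auto simp: graph_def image_image)

lemma graph_fst: "fst ` graph V i = (\<lambda>v. v [^] i) ` V"
  by (auto simp: graph_def image_image)

lemma graph_card: "card (graph V i) = card V"
  unfolding graph_def by (rule card_image) (auto simp: inj_on_def)

lemma preimage_subgroup:
  assumes V: "subgroup V G" and W: "subgroup W G"
  shows "subgroup {w \<in> W. w [^] (j::nat) \<in> V} G"
proof (rule subgroupI)
  show "{w \<in> W. w [^] j \<in> V} \<subseteq> carrier G" using subgroup_in[OF W] by blast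
  show "{w \<in> W. w [^] j \<in> V} \<noteq> {}" using subgroup.one_closed[OF V] subgroup.one_closed[OF W] by force
qed (auto simp: nat_pow_inv nat_pow_distrib subgroup_in[OF W] subgroup.m_inv_closed[OF W] subgroup.m_inv_closed[OF V]
    subgroup.m_closed[OF W] subgroup.m_closed[OF V])

lemma graph_relcomp_graph:
  assumes W: "subgroup W G"
  shows "graph V i O graph W j = graph {w \<in> W. w [^] j \<in> V} (j * i)"
  using subgroup_in[OF W] by (auto simp: graph_relcomp graph_iff nat_pow_pow)

text \<open>Both sides count \<open>V \<times> W\<close>: the left one along the homomorphism \<open>(v, w) \<mapsto> v w\<^sup>j\<close>.\<close>
lemma card_set_mult_preimage:
  assumes V: "subgroup V G" and W: "subgroup W G"
  shows "card (V <#> (\<lambda>w. w [^] (j::nat)) ` W) * card {w \<in> W. w [^] j \<in> V} = card V * card W"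
proof -
  let ?K = "G\<lparr>carrier := V\<rparr> \<times>\<times> G\<lparr>carrier := W\<rparr>"
  let ?f = "\<lambda>(v, w). v \<otimes> w [^] j"
  interpret K: group ?K by (rule DirProd_group[OF subgroup_imp_group[OF V] subgroup_imp_group[OF W]])
  note Vc = subgroup_in[OF V] and Wc = subgroup_in[OF W]
  have hom: "?f \<in> hom ?K G"
  proof (rule homI)
    fix x y assume "x \<in> carrier ?K" "y \<in> carrier ?K"
    then obtain v w v' w' where "x = (v, w)" "y = (v', w')" "v \<in> V" "w \<in> W" "v' \<in> V" "w' \<in> W" by auto
    then show "?f (x \<otimes>\<^bsub>?K\<^esub> y) = ?f x \<otimes> ?f y"
      using Vc Wc by (simp add: nat_pow_distrib m_ac)
  qed (use Vc Wc in auto)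
  interpret h: group_hom ?K G ?f by (rule group_hom.intro[OF K.is_group is_group]) (simp add: group_hom_axioms_def hom)
  let ?D = "kernel ?K G ?f"
  have "card (?f ` carrier ?K) * card ?D = card (carrier ?K)"
  proof (rule K.card_image_fibres)
    show "finite (carrier ?K)" using subgroup_fin V W by simp
    show "subgroup ?D ?K" by (rule h.subgroup_kernel)
    fix x y assume xy: "x \<in> carrier ?K" "y \<in> carrier ?K"
    have "?f (x \<otimes>\<^bsub>?K\<^esub> inv\<^bsub>?K\<^esub> y) = ?f x \<otimes> inv (?f y)" using xy h.hom_mult h.hom_inv K.inv_closed by metis
    moreover have "?f x \<in> carrier G" "?f y \<in> carrier G" using xy h.hom_closed by blast+
    ultimately have "?f (x \<otimes>\<^bsub>?K\<^esub> inv\<^bsub>?K\<^esub> y) = \<one> \<longleftrightarrow> ?f x = ?f y"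
      using mult_inv_eq_one_iff[of "?f x" "?f y"] by simp
    then show "?f x = ?f y \<longleftrightarrow> x \<otimes>\<^bsub>?K\<^esub> inv\<^bsub>?K\<^esub> y \<in> ?D"
      using xy by (simp only: kernel_def mem_Collect_eq K.m_closed K.inv_closed simp_thms)
  qed
  moreover have "?f ` carrier ?K = V <#> (\<lambda>w. w [^] j) ` W"
    by (force simp: set_mult_def image_iff)
  moreover have "card ?D = card {w \<in> W. w [^] j \<in> V}"
  proof (rule bij_betw_same_card[symmetric], rule bij_betwI[of "\<lambda>w. (inv (w [^] j), w)" _ _ snd])
    show "(\<lambda>w. (inv (w [^] j), w)) \<in> {w \<in> W. w [^] j \<in> V} \<rightarrow> ?D"
      using Wc subgroup.m_inv_closed[OF V] by (auto simp: kernel_def)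
    have D: "w [^] j \<in> V" "v = inv (w [^] j)" if "v \<in> V" "w \<in> W" "v \<otimes> w [^] j = \<one>" for v w
    proof -
      show v: "v = inv (w [^] j)" using that Vc Wc inv_equality by (metis nat_pow_closed)
      have "w [^] j = inv v" using v Wc that by simp
      then show "w [^] j \<in> V" using subgroup.m_inv_closed[OF V that(1)] by simp
    qed
    then show "snd \<in> ?D \<rightarrow> {w \<in> W. w [^] j \<in> V}" by (auto simp: kernel_def)
    show "(inv (snd y [^] j), snd y) = y" if "y \<in> ?D" for y
      using that D by (auto simp: kernel_def)
  qed simp
  ultimately show ?thesis by (simp add: card_cartesian_product)
qed

subsection \<open>Marks and the product\<close>

text \<open>The weight that makes the basis multiplicative: the basis element of \<open>L\<close>
  divided by \<open>wt L\<close> multiplies as \<open>L\<close> does under \<open>O\<close>.\<close>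

definition wt :: "('g \<times> 'g) set \<Rightarrow> 'k::field_char_0" where
  "wt L = of_nat (order G) / of_nat (card L)"

text \<open>The mark at \<open>N\<close> divided by |G|. In terms of the coordinates
  \<open>a M * wt M\<close> for the rescaled basis it is just the sum over the \<open>M\<close> that
  contain \<open>N\<close>.\<close>

definition mk :: "('g \<times> 'g) set \<Rightarrow> (('g \<times> 'g) set \<Rightarrow> 'k::field_char_0) \<Rightarrow> 'k" where
  "mk N a = (\<Sum>M | subgroup M (GG G). if N \<subseteq> M then a M * wt M else 0)"

lemma wt_nonzero: "subgroup L (GG G) \<Longrightarrow> (wt L :: 'k::field_char_0) \<noteq> 0"
  using order_nonzero[where 'k='k] P_subgroup_card_nonzero[of L, where 'k='k] by (simp add: wt_def)

lemma Phi_mk: "subgroup N (GG G) \<Longrightarrow> Phi G N a = of_nat (order G) * mk N (a :: _ \<Rightarrow> 'k::field_char_0)"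
  by (simp add: Phi_eq mk_def wt_def cong: if_cong)

lemma Lam_relcomp:
  assumes "L \<in> Lam" "M \<in> Lam"
  shows "L O M \<in> Lam"
proof -
  obtain V i W j where "subgroup V G" "L = graph V i" "subgroup W G" "M = graph W j"
    using assms Lam_graph by blast
  then show ?thesis using graph_in_Lam[OF preimage_subgroup] by (simp add: graph_relcomp_graph)
qed

text \<open>With D the product of the projections and Q the domain of the composite, Mackey gives c
  |D| = |G| for the multiplicity c, and |D| |Q| = |V| |W|. Eliminating |D| leaves c / |Q| = |G| /
  (|V| |W|).\<close>

lemma wt_relcomp:
  assumes "L \<in> Lam" "M \<in> Lam"
  shows "of_nat (card (tens_orbits G L M)) * wt (L O M) = (wt L * wt M :: 'k::field_char_0)"
proof -
  obtain V i W j where V: "subgroup V G" "L = graph V i" and W: "subgroup W G" "M = graph W j"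
    using assms Lam_graph by blast
  let ?c = "card (tens_orbits G L M)" and ?D = "V <#> (\<lambda>w. w [^] j) ` W"
  let ?Q = "{w \<in> W. w [^] j \<in> V}"
  have "?c * card ?D = order G"
    using card_tens_orbits[OF Lam_subgroup[OF assms(1)] Lam_subgroup[OF assms(2)]] V(2) W(2)
    by (simp add: graph_snd graph_fst)
  moreover have "card ?D * card ?Q = card V * card W" by (rule card_set_mult_preimage[OF V(1) W(1)])
  ultimately have "?c * (card V * card W) = order G * card ?Q" by (metis mult.assoc)
  then have "of_nat ?c * (of_nat (card V) * of_nat (card W)) = (of_nat (order G) * of_nat (card ?Q) :: 'k)"
    by (metis of_nat_mult)
  moreover have "card ?Q > 0" "card V > 0" "card W > 0"
    using subgroup_card_pos preimage_subgroup V W by blast+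
  moreover have "L O M = graph ?Q (j * i)" using V W by (simp add: graph_relcomp_graph)
  ultimately show ?thesis using V W by (simp add: wt_def graph_card field_simps)
qed

lemma KB_lhd_iff: "a \<in> KB_lhd G \<longleftrightarrow> (\<forall>L. a L \<noteq> 0 \<longrightarrow> L \<in> Lam)"
  by (simp add: KB_lhd_def Lam_def)

lemma bmult_coeff_Lam:
  assumes "L \<in> Lam" "M \<in> Lam"
  shows "bmult_coeff G L M N = (if N = L O M then card (tens_orbits G L M) else 0)"
  by (rule bmult_coeff_eq[OF Lam_subgroup[OF assms(1)] Lam_subgroup[OF assms(2)]])

lemma bmult_in:
  assumes "a \<in> KB_lhd G" "b \<in> KB_lhd G"
  shows "bmult G a b \<in> (KB_lhd G :: (_ \<Rightarrow> 'k::field_char_0) set)"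
  unfolding KB_lhd_iff
proof (intro allI impI)
  fix N assume "bmult G a b N \<noteq> 0"
  then obtain L where "(\<Sum>M\<in>{M. subgroup M (GG G)}. a L * b M * of_nat (bmult_coeff G L M N)) \<noteq> 0"
    unfolding bmult_def by (metis (no_types, lifting) sum.neutral)
  then obtain M where LM: "a L * b M * of_nat (bmult_coeff G L M N) \<noteq> 0"
    by (metis (no_types, lifting) sum.neutral)
  then have "L \<in> Lam" "M \<in> Lam" using assms by (auto simp: KB_lhd_iff)
  moreover from this have "N = L O M" using LM by (auto simp: bmult_coeff_Lam split: if_splits)
  ultimately show "N \<in> Lam" using Lam_relcomp by simp
qed

text \<open>In rescaled coordinates the product is that of the monoid algebra of \<open>Lam\<close>,
  so its mark collects the pairs whose composite contains \<open>N\<close>.\<close>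

lemma mk_bmult:
  assumes a: "a \<in> KB_lhd G" and b: "b \<in> KB_lhd G"
  shows "mk N (bmult G a b) = (\<Sum>L | subgroup L (GG G). \<Sum>M | subgroup M (GG G).
     if N \<subseteq> L O M then (a L * wt L) * (b M * wt M) else (0 :: 'k::field_char_0))"
proof -
  let ?S = "{L. subgroup L (GG G)}"
  note fin = P_subgroups_finite
  have "mk N (bmult G a b) = (\<Sum>N'\<in>?S. \<Sum>L\<in>?S. \<Sum>M\<in>?S.
      if N \<subseteq> N' then a L * b M * of_nat (bmult_coeff G L M N') * wt N' else 0)"
    unfolding mk_def bmult_def by (rule sum.cong) (auto simp: sum_distrib_right)
  also have "\<dots> = (\<Sum>L\<in>?S. \<Sum>M\<in>?S. \<Sum>N'\<in>?S.
      if N \<subseteq> N' then a L * b M * of_nat (bmult_coeff G L M N') * wt N' else 0)"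
    by (subst sum.swap, rule sum.cong[OF refl], rule sum.swap)
  also have "\<dots> = (\<Sum>L\<in>?S. \<Sum>M\<in>?S. if N \<subseteq> L O M then (a L * wt L) * (b M * wt M) else 0)"
  proof (intro sum.cong refl)
    fix L M
    show "(\<Sum>N'\<in>?S. if N \<subseteq> N' then a L * b M * of_nat (bmult_coeff G L M N') * wt N' else 0) =
        (if N \<subseteq> L O M then (a L * wt L) * (b M * wt M) else 0)"
    \<comment> \<open>Outside \<open>Lam\<close> one of the coefficients is 0, so only pairs with
      multiplicative weights remain.\<close>
    proof (cases "L \<in> Lam \<and> M \<in> Lam")
      case False
      then have "a L = 0 \<or> b M = 0" using a b by (auto simp: KB_lhd_iff)
      then show ?thesis by (elim disjE) (simp_all cong: if_cong)
    next
      case True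
      then have LM: "L \<in> Lam" "M \<in> Lam" by auto
      have "(\<Sum>N'\<in>?S. if N \<subseteq> N' then a L * b M * of_nat (bmult_coeff G L M N') * wt N' else 0) =
          (\<Sum>N'\<in>?S. if N' = L O M then
             (if N \<subseteq> L O M then a L * b M * (of_nat (card (tens_orbits G L M)) * wt (L O M)) else 0) else 0)"
        by (rule sum.cong) (auto simp: bmult_coeff_Lam[OF LM])
      also have "\<dots> = (if N \<subseteq> L O M then a L * b M * (of_nat (card (tens_orbits G L M)) * wt (L O M)) else 0)"
        using fin Lam_subgroup[OF Lam_relcomp[OF LM]] by simp
      finally show ?thesis by (simp add: wt_relcomp[OF LM])
    qed
  qed
  finally show ?thesis .
qed

subsection \<open>Triangularity of the table of marks\<close>

lemma mk_diff: "mk N (\<lambda>L. a L - b L) = mk N a - mk N b"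
  unfolding mk_def sum_subtractf[symmetric] by (rule sum.cong) (auto simp: left_diff_distrib)

text \<open>At a maximal \<open>N\<close> in the support of the difference only the term
  \<open>M = N\<close> survives, and its weight is nonzero. The index set \<open>F\<close> is left
  open because the lemma serves both \<open>Lam\<close> and the subgroups with k_1 = k_2 =
  1.\<close>

lemma mk_determines:
  fixes a b :: "('g \<times> 'g) set \<Rightarrow> 'k::field_char_0"
  assumes F: "\<And>L. L \<in> F \<Longrightarrow> subgroup L (GG G)"
    and supp: "\<And>L. L \<notin> F \<Longrightarrow> a L = 0" "\<And>L. L \<notin> F \<Longrightarrow> b L = 0"
    and eq: "\<And>N. N \<in> F \<Longrightarrow> mk N a = mk N b"
  shows "a = b"
proof (rule ccontr)
  assume "a \<noteq> b"
  define d where "d = (\<lambda>L. a L - b L)"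
  let ?D = "{L \<in> F. d L \<noteq> 0}"
  obtain K where "a K \<noteq> b K" using \<open>a \<noteq> b\<close> by blast
  then have "K \<in> ?D" using supp[of K] by (cases "K \<in> F") (auto simp: d_def)
  then have "?D \<noteq> {}" by blast
  moreover have "finite ?D" by (rule finite_subset[OF _ P_subgroups_finite]) (use F in auto)
  ultimately obtain N where N: "N \<in> ?D" and max: "\<And>L. L \<in> ?D \<Longrightarrow> N \<subseteq> L \<Longrightarrow> N = L"
    using finite_has_maximal[of ?D] by blast
  have "mk N d = (\<Sum>M | subgroup M (GG G). if M = N then d N * wt N else 0)"
    unfolding mk_def
  proof (rule sum.cong[OF refl])
    fix M
    show "(if N \<subseteq> M then d M * wt M else 0) = (if M = N then d N * wt N else 0)"
      using max[of M] supp by (cases "M \<in> F") (auto simp: d_def)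
  qed
  also have "\<dots> = d N * wt N" using P_subgroups_finite F N by simp
  finally have "mk N d = d N * wt N" .
  moreover have "mk N d = 0" unfolding d_def mk_diff using eq N by simp
  ultimately show False using N wt_nonzero[OF F, of N, where 'k='k] by simp
qed

text \<open>Solve for \<open>F\<close> without a minimal member \<open>N0\<close>, then adjust the
  coefficient at \<open>N0\<close>: this changes marks only at subgroups of \<open>N0\<close>, and
  the only such member of \<open>F\<close> is \<open>N0\<close> itself.\<close>

lemma mk_solvable:
  assumes "finite F" "\<And>L. L \<in> F \<Longrightarrow> subgroup L (GG G)"
  shows "\<exists>a :: ('g \<times> 'g) set \<Rightarrow> 'k::field_char_0. (\<forall>L. L \<notin> F \<longrightarrow> a L = 0) \<and> (\<forall>N\<in>F. mk N a = c N)"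
  using assms
proof (induction F rule: finite_psubset_induct)
  case (psubset F)
  show ?case
  proof (cases "F = {}")
    case True
    then show ?thesis by (intro exI[of _ "\<lambda>_. 0"]) simp
  next
    case False
    then obtain N0 where N0: "N0 \<in> F" and min: "\<And>L. L \<in> F \<Longrightarrow> L \<subseteq> N0 \<Longrightarrow> L = N0"
      using finite_has_minimal[OF psubset.hyps(1)] by metis
    have "\<exists>a :: ('g \<times> 'g) set \<Rightarrow> 'k. (\<forall>L. L \<notin> F - {N0} \<longrightarrow> a L = 0) \<and> (\<forall>N\<in>F - {N0}. mk N a = c N)"
    proof (rule psubset.IH)
      show "F - {N0} \<subset> F" using N0 by blast
      show "\<And>L. L \<in> F - {N0} \<Longrightarrow> subgroup L (GG G)" using psubset.prems by simp
    qed
    then obtain a :: "('g \<times> 'g) set \<Rightarrow> 'k"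
      where a': "(\<forall>L. L \<notin> F - {N0} \<longrightarrow> a L = 0) \<and> (\<forall>N\<in>F - {N0}. mk N a = c N)" ..
    have a: "a L = 0" if "L \<notin> F - {N0}" for L using a' that by blast
    have ac: "mk N a = c N" if "N \<in> F - {N0}" for N using a' that by blast
    define b where "b = a(N0 := (c N0 - mk N0 a) / wt N0)"
    have sub0: "subgroup N0 (GG G)" using psubset.prems N0 by blast
    have b: "mk N b = mk N a + (if N \<subseteq> N0 then b N0 * wt N0 else 0)" for N
    proof -
      have "mk N b = (\<Sum>M | subgroup M (GG G). (if N \<subseteq> M then a M * wt M else 0) +
          (if M = N0 then (if N \<subseteq> N0 then b N0 * wt N0 else 0) else 0))"
        unfolding mk_def by (rule sum.cong) (use a[of N0] in \<open>auto simp: b_def\<close>)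
      then show ?thesis using P_subgroups_finite sub0 by (simp add: mk_def sum.distrib)
    qed
    have "mk N b = c N" if N: "N \<in> F" for N
    proof (cases "N = N0")
      case True
      then show ?thesis using b[of N0] wt_nonzero[OF sub0, where 'k='k] by (simp add: b_def)
    next
      case False
      then show ?thesis using b[of N] min[OF N] ac[of N] N by auto
    qed
    moreover have "b L = 0" if "L \<notin> F" for L using that N0 a by (auto simp: b_def)
    ultimately show ?thesis by blast
  qed
qed

subsection \<open>The centre\<close>

text \<open>The graph of a function instead of an exponent: exponents are determined only modulo the
  order of U, whereas automorphisms are recovered from their graphs.\<close>

definition agraph :: "'g set \<Rightarrow> ('g \<Rightarrow> 'g) \<Rightarrow> ('g \<times> 'g) set" where
  "agraph U c = (\<lambda>u. (c u, u)) ` U"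

lemma agraph_subset: "agraph U c \<subseteq> agraph V d \<longleftrightarrow> U \<subseteq> V \<and> (\<forall>u\<in>U. c u = d u)"
  by (auto simp: agraph_def)

lemma agraph_power: "agraph U (\<lambda>u\<in>U. u [^] (i::nat)) = graph U i"
  by (auto simp: agraph_def graph_def)

lemma agraph_cases:
  assumes "subgroup U G" "c \<in> carrier (AutG G U)"
  obtains i :: nat where "agraph U c = graph U i" "inj_on (\<lambda>u. u [^] i) U" "\<forall>u\<in>U. c u = u [^] i"
  using assms AutG_iff[OF assms(1), of c] agraph_power by auto

lemma agraph_in_Lam: "subgroup U G \<Longrightarrow> c \<in> carrier (AutG G U) \<Longrightarrow> agraph U c \<in> Lam"
  using agraph_cases graph_in_Lam by metis

lemma agraph_inj:
  assumes "c \<in> carrier (AutG G U)" "d \<in> carrier (AutG G V)" "agraph U c = agraph V d"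
  shows "U = V" "c = d"
proof -
  show UV: "U = V" using assms(3) agraph_subset[of U c V d] agraph_subset[of V d U c] by blast
  have "\<forall>u\<in>U. c u = d u" using assms(3) agraph_subset[of U c V d] by blast
  then show "c = d" using assms(1,2) UV by (auto simp: carrier_AutG intro: extensionalityI)
qed

abbreviation GA :: "('g \<Rightarrow> 'g) \<Rightarrow> ('g \<times> 'g) set" where
  "GA b \<equiv> agraph (carrier G) b"

lemma Aut_fin_comm_group: "fin_comm_group (AutoGroup G)"
  using AutG_fin_comm_group[OF subgroup_self] unfolding AutG_carrier .

lemma Aut_cases:
  assumes "b \<in> carrier (AutoGroup G)"
  obtains i :: nat where "GA b = graph (carrier G) i" "inj_on (\<lambda>u. u [^] i) (carrier G)" "\<forall>u\<in>carrier G. b u = u [^] i"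
  using agraph_cases[OF subgroup_self, of b] assms unfolding AutG_carrier by blast

lemma GA_in_Lam: "b \<in> carrier (AutoGroup G) \<Longrightarrow> GA b \<in> Lam"
  using agraph_in_Lam[OF subgroup_self, of b] unfolding AutG_carrier .

lemma GA_inj: "b \<in> carrier (AutoGroup G) \<Longrightarrow> c \<in> carrier (AutoGroup G) \<Longrightarrow> GA b = GA c \<longleftrightarrow> b = c"
  using agraph_inj(2)[of b "carrier G" c "carrier G"] unfolding AutG_carrier by blast

lemma wt_GA: "b \<in> carrier (AutoGroup G) \<Longrightarrow> wt (GA b) = (1 :: 'k::field_char_0)"
  using order_nonzero[where 'k='k] by (auto elim!: Aut_cases simp: wt_def graph_card order_def)

text \<open>An injective power map on G maps each subgroup onto itself and pulls it back to itself,
  so both composites have the domain of \<open>M\<close>; the exponents commute.\<close>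

lemma GA_commutes:
  assumes b: "b \<in> carrier (AutoGroup G)" and M: "M \<in> Lam"
  shows "GA b O M = M O GA b"
proof -
  obtain i :: nat where i: "GA b = graph (carrier G) i" "inj_on (\<lambda>u. u [^] i) (carrier G)" using b by (rule Aut_cases)
  obtain W j where W: "subgroup W G" "M = graph W j" using M Lam_graph by blast
  note Wc = subgroup_in[OF W(1)]
  have inj: "inj_on (\<lambda>u. u [^] i) W" by (rule inj_on_subset[OF i(2) subgroup.subset[OF W(1)]])
  have "(\<lambda>u. u [^] i) ` W \<subseteq> W" using subgroup_pow[OF W(1)] by auto
  then have img: "(\<lambda>u. u [^] i) ` W = W" by (rule endo_inj_surj[OF subgroup_fin[OF W(1)] _ inj])
  have iff: "w [^] i \<in> W \<longleftrightarrow> w \<in> W" if w: "w \<in> carrier G" for w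
  proof
    assume "w [^] i \<in> W"
    then have "w [^] i \<in> (\<lambda>u. u [^] i) ` W" unfolding img .
    then obtain u where "u \<in> W" "w [^] i = u [^] i" by blast
    then show "w \<in> W" using inj_onD[OF i(2), of w u] w Wc by simp
  qed (rule subgroup_pow[OF W(1)])
  have "{w \<in> W. w [^] j \<in> carrier G} = W" using Wc by auto
  moreover have "{w \<in> carrier G. w [^] i \<in> W} = W" using iff Wc by auto
  ultimately show ?thesis
    unfolding i(1) W(2) graph_relcomp_graph[OF W(1)] graph_relcomp_graph[OF subgroup_self]
    by (simp add: mult.commute)
qed

lemma GA_relcomp:
  assumes "b \<in> carrier (AutoGroup G)" "c \<in> carrier (AutoGroup G)"
  shows "GA b O GA c = GA (b \<otimes>\<^bsub>AutoGroup G\<^esub> c)"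
proof -
  have "b \<otimes>\<^bsub>AutoGroup G\<^esub> c = compose (carrier G) b c"
    using AutG_mult[of b "carrier G" c] assms unfolding AutG_carrier by blast
  moreover have "c u \<in> carrier G" if "u \<in> carrier G" for u
    using assms(2) that by (auto elim!: Aut_cases)
  ultimately show ?thesis by (auto simp: agraph_def relcomp_unfold compose_def)
qed

section \<open>The group algebra of the automorphism group inside the biset algebra\<close>

definition zeta :: "(('g \<Rightarrow> 'g) \<Rightarrow> 'k::field_char_0) \<Rightarrow> ('g \<times> 'g) set \<Rightarrow> 'k" where
  "zeta x L = (\<Sum>b\<in>carrier (AutoGroup G). if GA b = L then x b else 0)"

lemma zeta_GA: "b \<in> carrier (AutoGroup G) \<Longrightarrow> zeta x (GA b) = x b"
proof -
  assume b: "b \<in> carrier (AutoGroup G)"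
  interpret A: fin_comm_group "AutoGroup G" by (rule Aut_fin_comm_group)
  have "zeta x (GA b) = (\<Sum>c\<in>carrier (AutoGroup G). if c = b then x b else 0)"
    unfolding zeta_def by (rule sum.cong) (auto simp: GA_inj b)
  then show ?thesis using b A.fin by simp
qed

lemma zeta_support: "zeta x L \<noteq> 0 \<Longrightarrow> \<exists>b\<in>carrier (AutoGroup G). L = GA b"
proof (rule ccontr)
  assume nz: "zeta x L \<noteq> 0" and "\<not> (\<exists>b\<in>carrier (AutoGroup G). L = GA b)"
  then have "zeta x L = 0" unfolding zeta_def by (intro sum.neutral) auto
  then show False using nz by simp
qed

lemma zeta_in: "zeta x \<in> KB_lhd G"
  unfolding KB_lhd_iff using zeta_support GA_in_Lam by blast

lemma zeta_sum:
  "(\<Sum>L | subgroup L (GG G). zeta x L * f L) = (\<Sum>b\<in>carrier (AutoGroup G). x b * f (GA b))"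
proof -
  have "(\<Sum>L | subgroup L (GG G). zeta x L * f L) =
      (\<Sum>L | subgroup L (GG G). \<Sum>b\<in>carrier (AutoGroup G). if L = GA b then x b * f (GA b) else 0)"
    unfolding zeta_def sum_distrib_right by (intro sum.cong refl) auto
  also have "\<dots> = (\<Sum>b\<in>carrier (AutoGroup G). \<Sum>L | subgroup L (GG G). if L = GA b then x b * f (GA b) else 0)"
    by (rule sum.swap)
  also have "\<dots> = (\<Sum>b\<in>carrier (AutoGroup G). x b * f (GA b))"
    by (rule sum.cong[OF refl]) (simp add: P_subgroups_finite Lam_subgroup[OF GA_in_Lam])
  finally show ?thesis .
qed

lemma mk_zeta: "mk N (zeta x) = (\<Sum>b\<in>carrier (AutoGroup G). if N \<subseteq> GA b then x b else 0)"
proof -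
  have "mk N (zeta x) = (\<Sum>L | subgroup L (GG G). zeta x L * (if N \<subseteq> L then wt L else 0))"
    unfolding mk_def by (rule sum.cong) auto
  also have "\<dots> = (\<Sum>b\<in>carrier (AutoGroup G). if N \<subseteq> GA b then x b else 0)"
    unfolding zeta_sum by (rule sum.cong) (auto simp: wt_GA)
  finally show ?thesis .
qed

lemma KB_lhd_eqI:
  fixes a b :: "('g \<times> 'g) set \<Rightarrow> 'k::field_char_0"
  assumes "a \<in> KB_lhd G" "b \<in> KB_lhd G" "\<And>N. N \<in> Lam \<Longrightarrow> mk N a = mk N b"
  shows "a = b"
  by (rule mk_determines[of Lam]) (use assms Lam_subgroup in \<open>auto simp: KB_lhd_iff\<close>)

text \<open>The graphs of automorphisms have weight 1 and multiply as the automorphisms do, so no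
  rescaling intervenes and the product is convolution.\<close>

lemma bmult_zeta: "bmult G (zeta x) (zeta y) = zeta (group_alg_mult (AutoGroup G) x y)"
proof (rule KB_lhd_eqI)
  let ?A = "AutoGroup G"
  interpret A: fin_comm_group ?A by (rule Aut_fin_comm_group)
  fix N
  let ?I = "\<lambda>h. if N \<subseteq> GA h then 1 else (0 :: 'a)"
  have "mk N (bmult G (zeta x) (zeta y)) = (\<Sum>L | subgroup L (GG G). zeta x L *
      (\<Sum>M | subgroup M (GG G). zeta y M * (if N \<subseteq> L O M then wt L * wt M else 0)))"
    unfolding mk_bmult[OF zeta_in zeta_in] sum_distrib_left
    by (intro sum.cong refl) (simp add: ac_simps)
  also have "\<dots> = (\<Sum>b\<in>carrier ?A. x b * (\<Sum>c\<in>carrier ?A. y c * (if N \<subseteq> GA b O GA c then wt (GA b) * wt (GA c) else 0)))"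
    unfolding zeta_sum ..
  also have "\<dots> = (\<Sum>b\<in>carrier ?A. \<Sum>c\<in>carrier ?A. x b * y c * ?I (b \<otimes>\<^bsub>?A\<^esub> c))"
    unfolding sum_distrib_left by (intro sum.cong refl) (simp add: GA_relcomp wt_GA)
  also have "\<dots> = (\<Sum>b\<in>carrier ?A. \<Sum>h\<in>carrier ?A. x b * y (inv\<^bsub>?A\<^esub> b \<otimes>\<^bsub>?A\<^esub> h) * ?I h)"
    by (rule sum.cong[OF refl], rule A.sum_translate[symmetric, of _ "\<lambda>c h. x _ * y c * ?I h"])
  also have "\<dots> = (\<Sum>h\<in>carrier ?A. \<Sum>b\<in>carrier ?A. x b * y (inv\<^bsub>?A\<^esub> b \<otimes>\<^bsub>?A\<^esub> h) * ?I h)"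
    by (rule sum.swap)
  also have "\<dots> = mk N (zeta (group_alg_mult ?A x y))"
    unfolding mk_zeta by (rule sum.cong) (auto simp: group_alg_mult_def sum_distrib_right)
  finally show "mk N (bmult G (zeta x) (zeta y)) = mk N (zeta (group_alg_mult ?A x y))" .
qed (intro bmult_in zeta_in)+

lemma zeta_central:
  assumes a: "a \<in> KB_lhd G"
  shows "bmult G a (zeta x) = bmult G (zeta x) a"
proof (rule KB_lhd_eqI)
  fix N
  have "mk N (bmult G a (zeta x)) = (\<Sum>M | subgroup M (GG G). \<Sum>L | subgroup L (GG G).
     if N \<subseteq> L O M then (a L * wt L) * (zeta x M * wt M) else 0)"
    unfolding mk_bmult[OF a zeta_in] by (rule sum.swap)
  also have "\<dots> = mk N (bmult G (zeta x) a)"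
    unfolding mk_bmult[OF zeta_in a]
  proof (intro sum.cong refl)
    fix L M
    show "(if N \<subseteq> L O M then (a L * wt L) * (zeta x M * wt M) else 0) =
      (if N \<subseteq> M O L then (zeta x M * wt M) * (a L * wt L) else 0)"
    proof (cases "a L = 0 \<or> zeta x M = 0")
      case True
      then show ?thesis by (elim disjE) (simp_all cong: if_cong)
    next
      case False
      then have "L \<in> Lam" using a by (auto simp: KB_lhd_iff)
      moreover obtain b where "b \<in> carrier (AutoGroup G)" "M = GA b" using False zeta_support by blast
      ultimately have "L O M = M O L" using GA_commutes by simp
      then show ?thesis by (simp add: mult.commute)
    qed
  qed
  finally show "mk N (bmult G a (zeta x)) = mk N (bmult G (zeta x) a)" .
qed (intro bmult_in zeta_in a)+

section \<open>Central elements of \<open>KB_lhd G\<close>\<close>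

text \<open>Commutation with the single basis element of \<open>M\<close>, read at the mark
  \<open>N\<close>; the nonzero weight of \<open>M\<close> cancels.\<close>

lemma central_equation:
  fixes a :: "('g \<times> 'g) set \<Rightarrow> 'k::field_char_0"
  assumes a: "a \<in> KB_lhd G" and cent: "\<forall>b\<in>KB_lhd G. bmult G b a = bmult G a b" and M: "M \<in> Lam"
  shows "(\<Sum>L | subgroup L (GG G). if N \<subseteq> L O M then a L * wt L else 0) =
    (\<Sum>L | subgroup L (GG G). if N \<subseteq> M O L then a L * wt L else 0)"
proof -
  define s :: "('g \<times> 'g) set \<Rightarrow> 'k" where "s = (\<lambda>L. if L = M then 1 else 0)"
  have s: "s \<in> KB_lhd G" using M by (simp add: KB_lhd_iff s_def)
  have MS: "M \<in> {M. subgroup M (GG G)}" using Lam_subgroup[OF M] by simp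
  have delta: "(\<Sum>K | subgroup K (GG G). if Q K then r * (s K * wt K) else 0) = (if Q M then r else 0) * wt M"
    "(\<Sum>K | subgroup K (GG G). if Q K then (s K * wt K) * r else 0) = (if Q M then r else 0) * wt M"
    for Q and r :: 'k
  proof -
    have "(\<Sum>K | subgroup K (GG G). if Q K then r * (s K * wt K) else 0) =
        (\<Sum>K | subgroup K (GG G). if K = M then (if Q M then r else 0) * wt M else 0)"
      by (rule sum.cong) (auto simp: s_def)
    then show *: "(\<Sum>K | subgroup K (GG G). if Q K then r * (s K * wt K) else 0) = (if Q M then r else 0) * wt M"
      using P_subgroups_finite MS by simp
    show "(\<Sum>K | subgroup K (GG G). if Q K then (s K * wt K) * r else 0) = (if Q M then r else 0) * wt M"
      using * by (simp only: mult.commute[of _ r])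
  qed
  have "mk N (bmult G a s) = (\<Sum>L | subgroup L (GG G). if N \<subseteq> L O M then a L * wt L else 0) * wt M"
    unfolding mk_bmult[OF a s] delta sum_distrib_right ..
  moreover have "mk N (bmult G s a) = (\<Sum>L | subgroup L (GG G). if N \<subseteq> M O L then a L * wt L else 0) * wt M"
    unfolding mk_bmult[OF s a] by (subst sum.swap) (simp only: delta sum_distrib_right)
  moreover have "bmult G s a = bmult G a s" using cent s by blast
  ultimately show ?thesis using wt_nonzero[OF Lam_subgroup[OF M], where 'k='k] by simp
qed

text \<open>Composing on the right with a power map of G onto U extends a partial map defined on U
  to one defined on G, whereas composing on the left can never enlarge a domain; so only maps with
  full domain carry \<open>a\<close>. Among these, a map with proper image survives restriction of
  its values to the image but not restriction of its arguments, so the image must be full as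
  well.\<close>

lemma central_support:
  fixes a :: "('g \<times> 'g) set \<Rightarrow> 'k::field_char_0"
  assumes a: "a \<in> KB_lhd G" and cent: "\<forall>b\<in>KB_lhd G. bmult G b a = bmult G a b" and nz: "a L0 \<noteq> 0"
  shows "\<exists>b\<in>carrier (AutoGroup G). L0 = GA b"
proof -
  \<comment> \<open>The part of \<open>a\<close> on graphs with full domain; it is shown to have the
    same marks as \<open>a\<close>.\<close>
  define a' where "a' = (\<lambda>L. if snd ` L = carrier G then a L else 0)"
  have "a = a'"
  proof (rule KB_lhd_eqI[OF a])
    show "a' \<in> KB_lhd G" using a by (simp add: KB_lhd_iff a'_def)
    fix N assume "N \<in> Lam"
    then obtain U j where U: "subgroup U G" "N = graph U j" using Lam_graph by blast
    define d where "d = order G div card U"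
    have Ud: "U = (\<lambda>g. g [^] d) ` carrier G" unfolding d_def by (rule subgroup_pow_image[OF U(1)])
    \<comment> \<open>\<open>?M\<close> is the power map by the index of U, which maps G onto U;
      \<open>?N\<close> is the map of \<open>N\<close> preceded by it, and so has full
      domain.\<close>
    let ?M = "graph (carrier G) d" and ?N = "graph (carrier G) (d * j)"
    have l: "?N \<subseteq> L O ?M \<longleftrightarrow> N \<subseteq> L" for L
    proof -
      have "?N \<subseteq> L O ?M \<longleftrightarrow> (\<forall>g\<in>carrier G. ((g [^] d) [^] j, g [^] d) \<in> L)"
        by (auto simp: graph_def relcomp_unfold nat_pow_pow)
      also have "\<dots> \<longleftrightarrow> N \<subseteq> L" unfolding U(2) graph_def by (subst Ud) auto
      finally show ?thesis .
    qed
    have r: "?N \<subseteq> ?M O L \<longleftrightarrow> snd ` L = carrier G \<and> N \<subseteq> L" if L: "L \<in> Lam" for L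
    proof -
      obtain V i where V: "subgroup V G" "L = graph V i" using L Lam_graph by blast
      have "?N \<subseteq> ?M O L \<longleftrightarrow> (\<forall>g\<in>carrier G. g \<in> V \<and> (g [^] d) [^] j = (g [^] i) [^] d)"
        unfolding V(2) graph_relcomp by (auto simp: graph_def nat_pow_pow)
      also have "\<dots> \<longleftrightarrow> V = carrier G \<and> (\<forall>g\<in>carrier G. (g [^] d) [^] j = (g [^] d) [^] i)"
        using subgroup.subset[OF V(1)] by (auto simp: nat_pow_pow mult.commute)
      also have "\<dots> \<longleftrightarrow> V = carrier G \<and> (\<forall>u\<in>U. u [^] j = u [^] i)"
        by (subst Ud) simp
      also have "\<dots> \<longleftrightarrow> snd ` L = carrier G \<and> N \<subseteq> L"
        unfolding V(2) U(2) graph_snd using subgroup.subset[OF U(1)] by (auto simp: graph_def)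
      finally show ?thesis .
    qed
    have "mk N a = (\<Sum>L | subgroup L (GG G). if ?N \<subseteq> L O ?M then a L * wt L else 0)"
      unfolding mk_def l ..
    also have "\<dots> = (\<Sum>L | subgroup L (GG G). if ?N \<subseteq> ?M O L then a L * wt L else 0)"
      by (rule central_equation[OF a cent graph_in_Lam[OF subgroup_self]])
    also have "\<dots> = mk N a'"
      unfolding mk_def
    proof (rule sum.cong[OF refl])
      fix L
      show "(if ?N \<subseteq> ?M O L then a L * wt L else 0) = (if N \<subseteq> L then a' L * wt L else 0)"
        using a r[of L] by (cases "L \<in> Lam") (auto simp: a'_def KB_lhd_iff)
    qed
    finally show "mk N a = mk N a'" .
  qed
  then have full: "snd ` L = carrier G" if "a L \<noteq> 0" for L
    using that unfolding a'_def by (metis (full_types))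
  have form: "\<exists>i. L = graph (carrier G) i" if L: "a L \<noteq> 0" for L
  proof -
    have "L \<in> Lam" using a L by (simp add: KB_lhd_iff)
    then obtain V i where "L = graph V i" using Lam_graph by blast
    then show ?thesis using full[OF L] graph_snd[of V i] by auto
  qed
  obtain i where i: "L0 = graph (carrier G) i" using form[OF nz] by blast
  let ?U = "(\<lambda>g. g [^] i) ` carrier G"
  have U: "subgroup ?U G"
    using fst_subgroup[OF is_group Lam_subgroup, of L0] a nz i graph_fst by (simp add: KB_lhd_iff)
  have "?U = carrier G"
  proof (rule ccontr)
    assume ne: "?U \<noteq> carrier G"
    \<comment> \<open>The diagonal of the image. On the right it restricts arguments to
      \<open>?U\<close>, so no composite contains \<open>L0\<close>; on the left it restricts values
      to \<open>?U\<close>, which leaves \<open>L0\<close> intact.\<close>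
    let ?M = "graph ?U 1"
    have "?U \<subseteq> carrier G" by auto
    then obtain g where g: "g \<in> carrier G" "g \<notin> ?U" using ne by blast
    have l: "\<not> L0 \<subseteq> L O ?M" for L
    proof
      assume "L0 \<subseteq> L O ?M"
      moreover have "(g [^] i, g) \<in> L0" using g(1) by (simp add: i graph_iff)
      ultimately have "(g [^] i, g) \<in> L O ?M" by blast
      then show False using g(2) by (auto simp: graph_iff)
    qed
    \<comment> \<open>All graphs in the support have full domain, so containing \<open>L0\<close>
      already means being equal to it; the sum of the central equation collapses to a single
      term.\<close>
    have r: "L0 \<subseteq> ?M O L \<longleftrightarrow> L = L0" if L: "a L \<noteq> 0" for L
    proof -
      obtain k where k: "L = graph (carrier G) k" using form[OF L] by blast
      have "L0 \<subseteq> ?M O L \<longleftrightarrow> (\<forall>h\<in>carrier G. h [^] k \<in> ?U \<and> h [^] i = h [^] k)"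
        unfolding i k graph_relcomp by (auto simp: graph_def)
      also have "\<dots> \<longleftrightarrow> (\<forall>h\<in>carrier G. h [^] i = h [^] k)"
      proof (intro iffI ballI)
        fix h assume eq: "\<forall>h\<in>carrier G. h [^] i = h [^] k" and h: "h \<in> carrier G"
        have "h [^] i \<in> ?U" using h by (rule imageI)
        then show "h [^] k \<in> ?U \<and> h [^] i = h [^] k" using eq h by simp
      qed simp
      also have "\<dots> \<longleftrightarrow> L = L0"
      proof
        assume "\<forall>h\<in>carrier G. h [^] i = h [^] k"
        then show "L = L0" unfolding i k graph_def by (intro image_cong) auto
      next
        assume "L = L0"
        then have "(h [^] i, h) \<in> graph (carrier G) k" if "h \<in> carrier G" for h
          using that i k by (auto simp: graph_iff)
        then show "\<forall>h\<in>carrier G. h [^] i = h [^] k" by (simp add: graph_iff)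
      qed
      finally show ?thesis .
    qed
    have "0 = (\<Sum>L | subgroup L (GG G). if L0 \<subseteq> L O ?M then a L * wt L else 0)"
      using l by simp
    also have "\<dots> = (\<Sum>L | subgroup L (GG G). if L0 \<subseteq> ?M O L then a L * wt L else 0)"
      by (rule central_equation[OF a cent graph_in_Lam[OF U]])
    also have "\<dots> = (\<Sum>L | subgroup L (GG G). if L = L0 then a L0 * wt L0 else 0)"
    proof (rule sum.cong[OF refl])
      fix L
      show "(if L0 \<subseteq> ?M O L then a L * wt L else 0) = (if L = L0 then a L0 * wt L0 else 0)"
        using r[of L] nz by (cases "a L = 0") auto
    qed
    also have "\<dots> = a L0 * wt L0"
      using P_subgroups_finite a nz Lam_subgroup by (simp add: KB_lhd_iff)
    finally show False
      using nz wt_nonzero[OF Lam_subgroup, of L0, where 'k='k] a by (auto simp: KB_lhd_iff)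
  qed
  \<comment> \<open>A surjective power map on a finite group is injective, which turns
    \<open>L0\<close> into the graph of an automorphism.\<close>
  then have inj: "inj_on (\<lambda>g. g [^] i) (carrier G)"
    using finG by (simp add: inj_on_iff_surj eq_card_imp_inj_on)
  let ?b = "\<lambda>g\<in>carrier G. g [^] i"
  have "?b \<in> carrier (AutoGroup G)"
    using AutG_iff[OF subgroup_self, of ?b] inj coprime_if_inj_power[OF subgroup_self inj]
    unfolding AutG_carrier by blast
  moreover have "L0 = GA ?b" unfolding agraph_power i ..
  ultimately show ?thesis by blast
qed

section \<open>Primitive central idempotents\<close>

text \<open>The preimage under \<open>zeta\<close> is read off from the coefficients at the graphs
  \<open>GA b\<close>, outside of which a central element vanishes.\<close>

lemma central_idem_KB_lhd:
  "central_idem (KB_lhd G) (bmult G) e \<longleftrightarrow>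
    (\<exists>x. central_idem (group_alg (AutoGroup G)) (group_alg_mult (AutoGroup G)) x \<and> e = zeta (x :: _ \<Rightarrow> 'k::field_char_0))"
proof -
  let ?A = "AutoGroup G"
  interpret A: fin_comm_group ?A by (rule Aut_fin_comm_group)
  show ?thesis unfolding A.central_idem_iff
  proof
    assume "central_idem (KB_lhd G) (bmult G) e"
    then have e: "e \<in> KB_lhd G" "bmult G e e = e" "\<forall>a\<in>KB_lhd G. bmult G a e = bmult G e a"
      by (auto simp: central_idem_def)
    define x where "x = (\<lambda>b. if b \<in> carrier ?A then e (GA b) else 0)"
    have x: "x \<in> group_alg ?A" by (simp add: group_alg_def x_def)
    have ex: "e = zeta x"
    proof
      fix L
      show "e L = zeta x L"
      proof (cases "\<exists>b\<in>carrier ?A. L = GA b")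
        case True
        then obtain b where b: "b \<in> carrier ?A" "L = GA b" by blast
        have "zeta x (GA b) = x b" by (rule zeta_GA[OF b(1)])
        also have "x b = e (GA b)" using b(1) by (simp add: x_def)
        finally show ?thesis using b(2) by simp
      next
        case False
        then show ?thesis using zeta_support[of x L] central_support[OF e(1,3), of L] by metis
      qed
    qed
    have "zeta (group_alg_mult ?A x x) = zeta x" using e(2) ex bmult_zeta[of x x] by simp
    then have "group_alg_mult ?A x x b = x b" if "b \<in> carrier ?A" for b
      using zeta_GA[OF that] by metis
    then have "group_alg_mult ?A x x = x"
      using A.KA_vanish[OF A.conv_in] A.KA_vanish[OF x] by (metis ext)
    then show "\<exists>x. A.idem x \<and> e = zeta x" using x ex by (auto simp: A.idem_def)
  next
    assume "\<exists>x. A.idem x \<and> e = zeta x"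
    then obtain x where x: "group_alg_mult ?A x x = x" "e = zeta x" by (auto simp: A.idem_def)
    then show "central_idem (KB_lhd G) (bmult G) e"
      using zeta_central by (auto simp: central_idem_def zeta_in bmult_zeta)
  qed
qed

lemma zeta_inj_on: "inj_on zeta (group_alg (AutoGroup G) :: (_ \<Rightarrow> 'k::field_char_0) set)"
proof (rule inj_onI)
  fix x y :: "('g \<Rightarrow> 'g) \<Rightarrow> 'k"
  assume xy: "x \<in> group_alg (AutoGroup G)" "y \<in> group_alg (AutoGroup G)" "zeta x = zeta y"
  show "x = y"
  proof
    fix b
    show "x b = y b"
      using xy zeta_GA[of b x] zeta_GA[of b y] by (cases "b \<in> carrier (AutoGroup G)") (auto simp: group_alg_def)
  qed
qed

lemma zeta_zero: "zeta (\<lambda>_. 0) = (\<lambda>_. 0)"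
  by (rule ext) (simp add: zeta_def)

lemma zeta_add: "zeta (\<lambda>b. x b + y b) = (\<lambda>L. zeta x L + zeta y L)"
  by (rule ext) (auto simp: zeta_def sum.distrib[symmetric] intro!: sum.cong)

text \<open>Primitivity speaks only of central idempotents, and all of these lie in the image of
  \<open>zeta\<close>, which is injective and respects zero, sums and products; so a splitting on
  one side is a splitting on the other.\<close>

lemma zeta_bij_pci:
  "bij_betw zeta {x. primitive_central_idem (group_alg (AutoGroup G)) (group_alg_mult (AutoGroup G)) x}
     {e :: _ \<Rightarrow> 'k::field_char_0. primitive_central_idem (KB_lhd G) (bmult G) e}"
proof -
  let ?A = "AutoGroup G"
  interpret A: fin_comm_group ?A by (rule Aut_fin_comm_group)
  let ?ci = "central_idem (group_alg ?A) (group_alg_mult ?A) :: (_ \<Rightarrow> 'k) \<Rightarrow> bool"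
  let ?z = "\<lambda>_. 0 :: 'k"
  have cin: "x \<in> group_alg ?A" if "?ci x" for x using that by (simp add: central_idem_def)
  have zin: "?z \<in> group_alg ?A" by (simp add: group_alg_def)
  have eq: "zeta x = zeta y \<longleftrightarrow> x = y" if "x \<in> group_alg ?A" "y \<in> group_alg ?A" for x y :: "_ \<Rightarrow> 'k"
    using zeta_inj_on that by (auto dest: inj_onD)
  have z0: "zeta x = ?z \<longleftrightarrow> x = ?z" if "x \<in> group_alg ?A" for x
    using eq[OF that zin] by (simp add: zeta_zero)
  have prim: "primitive_central_idem (KB_lhd G) (bmult G) (zeta x) \<longleftrightarrow>
      primitive_central_idem (group_alg ?A) (group_alg_mult ?A) x" if x: "?ci x" for x
  proof -
    have mul0: "bmult G (zeta u) (zeta v) = ?z \<longleftrightarrow> group_alg_mult ?A u v = ?z" for u v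
      unfolding bmult_zeta by (rule z0[OF A.conv_in])
    have add: "zeta x = (\<lambda>L. zeta u L + zeta v L) \<longleftrightarrow> x = (\<lambda>b. u b + v b)" if "?ci u" "?ci v" for u v
      unfolding zeta_add[symmetric] by (rule eq[OF cin[OF x] A.add_in[OF cin[OF that(1)] cin[OF that(2)]]])
    have "(\<exists>e1 e2. central_idem (KB_lhd G) (bmult G) e1 \<and> central_idem (KB_lhd G) (bmult G) e2 \<and>
        e1 \<noteq> ?z \<and> e2 \<noteq> ?z \<and> bmult G e1 e2 = ?z \<and> zeta x = (\<lambda>L. e1 L + e2 L)) \<longleftrightarrow>
      (\<exists>u v. ?ci u \<and> ?ci v \<and> zeta u \<noteq> ?z \<and> zeta v \<noteq> ?z \<and> bmult G (zeta u) (zeta v) = ?z \<and>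
        zeta x = (\<lambda>L. zeta u L + zeta v L))"
      unfolding central_idem_KB_lhd by blast
    also have "\<dots> \<longleftrightarrow> (\<exists>u v. ?ci u \<and> ?ci v \<and> u \<noteq> ?z \<and> v \<noteq> ?z \<and> group_alg_mult ?A u v = ?z \<and>
        x = (\<lambda>b. u b + v b))"
    proof -
      have "(?ci u \<and> ?ci v \<and> zeta u \<noteq> ?z \<and> zeta v \<noteq> ?z \<and> bmult G (zeta u) (zeta v) = ?z \<and>
          zeta x = (\<lambda>L. zeta u L + zeta v L)) \<longleftrightarrow>
        (?ci u \<and> ?ci v \<and> u \<noteq> ?z \<and> v \<noteq> ?z \<and> group_alg_mult ?A u v = ?z \<and> x = (\<lambda>b. u b + v b))" for u v
      proof (cases "?ci u \<and> ?ci v")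
        case True
        then show ?thesis using z0[OF cin, of u] z0[OF cin, of v] mul0[of u v] add[of u v] by simp
      qed auto
      then show ?thesis by (simp only:)
    qed
    finally show ?thesis
      unfolding primitive_central_idem_def using x z0[OF cin[OF x]] central_idem_KB_lhd by blast
  qed
  show ?thesis unfolding bij_betw_def
  proof
    show "inj_on zeta {x :: _ \<Rightarrow> 'k. primitive_central_idem (group_alg ?A) (group_alg_mult ?A) x}"
      by (rule inj_on_subset[OF zeta_inj_on]) (auto dest: A.pciD)
    show "zeta ` {x. primitive_central_idem (group_alg ?A) (group_alg_mult ?A) x} =
        {e :: _ \<Rightarrow> 'k. primitive_central_idem (KB_lhd G) (bmult G) e}"
    proof (intro subset_antisym subsetI)
      fix e assume "e \<in> zeta ` {x :: _ \<Rightarrow> 'k. primitive_central_idem (group_alg ?A) (group_alg_mult ?A) x}"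
      then obtain x where x: "primitive_central_idem (group_alg ?A) (group_alg_mult ?A) x" "e = zeta x" by blast
      then have "?ci x" by (simp add: primitive_central_idem_def)
      then show "e \<in> {e. primitive_central_idem (KB_lhd G) (bmult G) e}" using prim x by blast
    next
      fix e :: "_ \<Rightarrow> 'k" assume "e \<in> {e. primitive_central_idem (KB_lhd G) (bmult G) e}"
      then have e: "primitive_central_idem (KB_lhd G) (bmult G) e" by simp
      then have "central_idem (KB_lhd G) (bmult G) e" by (simp add: primitive_central_idem_def)
      then obtain x where x: "?ci x" "e = zeta x" unfolding central_idem_KB_lhd by blast
      then show "e \<in> zeta ` {x. primitive_central_idem (group_alg ?A) (group_alg_mult ?A) x}"
        using e prim[OF x(1)] by blast
    qed
  qed
qed

subsection \<open>The idempotents \<open>e\<^sub>(\<^sub>U\<^sub>,\<^sub>\<chi>\<^sub>)\<close>\<close>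

text \<open>The basis of \<open>KB_Delta G\<close>, indexed by a subgroup and an automorphism of it;
  this is the form in which marks are compared with elements of the algebras K Aut(U).\<close>

definition Del :: "('g \<times> 'g) set set" where
  "Del = {agraph U c | U c. subgroup U G \<and> c \<in> carrier (AutG G U)}"

lemma Del_subgroup: "L \<in> Del \<Longrightarrow> subgroup L (GG G)"
  unfolding Del_def using agraph_in_Lam Lam_subgroup by blast

lemma Del_finite: "finite Del"
  by (rule finite_subset[OF _ P_subgroups_finite]) (use Del_subgroup in blast)

text \<open>For the graph of a power map, k_2 is the kernel, so k_2 = 1 says that the power map is
  an automorphism of its domain.\<close>

lemma Del_iff: "L \<in> Del \<longleftrightarrow> subgroup L (GG G) \<and> k1 G L = {\<one>} \<and> k2 G L = {\<one>}"
proof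
  assume "L \<in> Del"
  then obtain U c where U: "subgroup U G" and c: "c \<in> carrier (AutG G U)" and L: "L = agraph U c"
    by (auto simp: Del_def)
  obtain i :: nat where i: "agraph U c = graph U i" "inj_on (\<lambda>u. u [^] i) U" by (rule agraph_cases[OF U c])
  have "u = \<one>" if "u \<in> U" "\<one> = u [^] i" for u
    using inj_onD[OF i(2), of u \<one>] that(1) that(2)[symmetric] subgroup.one_closed[OF U] by simp
  then have "k2 G L = {\<one>}"
    unfolding L i(1) using subgroup.one_closed[OF U] by (auto simp: k2_def graph_iff)
  then show "subgroup L (GG G) \<and> k1 G L = {\<one>} \<and> k2 G L = {\<one>}"
    using agraph_in_Lam[OF U c] L by (simp add: Lam_def)
next
  assume a: "subgroup L (GG G) \<and> k1 G L = {\<one>} \<and> k2 G L = {\<one>}"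
  then have "L \<in> Lam" by (simp add: Lam_def)
  then obtain V i where V: "subgroup V G" "L = graph V i" using Lam_graph by blast
  have "inj_on (\<lambda>v. v [^] i) V"
  proof (rule inj_onI)
    fix u v assume uv: "u \<in> V" "v \<in> V" "u [^] i = v [^] i"
    have c: "u \<in> carrier G" "v \<in> carrier G" using uv subgroup_in[OF V(1)] by auto
    have "(u \<otimes> inv v) [^] i = \<one>" using uv(3) c by (simp add: nat_pow_distrib nat_pow_inv)
    moreover have "u \<otimes> inv v \<in> V" using uv subgroup.m_closed[OF V(1)] subgroup.m_inv_closed[OF V(1)] by blast
    ultimately have "u \<otimes> inv v \<in> k2 G L" using c by (simp add: k2_def V(2) graph_iff)
    then show "u = v" using a c by (simp add: mult_inv_eq_one_iff)
  qed
  then have "(\<lambda>v\<in>V. v [^] i) \<in> carrier (AutG G V)"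
    using AutG_iff[OF V(1)] coprime_if_inj_power[OF V(1)] by blast
  moreover have "L = agraph V (\<lambda>v\<in>V. v [^] i)" by (simp add: V(2) agraph_power)
  ultimately show "L \<in> Del" using V(1) by (auto simp: Del_def)
qed

lemma KB_Delta_iff: "a \<in> KB_Delta G \<longleftrightarrow> (\<forall>L. a L \<noteq> 0 \<longrightarrow> L \<in> Del)"
  by (simp add: KB_Delta_def Del_iff)

lemma centralizer_card_eq: "S \<subseteq> carrier G \<Longrightarrow> centralizer_card G S = order G"
proof -
  assume "S \<subseteq> carrier G"
  then have "{g \<in> carrier G. \<forall>x\<in>S. g \<otimes> x = x \<otimes> g} = carrier G" using m_comm by auto
  then show ?thesis by (simp add: centralizer_card_def order_def)
qed

text \<open>Substitute \<open>mu u\<close> for \<open>u\<close>, which runs through U again: the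
  subgroup depends on the pair only through the quotient of \<open>la\<close> by
  \<open>mu\<close>.\<close>

lemma Delta_eq:
  assumes U: "subgroup U G" and la: "la \<in> carrier (AutG G U)" and mu: "mu \<in> carrier (AutG G U)"
  shows "Delta U la mu = agraph U (la \<otimes>\<^bsub>AutG G U\<^esub> inv\<^bsub>AutG G U\<^esub> mu)"
proof -
  interpret A: fin_comm_group "AutG G U" by (rule AutG_fin_comm_group[OF U])
  let ?c = "la \<otimes>\<^bsub>AutG G U\<^esub> inv\<^bsub>AutG G U\<^esub> mu"
  have c: "?c \<in> carrier (AutG G U)" using la mu by simp
  have "?c \<otimes>\<^bsub>AutG G U\<^esub> mu = la" using la mu by (simp add: A.m_assoc)
  then have "compose U ?c mu = la" using AutG_mult[OF c mu] by simp
  then have l: "la u = ?c (mu u)" if "u \<in> U" for u using that by (metis compose_eq)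
  have img: "mu ` U = U" using mu by (auto simp: carrier_AutG bij_betw_def)
  have "agraph U ?c = (\<lambda>u. (?c u, u)) ` mu ` U" unfolding agraph_def img ..
  also have "\<dots> = (\<lambda>u. (?c (mu u), mu u)) ` U" by (rule image_image)
  also have "\<dots> = (\<lambda>u. (la u, mu u)) ` U" by (rule image_cong[OF refl]) (simp add: l)
  also have "\<dots> = Delta U la mu" unfolding Delta_def by blast
  finally show ?thesis by simp
qed

text \<open>The factor |G| of the mark cancels the centralizer order, and the sum on the right has
  the single term at the quotient of \<open>la\<close> by \<open>mu\<close>. So the whole matrix of
  the U-component is governed by the entries with \<open>mu\<close> the identity.\<close>

lemma sigma_condition:
  fixes e :: "('g \<times> 'g) set \<Rightarrow> 'k::field_char_0"
  assumes U: "subgroup U G"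
  shows "(\<forall>la\<in>Inj G U. \<forall>mu\<in>Inj G U. Phi G (Delta U la mu) e / of_nat (centralizer_card G (la ` U)) =
        (if Q then (\<Sum>\<alpha>\<in>carrier (AutG G U). if compose U mu \<alpha> = la then x \<alpha> else 0) else 0)) \<longleftrightarrow>
     (\<forall>c\<in>carrier (AutG G U). mk (agraph U c) e = (if Q then x c else 0))" (is "?l \<longleftrightarrow> ?r")
proof -
  let ?A = "AutG G U"
  interpret A: fin_comm_group ?A by (rule AutG_fin_comm_group[OF U])
  have cond: "Phi G (Delta U la mu) e / of_nat (centralizer_card G (la ` U)) =
        (if Q then (\<Sum>\<alpha>\<in>carrier ?A. if compose U mu \<alpha> = la then x \<alpha> else 0) else 0) \<longleftrightarrow>
      mk (agraph U (la \<otimes>\<^bsub>?A\<^esub> inv\<^bsub>?A\<^esub> mu)) e = (if Q then x (la \<otimes>\<^bsub>?A\<^esub> inv\<^bsub>?A\<^esub> mu) else 0)"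
    if la: "la \<in> carrier ?A" and mu: "mu \<in> carrier ?A" for la mu
  proof -
    let ?c = "la \<otimes>\<^bsub>?A\<^esub> inv\<^bsub>?A\<^esub> mu"
    have c: "?c \<in> carrier ?A" using la mu by simp
    have "la ` U \<subseteq> carrier G" using la subgroup.subset[OF U] by (auto simp: carrier_AutG bij_betw_def)
    then have "Phi G (Delta U la mu) e / of_nat (centralizer_card G (la ` U)) = mk (agraph U ?c) e"
      using order_nonzero[where 'k='k] Phi_mk[OF Lam_subgroup[OF agraph_in_Lam[OF U c]], of e]
      by (simp add: centralizer_card_eq Delta_eq[OF U la mu])
    moreover have "(\<Sum>\<alpha>\<in>carrier ?A. if compose U mu \<alpha> = la then x \<alpha> else 0) = x ?c"
    proof -
      have "compose U mu \<alpha> = la \<longleftrightarrow> \<alpha> = ?c" if "\<alpha> \<in> carrier ?A" for \<alpha>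
        unfolding AutG_mult[OF mu that, symmetric]
        using A.inv_solve_left[OF that mu la] A.m_comm[OF la A.inv_closed[OF mu]] by metis
      then have "(\<Sum>\<alpha>\<in>carrier ?A. if compose U mu \<alpha> = la then x \<alpha> else 0) =
          (\<Sum>\<alpha>\<in>carrier ?A. if \<alpha> = ?c then x ?c else 0)"
        by (intro sum.cong) auto
      then show ?thesis using A.fin c by simp
    qed
    ultimately show ?thesis by simp
  qed
  show ?thesis unfolding Inj_eq[OF U]
  proof
    assume l: "\<forall>la\<in>carrier ?A. \<forall>mu\<in>carrier ?A. Phi G (Delta U la mu) e / of_nat (centralizer_card G (la ` U)) =
        (if Q then (\<Sum>\<alpha>\<in>carrier ?A. if compose U mu \<alpha> = la then x \<alpha> else 0) else 0)"
    show ?r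
    proof
      fix c assume c: "c \<in> carrier ?A"
      have c1: "c \<otimes>\<^bsub>?A\<^esub> inv\<^bsub>?A\<^esub> \<one>\<^bsub>?A\<^esub> = c" using c by simp
      show "mk (agraph U c) e = (if Q then x c else 0)"
        by (rule iffD1[OF cond[OF c A.one_closed], unfolded c1]) (rule l[rule_format, OF c A.one_closed])
    qed
  next
    assume r: ?r
    show "\<forall>la\<in>carrier ?A. \<forall>mu\<in>carrier ?A. Phi G (Delta U la mu) e / of_nat (centralizer_card G (la ` U)) =
        (if Q then (\<Sum>\<alpha>\<in>carrier ?A. if compose U mu \<alpha> = la then x \<alpha> else 0) else 0)"
    proof (intro ballI)
      fix la mu assume lm: "la \<in> carrier ?A" "mu \<in> carrier ?A"
      have "la \<otimes>\<^bsub>?A\<^esub> inv\<^bsub>?A\<^esub> mu \<in> carrier ?A" using lm by simp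
      then show "Phi G (Delta U la mu) e / of_nat (centralizer_card G (la ` U)) =
        (if Q then (\<Sum>\<alpha>\<in>carrier ?A. if compose U mu \<alpha> = la then x \<alpha> else 0) else 0)"
        unfolding cond[OF lm] using r by blast
    qed
  qed
qed

text \<open>The defining condition prescribes the marks on \<open>Del\<close> and the support in
  \<open>Del\<close>; by triangularity there is exactly one such element, so the definite
  description denotes it.\<close>

lemma e_idem_mark:
  fixes \<chi> :: "('g \<Rightarrow> 'g) \<Rightarrow> 'k::field_char_0"
  assumes U: "subgroup U G"
  shows "e_idem G U \<chi> \<in> KB_Delta G"
    and "subgroup V G \<Longrightarrow> c \<in> carrier (AutG G V) \<Longrightarrow>
      mk (agraph V c) (e_idem G U \<chi>) = (if V = U then cpi_of (AutG G U) \<chi> c else 0)"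
proof -
  interpret A: fin_comm_group "AutG G U" by (rule AutG_fin_comm_group[OF U])
  let ?x = "cpi_of (AutG G U) \<chi>"
  let ?P = "\<lambda>e :: ('g \<times> 'g) set \<Rightarrow> 'k. e \<in> KB_Delta G \<and> (\<forall>V. subgroup V G \<longrightarrow>
      (\<forall>c\<in>carrier (AutG G V). mk (agraph V c) e = (if V = U then ?x c else 0)))"
  have e_idem: "e_idem G U \<chi> = (THE e. ?P e)"
  proof -
    have "(\<forall>la\<in>Inj G V. \<forall>mu\<in>Inj G V. Phi G (Delta V la mu) e / of_nat (centralizer_card G (la ` V)) =
          (if V = U then (\<Sum>\<alpha>\<in>carrier (AutG G U). if compose U mu \<alpha> = la then ?x \<alpha> else 0) else 0)) \<longleftrightarrow>
       (\<forall>c\<in>carrier (AutG G V). mk (agraph V c) e = (if V = U then ?x c else 0))"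
      if V: "subgroup V G" for V and e :: "('g \<times> 'g) set \<Rightarrow> 'k"
      using sigma_condition[OF V, of e "V = U" ?x] by (cases "V = U") simp_all
    then have eq: "(\<forall>V. subgroup V G \<longrightarrow> (\<forall>la\<in>Inj G V. \<forall>mu\<in>Inj G V.
          Phi G (Delta V la mu) e / of_nat (centralizer_card G (la ` V)) =
          (if V = U then (\<Sum>\<alpha>\<in>carrier (AutG G U). if compose U mu \<alpha> = la then ?x \<alpha> else 0) else 0))) \<longleftrightarrow>
       (\<forall>V. subgroup V G \<longrightarrow> (\<forall>c\<in>carrier (AutG G V). mk (agraph V c) e = (if V = U then ?x c else 0)))"
      for e :: "('g \<times> 'g) set \<Rightarrow> 'k"
      by (rule all_cong1[OF imp_cong[OF refl]])
    show ?thesis unfolding e_idem_def eq ..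
  qed
  \<comment> \<open>The prescribed marks as a function of the subgroup alone; at most one term is
    nonzero, since a graph determines its domain and its automorphism.\<close>
  define v where "v = (\<lambda>N. \<Sum>c\<in>carrier (AutG G U). if agraph U c = N then ?x c else 0)"
  have v: "v (agraph V c) = (if V = U then ?x c else 0)" if c: "c \<in> carrier (AutG G V)" for V c
  proof -
    have "v (agraph V c) = (\<Sum>d\<in>carrier (AutG G U). if d = c then (if V = U then ?x c else 0) else 0)"
      unfolding v_def
    proof (rule sum.cong[OF refl])
      fix d assume d: "d \<in> carrier (AutG G U)"
      show "(if agraph U d = agraph V c then ?x d else 0) = (if d = c then (if V = U then ?x c else 0) else 0)"
        using agraph_inj[OF d c] by (cases "agraph U d = agraph V c") auto
    qed
    then show ?thesis using A.fin c by auto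
  qed
  obtain e :: "('g \<times> 'g) set \<Rightarrow> 'k" where e: "(\<forall>L. L \<notin> Del \<longrightarrow> e L = 0) \<and> (\<forall>N\<in>Del. mk N e = v N)"
    using mk_solvable[OF Del_finite Del_subgroup, of v] by blast
  have Pe: "?P e"
  proof (intro conjI allI impI ballI)
    show "e \<in> KB_Delta G" using e by (auto simp: KB_Delta_iff)
    fix V c assume V: "subgroup V G" "c \<in> carrier (AutG G V)"
    then have "agraph V c \<in> Del" by (auto simp: Del_def)
    then show "mk (agraph V c) e = (if V = U then ?x c else 0)" using e v[OF V(2)] by simp
  qed
  have "e' = e" if e': "?P e'" for e'
  proof (rule mk_determines[of Del])
    fix N assume "N \<in> Del"
    then obtain V c where "subgroup V G" "c \<in> carrier (AutG G V)" "N = agraph V c" by (auto simp: Del_def)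
    then show "mk N e' = mk N e" using e' Pe by simp
  qed (use Del_subgroup e e' in \<open>auto simp: KB_Delta_iff\<close>)
  then have "e_idem G U \<chi> = e" unfolding e_idem using Pe by (intro the_equality) blast+
  then show "e_idem G U \<chi> \<in> KB_Delta G"
    "subgroup V G \<Longrightarrow> c \<in> carrier (AutG G V) \<Longrightarrow>
      mk (agraph V c) (e_idem G U \<chi>) = (if V = U then cpi_of (AutG G U) \<chi> c else 0)"
    using Pe by simp_all
qed

section \<open>The sum of the idempotents belonging to a character of Aut(G)\<close>

lemma mk_sum: "mk N (\<lambda>L. \<Sum>s\<in>S. f s L) = (\<Sum>s\<in>S. mk N (f s))"
  unfolding mk_def by (subst sum.swap) (intro sum.cong refl, simp add: sum_distrib_right)

text \<open>The graph of \<open>c\<close> lies in the graph of \<open>b\<close> iff \<open>b\<close>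
  restricts to \<open>c\<close>, so the mark sums \<open>x\<close> over a fibre of the restriction
  map.\<close>

lemma mk_agraph_zeta:
  assumes U: "subgroup U G" and c: "c \<in> carrier (AutG G U)"
  shows "mk (agraph U c) (zeta x) = push (AutoGroup G) (AutG G U) (p_res G U) x c"
proof -
  interpret A: fin_comm_group "AutoGroup G" by (rule Aut_fin_comm_group)
  have "agraph U c \<subseteq> GA b \<longleftrightarrow> p_res G U b = c" if b: "b \<in> carrier (AutoGroup G)" for b
  proof -
    have "p_res G U b = c \<longleftrightarrow> (\<forall>u\<in>U. c u = b u)"
      unfolding p_res_eq(1)[OF U b] using c by (auto simp: carrier_AutG extensional_def fun_eq_iff)
    then show ?thesis using subgroup.subset[OF U] by (simp add: agraph_subset)
  qed
  then have "mk (agraph U c) (zeta x) = (\<Sum>b\<in>carrier (AutoGroup G). if p_res G U b = c then x b else 0)"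
    unfolding mk_zeta by (intro sum.cong) auto
  then show ?thesis using A.fin c by (simp add: push_def sum.inter_filter)
qed

lemma E_G_iff: "(U, \<chi> :: _ \<Rightarrow> 'k::field_char_0) \<in> E_G G \<longleftrightarrow> subgroup U G \<and> \<chi> \<in> irr_chars (AutG G U)"
  using constituent_all by (auto simp: E_G_def)

text \<open>Both sides are supported on \<open>Del\<close>, so it suffices to compare marks at
  \<open>agraph V c\<close>. On the left only a pair with first component V contributes; on the
  right stands the pushed idempotent of \<open>\<theta>\<close>.\<close>

lemma sum_e_idem:
  fixes \<theta> :: "('g \<Rightarrow> 'g) \<Rightarrow> 'k::field_char_0"
  assumes \<theta>: "\<theta> \<in> irr_chars (AutoGroup G)"
  defines "S \<equiv> {(U, \<chi>) \<in> E_G G. \<forall>\<alpha>\<in>carrier (AutoGroup G). \<theta> \<alpha> = \<chi> (p_res G U \<alpha>)}"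
  shows "(\<lambda>N. \<Sum>(U, \<chi>)\<in>S. e_idem G U \<chi> N) = zeta (cpi_of (AutoGroup G) \<theta>)"
proof -
  let ?A = "AutoGroup G"
  have S: "(U, \<chi>) \<in> S \<longleftrightarrow> subgroup U G \<and> \<chi> \<in> irr_chars (AutG G U) \<and>
      (\<forall>\<alpha>\<in>carrier ?A. \<theta> \<alpha> = \<chi> (p_res G U \<alpha>))" for U \<chi>
    by (simp add: S_def E_G_iff)
  \<comment> \<open>As Aut(G) maps onto Aut(U), a character inflated to \<open>\<theta>\<close> is
    determined by \<open>\<theta>\<close>: each U occurs at most once.\<close>
  have unique: "\<chi> = \<psi>" if s: "(U, \<chi>) \<in> S" "(U, \<psi>) \<in> S" for U \<chi> \<psi>
  proof
    fix b
    show "\<chi> b = \<psi> b"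
    proof (cases "b \<in> carrier (AutG G U)")
      case True
      then obtain a where "a \<in> carrier ?A" "b = p_res G U a"
        using p_res_surj[of U] s S by blast
      then show ?thesis using s S by metis
    next
      case False
      then show ?thesis using s S by (auto simp: irr_chars_def character_def)
    qed
  qed
  \<comment> \<open>Finiteness has to be established, as a sum over an infinite set would silently
    be 0; \<open>S\<close> injects into the set of subgroups.\<close>
  have "finite (fst ` S)"
  proof (rule finite_subset)
    show "fst ` S \<subseteq> Pow (carrier G)" using S subgroup.subset by fastforce
  qed (use finG in simp)
  moreover have "inj_on fst S" using unique by (auto simp: inj_on_def)
  ultimately have finS: "finite S" by (rule finite_imageD)
  show ?thesis
  proof (rule mk_determines[of Del])
    fix L :: "('g \<times> 'g) set" assume L: "L \<notin> Del"
    have "e_idem G U \<chi> L = 0" if "(U, \<chi>) \<in> S" for U \<chi>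
      using e_idem_mark(1)[of U \<chi>] that S L by (auto simp: KB_Delta_iff)
    then show "(\<Sum>(U, \<chi>)\<in>S. e_idem G U \<chi> L) = 0" by (intro sum.neutral) auto
    have "GA b \<in> Del" if "b \<in> carrier ?A" for b
      unfolding Del_def using subgroup_self that AutG_carrier by fastforce
    then show "zeta (cpi_of ?A \<theta>) L = 0" using zeta_support L by blast
  next
    fix N assume "N \<in> Del"
    then obtain V c where V: "subgroup V G" and c: "c \<in> carrier (AutG G V)" and N: "N = agraph V c"
      by (auto simp: Del_def)
    have "mk N (\<lambda>L. \<Sum>s\<in>S. (\<lambda>(U, \<chi>). e_idem G U \<chi> L) s) =
        (\<Sum>s\<in>S. mk N (\<lambda>L. (\<lambda>(U, \<chi>). e_idem G U \<chi> L) s))" by (rule mk_sum)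
    also have "\<dots> = (\<Sum>(U, \<chi>)\<in>S. if V = U then cpi_of (AutG G U) \<chi> c else 0)"
      unfolding N by (rule sum.cong[OF refl]) (auto simp: S e_idem_mark(2)[OF _ V c])
    also have "\<dots> = push ?A (AutG G V) (p_res G V) (cpi_of ?A \<theta>) c"
    proof (cases "\<exists>\<psi>. (V, \<psi>) \<in> S")
      case True
      then obtain \<psi> where \<psi>: "(V, \<psi>) \<in> S" by blast
      have "(\<Sum>(U, \<chi>)\<in>S. if V = U then cpi_of (AutG G U) \<chi> c else 0) =
          (\<Sum>s\<in>S. if s = (V, \<psi>) then cpi_of (AutG G V) \<psi> c else 0)"
      proof (rule sum.cong[OF refl])
        fix s assume "s \<in> S"
        moreover obtain U \<chi> where "s = (U, \<chi>)" by (cases s)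
        ultimately show "(case s of (U, \<chi>) \<Rightarrow> if V = U then cpi_of (AutG G U) \<chi> c else 0) =
            (if s = (V, \<psi>) then cpi_of (AutG G V) \<psi> c else 0)"
          using unique[OF \<psi>, of \<chi>] by (cases "V = U") simp_all
      qed
      also have "\<dots> = cpi_of (AutG G V) \<psi> c" using finS \<psi> by simp
      also have "\<dots> = push ?A (AutG G V) (p_res G V) (cpi_of ?A \<theta>) c"
        using push_cpi_of(1)[OF Aut_fin_comm_group AutG_fin_comm_group[OF V] p_res_hom[OF V] p_res_surj[OF V] \<theta>, of \<psi>]
          \<psi> S by simp
      finally show ?thesis .
    \<comment> \<open>No character of Aut(V) inflates to \<open>\<theta>\<close>: the left sum has
      no term for V, and the pushed idempotent is 0.\<close>
    next
      case False
      then have "(\<Sum>(U, \<chi>)\<in>S. if V = U then cpi_of (AutG G U) \<chi> c else 0) = 0"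
        by (intro sum.neutral) auto
      moreover have "push ?A (AutG G V) (p_res G V) (cpi_of ?A \<theta>) = (\<lambda>_. 0)"
        by (rule push_cpi_of(2)[OF Aut_fin_comm_group AutG_fin_comm_group[OF V] p_res_hom[OF V] p_res_surj[OF V] \<theta>])
          (use False S V in blast)
      ultimately show ?thesis by simp
    qed
    also have "\<dots> = mk N (zeta (cpi_of ?A \<theta>))" unfolding N mk_agraph_zeta[OF V c] ..
    finally show "mk N (\<lambda>N. \<Sum>(U, \<chi>)\<in>S. e_idem G U \<chi> N) = mk N (zeta (cpi_of ?A \<theta>))" .
  qed (rule Del_subgroup)
qed

end

theorem theorem7p2:
  fixes G :: "'g monoid" and n :: nat
  assumes "group G" and "cyclic_group G" and "n > 0" and "order G = n"
  shows "(\<forall>U (\<chi> :: ('g \<Rightarrow> 'g) \<Rightarrow> 'k::field_char_0).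
            subgroup U G \<and> \<chi> \<in> irr_chars (AutG G U) \<longrightarrow> (U, \<chi>) \<in> E_G G)
       \<and> bij_betw
           (\<lambda>\<theta>. (\<lambda>N. \<Sum>(U, \<chi>)\<in>{(U, \<chi>) \<in> E_G G. \<forall>\<alpha>\<in>carrier (AutoGroup G). \<theta> \<alpha> = \<chi> (p_res G U \<alpha>)}.
                       e_idem G U \<chi> N))
           (irr_chars (AutoGroup G) :: (('g \<Rightarrow> 'g) \<Rightarrow> 'k) set)
           {e. primitive_central_idem (KB_lhd G) (bmult G) e}"
proof -
  have "finite (carrier G)" using assms(3,4) by (metis card.infinite less_irrefl order_def)
  then interpret fin_cyclic_group G
    using group.cyclic_imp_abelian_group[OF assms(1,2)] assms(2)
    by (simp add: fin_cyclic_group_def fin_cyclic_group_axioms_def)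
  interpret A: fin_comm_group "AutoGroup G" by (rule Aut_fin_comm_group)
  have "bij_betw (\<lambda>\<theta>. zeta (cpi_of (AutoGroup G) \<theta>)) (irr_chars (AutoGroup G) :: (('g \<Rightarrow> 'g) \<Rightarrow> 'k) set)
      {e. primitive_central_idem (KB_lhd G) (bmult G) e}"
    using bij_betw_trans[OF A.cpi_of_bij zeta_bij_pci] unfolding comp_def .
  then have "bij_betw
           (\<lambda>\<theta>. (\<lambda>N. \<Sum>(U, \<chi>)\<in>{(U, \<chi>) \<in> E_G G. \<forall>\<alpha>\<in>carrier (AutoGroup G). \<theta> \<alpha> = \<chi> (p_res G U \<alpha>)}.
                       e_idem G U \<chi> N))
           (irr_chars (AutoGroup G) :: (('g \<Rightarrow> 'g) \<Rightarrow> 'k) set)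
           {e. primitive_central_idem (KB_lhd G) (bmult G) e}"
    by (subst bij_betw_cong[OF sum_e_idem])
  then show ?thesis using E_G_iff by blast
qed

end
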